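(* Let $\varphi$ be a holomorphic quadratic form on $\mathbf{C}^n_x\times\mathbf{C}^n_y$ with $\det\varphi''_{xy}\neq 0$ and $\operatorname{Im}\varphi''_{yy}>0$, let $\Phi(x)=\sup_{y\in\mathbf{R}^n}(-\operatorname{Im}\varphi(x,y))$, and for $C>0$ let $$Tu(x;h)=Ch^{-3n/4}\int_{\mathbf{R}^n} e^{i\varphi(x,y)/h}u(y)\,dy,\qquad x\in\mathbf{C}^n,\ 0<h\le 1.$$ If the constant $C>0$ (independent of $h$) is suitably chosen, then $T$ is unitary, $$T: L^2(\mathbf{R}^n)\to H_\Phi(\mathbf{C}^n).$$
   Context: A holomorphic quadratic form is a complex-valued homogeneous quadratic polynomial. $\varphi''_{xy}$, $\varphi''_{yy}$ denote the (constant) matrices of second derivatives; $\operatorname{Im}\varphi''_{yy}>0$ means that the real symmetric matrix of imaginary parts is positive definite. The operator $T$ maps $\mathcal{S}'(\mathbf{R}^n)$ (hence $L^2(\mathbf{R}^n)$) into $\operatorname{Hol}(\mathbf{C}^n)$, the space of entire functions. $H_\Phi(\mathbf{C}^n):=\operatorname{Hol}(\mathbf{C}^n)\cap L^2(\mathbf{C}^n,e^{-2\Phi/h}L(dx))$ with the norm of $L^2(\mathbf{C}^n,e^{-2\Phi/h}L(dx))$, where $L(dx)$ is the Lebesgue measure on $\mathbf{C}^n$. *)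

theory Defs
  imports "HOL-Analysis.Analysis"
begin

unbundle no fps_syntax

definition holomorphic_quadratic_form ::
    "(complex^'n \<Rightarrow> complex^'n \<Rightarrow> complex) \<Rightarrow> bool" where
  "holomorphic_quadratic_form \<phi> \<longleftrightarrow>
     (\<exists>A B D :: complex^'n^'n. \<forall>x y.
        \<phi> x y = (\<Sum>i\<in>UNIV. \<Sum>j\<in>UNIV. A $ i $ j * x $ i * x $ j)
              + (\<Sum>i\<in>UNIV. \<Sum>j\<in>UNIV. B $ i $ j * x $ i * y $ j)
              + (\<Sum>i\<in>UNIV. \<Sum>j\<in>UNIV. D $ i $ j * y $ i * y $ j))"

text \<open>Matrices of second complex partial derivatives at the point \<open>(x, y)\<close>; the
  increment in the \<open>i\<close>-th coordinate is \<open>axis i s\<close>. For a quadratic form they do not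
  depend on the point, see \<open>phi_xy_quadratic\<close> and \<open>phi_yy_quadratic\<close> below.\<close>

definition phi_xy ::
    "(complex^'n \<Rightarrow> complex^'n \<Rightarrow> complex) \<Rightarrow> complex^'n \<Rightarrow> complex^'n \<Rightarrow> complex^'n^'n" where
  "phi_xy \<phi> x y =
     (\<chi> i j. deriv (\<lambda>s. deriv (\<lambda>t. \<phi> (x + axis i s) (y + axis j t)) 0) 0)"

definition phi_yy ::
    "(complex^'n \<Rightarrow> complex^'n \<Rightarrow> complex) \<Rightarrow> complex^'n \<Rightarrow> complex^'n \<Rightarrow> complex^'n^'n" where
  "phi_yy \<phi> x y =
     (\<chi> i j. deriv (\<lambda>s. deriv (\<lambda>t. \<phi> x (y + axis i s + axis j t)) 0) 0)"

definition pos_def_matrix :: "real^'n^'n \<Rightarrow> bool" where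
  "pos_def_matrix A \<longleftrightarrow> transpose A = A \<and> (\<forall>v. v \<noteq> 0 \<longrightarrow> 0 < v \<bullet> (A *v v))"

definition Im_matrix :: "complex^'n^'m \<Rightarrow> real^'n^'m" where
  "Im_matrix A = (\<chi> i j. Im (A $ i $ j))"

definition of_real_vec :: "real^'n \<Rightarrow> complex^'n" where
  "of_real_vec y = (\<chi> i. complex_of_real (y $ i))"

text \<open>The supremum is taken in \<open>real\<close>; the set is bounded above when
  \<open>Im \<phi>''\<^sub>y\<^sub>y\<close> is positive definite.\<close>

definition Phi_weight :: "(complex^'n \<Rightarrow> complex^'n \<Rightarrow> complex) \<Rightarrow> complex^'n \<Rightarrow> real" where
  "Phi_weight \<phi> x = (SUP y. - Im (\<phi> x (of_real_vec y)))"

text \<open>Square-integrable functions, as functions rather than as classes modulo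
  almost everywhere equality.\<close>

definition L2 :: "'a measure \<Rightarrow> ('a \<Rightarrow> complex) set" where
  "L2 M = {u \<in> borel_measurable M. integrable M (\<lambda>x. (norm (u x))\<^sup>2)}"

definition L2_inner :: "'a measure \<Rightarrow> ('a \<Rightarrow> complex) \<Rightarrow> ('a \<Rightarrow> complex) \<Rightarrow> complex" where
  "L2_inner M u v = (LINT x|M. u x * cnj (v x))"

text \<open>Functions on \<open>\<complex>\<^sup>n\<close> that have a complex-linear Frechet derivative everywhere; the library's
  \<open>holomorphic_on\<close> covers one variable only.\<close>

definition Hol :: "(complex^'n \<Rightarrow> complex) set" where
  "Hol = {f. \<forall>x. \<exists>f'. (f has_derivative f') (at x) \<and> (\<forall>c v. f' (c *s v) = c * f' v)}"

definition weighted_lebesgue :: "(complex^'n \<Rightarrow> real) \<Rightarrow> real \<Rightarrow> (complex^'n) measure" where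
  "weighted_lebesgue \<Phi> h = density lebesgue (\<lambda>x. ennreal (exp (- 2 * \<Phi> x / h)))"

definition H_space :: "(complex^'n \<Rightarrow> real) \<Rightarrow> real \<Rightarrow> (complex^'n \<Rightarrow> complex) set" where
  "H_space \<Phi> h = Hol \<inter> L2 (weighted_lebesgue \<Phi> h)"

definition FBI_transform ::
    "(complex^'n \<Rightarrow> complex^'n \<Rightarrow> complex) \<Rightarrow> real \<Rightarrow> real \<Rightarrow>
     (real^'n \<Rightarrow> complex) \<Rightarrow> complex^'n \<Rightarrow> complex" where
  "FBI_transform \<phi> C h u x =
     complex_of_real (C * h powr (- 3 * real CARD('n) / 4)) *
       (LINT y|lebesgue. exp (\<i> * \<phi> x (of_real_vec y) / complex_of_real h) * u y)"

text \<open>\<open>T\<close> induces a unitary operator from \<open>L\<^sup>2(M)\<close>, taken modulo almost everywhere equality,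
  onto the space \<open>W \<subseteq> L\<^sup>2(N)\<close> with the inner product of \<open>L\<^sup>2(N)\<close>. Elements of \<open>W\<close> are genuine
  functions, so equality in \<open>W\<close> is pointwise; this is meant for spaces, such as \<open>H_space\<close>, in
  which functions equal almost everywhere coincide. Injectivity on classes follows from the
  preservation of inner products.\<close>

definition unitary_L2_onto ::
    "'a measure \<Rightarrow> 'b measure \<Rightarrow> ('b \<Rightarrow> complex) set \<Rightarrow>
     (('a \<Rightarrow> complex) \<Rightarrow> 'b \<Rightarrow> complex) \<Rightarrow> bool" where
  "unitary_L2_onto M N W T \<longleftrightarrow>
     (\<forall>u\<in>L2 M. \<forall>v\<in>L2 M. (AE x in M. u x = v x) \<longrightarrow> T u = T v) \<and>
     (\<forall>u\<in>L2 M. \<forall>v\<in>L2 M. \<forall>a b.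
        T (\<lambda>x. a * u x + b * v x) = (\<lambda>z. a * T u z + b * T v z)) \<and>
     (\<forall>u\<in>L2 M. \<forall>v\<in>L2 M. L2_inner N (T u) (T v) = L2_inner M u v) \<and>
     W \<subseteq> L2 N \<and> T ` L2 M = W"

lemma has_deriv_axis [derivative_intros]:
  "((\<lambda>t. (axis j t :: complex^'n) $ k) has_field_derivative (if k = j then 1 else 0)) (at s)"
  by (cases "k = j") (auto simp: axis_def)

lemma axis_zero_nth: "(axis j 0 :: complex^'n) $ k = 0"
  by (simp add: axis_def)

lemma phi_xy_quadratic:
  fixes A B D :: "complex^'n^'n"
  assumes "\<And>x y. \<phi> x y = (\<Sum>i\<in>UNIV. \<Sum>j\<in>UNIV. A $ i $ j * x $ i * x $ j)
              + (\<Sum>i\<in>UNIV. \<Sum>j\<in>UNIV. B $ i $ j * x $ i * y $ j)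
              + (\<Sum>i\<in>UNIV. \<Sum>j\<in>UNIV. D $ i $ j * y $ i * y $ j)"
  shows "phi_xy \<phi> x y = B"
proof -
  have "deriv (\<lambda>s. deriv (\<lambda>t. \<phi> (x + axis i s) (y + axis j t)) 0) 0 = B $ i $ j" for i j
  proof -
    have "((\<lambda>t. \<phi> (x + axis i s) (y + axis j t)) has_field_derivative
        (\<Sum>k\<in>UNIV. B $ k $ j * (x + axis i s) $ k)
        + (\<Sum>k\<in>UNIV. D $ k $ j * y $ k) + (\<Sum>k\<in>UNIV. D $ j $ k * y $ k)) (at 0)" for s
      unfolding assms
      by (rule derivative_eq_intros refl | simp)+
         (simp add: mult_delta_left mult_delta_right axis_zero_nth sum.distrib, (subst sum.swap)?, simp?)
    then have "deriv (\<lambda>t. \<phi> (x + axis i s) (y + axis j t)) 0 =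
        (\<Sum>k\<in>UNIV. B $ k $ j * (x + axis i s) $ k)
        + (\<Sum>k\<in>UNIV. D $ k $ j * y $ k) + (\<Sum>k\<in>UNIV. D $ j $ k * y $ k)" for s
      by (rule DERIV_imp_deriv)
    moreover have "((\<lambda>s. (\<Sum>k\<in>UNIV. B $ k $ j * (x + axis i s) $ k)
        + (\<Sum>k\<in>UNIV. D $ k $ j * y $ k) + (\<Sum>k\<in>UNIV. D $ j $ k * y $ k))
        has_field_derivative B $ i $ j) (at 0)"
      by (rule derivative_eq_intros refl | simp)+
         (simp add: mult_delta_left mult_delta_right sum.distrib)
    ultimately show ?thesis
      by (simp add: DERIV_imp_deriv)
  qed
  then show ?thesis
    by (simp add: phi_xy_def vec_eq_iff)
qed

lemma phi_yy_quadratic: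
  fixes A B D :: "complex^'n^'n"
  assumes "\<And>x y. \<phi> x y = (\<Sum>i\<in>UNIV. \<Sum>j\<in>UNIV. A $ i $ j * x $ i * x $ j)
              + (\<Sum>i\<in>UNIV. \<Sum>j\<in>UNIV. B $ i $ j * x $ i * y $ j)
              + (\<Sum>i\<in>UNIV. \<Sum>j\<in>UNIV. D $ i $ j * y $ i * y $ j)"
  shows "phi_yy \<phi> x y = D + transpose D"
proof -
  have "deriv (\<lambda>s. deriv (\<lambda>t. \<phi> x (y + axis i s + axis j t)) 0) 0 = D $ i $ j + D $ j $ i" for i j
  proof -
    have "((\<lambda>t. \<phi> x (y + axis i s + axis j t)) has_field_derivative
        (\<Sum>k\<in>UNIV. B $ k $ j * x $ k)
        + (\<Sum>k\<in>UNIV. D $ k $ j * (y + axis i s) $ k)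
        + (\<Sum>k\<in>UNIV. D $ j $ k * (y + axis i s) $ k)) (at 0)" for s
      unfolding assms
      by (rule derivative_eq_intros refl | simp)+
         (simp add: mult_delta_left mult_delta_right axis_zero_nth sum.distrib, (subst sum.swap)?, simp?)
    then have "deriv (\<lambda>t. \<phi> x (y + axis i s + axis j t)) 0 =
        (\<Sum>k\<in>UNIV. B $ k $ j * x $ k)
        + (\<Sum>k\<in>UNIV. D $ k $ j * (y + axis i s) $ k)
        + (\<Sum>k\<in>UNIV. D $ j $ k * (y + axis i s) $ k)" for s
      by (rule DERIV_imp_deriv)
    moreover have "((\<lambda>s. (\<Sum>k\<in>UNIV. B $ k $ j * x $ k)
        + (\<Sum>k\<in>UNIV. D $ k $ j * (y + axis i s) $ k)
        + (\<Sum>k\<in>UNIV. D $ j $ k * (y + axis i s) $ k))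
        has_field_derivative D $ i $ j + D $ j $ i) (at 0)"
      by (rule derivative_eq_intros refl | simp)+
         (simp add: mult_delta_left mult_delta_right sum.distrib)
    ultimately show ?thesis
      by (simp add: DERIV_imp_deriv)
  qed
  then show ?thesis
    by (simp add: phi_yy_def vec_eq_iff transpose_def)
qed

end

theory Submission
  imports Defs "HOL-Complex_Analysis.Complex_Analysis" "HOL-Probability.Distributions"
begin

unbundle no fps_syntax

text \<open>
  Every transform \<open>T\<close> of this kind is the Bargmann transform in disguise. Choose a basis of
  \<open>\<real>\<^sup>n\<close> that is orthonormal for \<open>Im \<phi>''\<^sub>y\<^sub>y\<close> and scale it by \<open>sqrt h\<close>; since \<open>\<phi>''\<^sub>x\<^sub>y\<close> is
  invertible, there is a complex linear coordinate \<open>z\<close> on \<open>\<complex>\<^sup>n\<close> in which the mixed term of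
  \<open>\<phi> / h\<close> is \<open>z \<cdot> v\<close>. What is left of \<open>\<phi>\<close> splits off as a unimodular function of the real
  variable, acting unitarily on \<open>L\<^sup>2(\<real>\<^sup>n)\<close>, and as a nowhere vanishing entire function of \<open>x\<close>,
  whose modulus turns the weight \<open>e\<^bsup>-2\<Phi>/h\<^esup>\<close> into the Gaussian \<open>e\<^bsup>-|z|\<^sup>2/2\<^esup>\<close>
  (\<open>Phi_weight_eq\<close>, \<open>unitary_transfer\<close>). The Jacobians contribute powers of \<open>h\<close> that cancel
  against \<open>h\<^bsup>-3n/4\<^esup>\<close>, so that \<open>C\<close> does not depend on \<open>h\<close>.

  For the Bargmann transform \<open>B\<close>, write \<open>B u w\<close> as the inner product of \<open>u\<close> with the coherent state
  \<open>k\<^sub>w\<close>. A Gaussian integral gives \<open>B k\<^sub>w = g K\<^sub>w\<close> with \<open>g > 0\<close> and \<open>K\<^sub>w(z) = e\<^bsup>z \<cdot> cnj w / 2\<^esup>\<close>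
  (\<open>bargmann_coherent_state\<close>), and the mean value property of entire functions shows that \<open>K\<^sub>w\<close> is,
  up to a constant \<open>m > 0\<close>, the reproducing kernel of the Fock space (\<open>fock_reproducing\<close>).
  Since \<open>|K\<^sub>w(z)|\<close> is a convolution kernel once the weight is distributed symmetrically, the Schur
  test makes \<open>B\<close> bounded (\<open>bargmann_sqnorm_le\<close>), so \<open>B\<close> has an adjoint \<open>B\<^sup>*\<close> by the Riesz
  representation theorem. For \<open>f\<close> in the Fock space,
  \<open>B B\<^sup>* f (w) = \<langle>B\<^sup>* f, k\<^sub>w\<rangle> = \<langle>f, B k\<^sub>w\<rangle> = g m f(w)\<close>, hence \<open>B\<close> is onto. Applying this to
  \<open>f = B u\<close> gives \<open>B (B\<^sup>* B u - g m u) = 0\<close>; as \<open>B\<close> is injective, which is the uniqueness of Fourier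
  transforms, \<open>B\<^sup>* B = g m\<close> and \<open>B\<close> is an isometry up to the factor \<open>sqrt (g m)\<close>.
\<close>

section \<open>Square integrable functions and the Riesz representation theorem\<close>

definition L2_sqnorm :: "'a measure \<Rightarrow> ('a \<Rightarrow> complex) \<Rightarrow> real" where
  "L2_sqnorm M u = (LINT x|M. (norm (u x))\<^sup>2)"

lemma L2_measurable: "u \<in> L2 M \<Longrightarrow> u \<in> borel_measurable M"
  by (simp add: L2_def)

lemma L2_integrable_sqnorm: "u \<in> L2 M \<Longrightarrow> integrable M (\<lambda>x. (norm (u x))\<^sup>2)"
  by (simp add: L2_def)

lemma L2_sqnorm_nonneg: "0 \<le> L2_sqnorm M u"
  by (simp add: L2_sqnorm_def)

lemma integrable_dominated:
  fixes g :: "'a \<Rightarrow> 'b::{banach, second_countable_topology}"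
  assumes "g \<in> borel_measurable M" "\<And>x. norm (g x) \<le> f x" "integrable M (f :: 'a \<Rightarrow> real)"
  shows "integrable M g"
proof (rule Bochner_Integration.integrable_bound[OF assms(3,1)])
  show "AE x in M. norm (g x) \<le> norm (f x)"
    by (rule AE_I2) (metis assms(2) abs_ge_self order_trans real_norm_def)
qed

lemma two_mult_le_power2_sum: "2 * (a * b) \<le> a\<^sup>2 + (b::real)\<^sup>2"
  using sum_squares_bound[of a b] by (simp add: mult.assoc)

lemma L2_product_integrable:
  assumes "u \<in> L2 M" "v \<in> L2 M"
  shows "integrable M (\<lambda>x. u x * v x)"
proof -
  note [measurable] = L2_measurable[OF assms(1)] L2_measurable[OF assms(2)]
  show ?thesis
  proof (rule Bochner_Integration.integrable_bound)
    show "integrable M (\<lambda>x. (norm (u x))\<^sup>2 + (norm (v x))\<^sup>2)"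
      using assms by (intro Bochner_Integration.integrable_add L2_integrable_sqnorm)
    have "norm (u x) * norm (v x) \<le> (norm (u x))\<^sup>2 + (norm (v x))\<^sup>2" for x
      using two_mult_le_power2_sum[of "norm (u x)" "norm (v x)"]
        mult_nonneg_nonneg[OF norm_ge_zero norm_ge_zero, of "u x" "v x"] by linarith
    then show "AE x in M. norm (u x * v x) \<le> norm ((norm (u x))\<^sup>2 + (norm (v x))\<^sup>2)"
      by (simp add: norm_mult)
  qed measurable
qed

lemma borel_measurable_cnj [measurable]:
  "f \<in> borel_measurable M \<Longrightarrow> (\<lambda>x. cnj (f x)) \<in> borel_measurable M"
  by (erule measurable_compose[OF _ borel_measurable_continuous_onI[of cnj]])
     (rule continuous_on_cnj[OF continuous_on_id])

lemma L2_cnj: "u \<in> L2 M \<Longrightarrow> (\<lambda>x. cnj (u x)) \<in> L2 M"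
  by (auto simp: L2_def)

lemma L2_scale:
  assumes "u \<in> L2 M" shows "(\<lambda>x. a * u x) \<in> L2 M"
proof -
  note [measurable] = L2_measurable[OF assms]
  have "integrable M (\<lambda>x. (norm a)\<^sup>2 * (norm (u x))\<^sup>2)"
    using L2_integrable_sqnorm[OF assms] by simp
  then show ?thesis by (simp add: L2_def norm_mult power_mult_distrib)
qed

lemma L2_add:
  assumes "u \<in> L2 M" "v \<in> L2 M" shows "(\<lambda>x. u x + v x) \<in> L2 M"
proof -
  note [measurable] = L2_measurable[OF assms(1)] L2_measurable[OF assms(2)]
  have "(norm (u x + v x))\<^sup>2 \<le> 2 * (norm (u x))\<^sup>2 + 2 * (norm (v x))\<^sup>2" for x
  proof -
    have "(norm (u x + v x))\<^sup>2 \<le> (norm (u x) + norm (v x))\<^sup>2"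
      by (intro power_mono norm_triangle_ineq) simp
    then show ?thesis
      using two_mult_le_power2_sum[of "norm (u x)" "norm (v x)"] by (simp add: power2_sum)
  qed
  moreover have int: "integrable M (\<lambda>x. 2 * (norm (u x))\<^sup>2 + 2 * (norm (v x))\<^sup>2)"
    using L2_integrable_sqnorm[OF assms(1)] L2_integrable_sqnorm[OF assms(2)] by simp
  ultimately have "integrable M (\<lambda>x. (norm (u x + v x))\<^sup>2)"
    by (intro integrable_dominated[OF _ _ int]) simp_all
  then show ?thesis by (simp add: L2_def)
qed

lemma L2_lincomb:
  "u \<in> L2 M \<Longrightarrow> v \<in> L2 M \<Longrightarrow> (\<lambda>x. a * u x + b * v x) \<in> L2 M"
  by (intro L2_add L2_scale)

lemma L2_diff:
  "u \<in> L2 M \<Longrightarrow> v \<in> L2 M \<Longrightarrow> (\<lambda>x. u x - v x) \<in> L2 M"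
  using L2_lincomb[of u M v 1 "-1"] by simp

lemma L2_inner_self: "L2_inner M u u = complex_of_real (L2_sqnorm M u)"
  unfolding L2_inner_def L2_sqnorm_def
  by (simp only: complex_norm_square[symmetric] integral_complex_of_real)

lemma L2_inner_integrable:
  "u \<in> L2 M \<Longrightarrow> v \<in> L2 M \<Longrightarrow> integrable M (\<lambda>x. u x * cnj (v x))"
  using L2_product_integrable[OF _ L2_cnj] by blast

lemma L2_inner_lincomb_left:
  assumes "u \<in> L2 M" "v \<in> L2 M" "w \<in> L2 M"
  shows "L2_inner M (\<lambda>x. a * u x + b * v x) w = a * L2_inner M u w + b * L2_inner M v w"
proof -
  note int = L2_inner_integrable[OF assms(1,3)] L2_inner_integrable[OF assms(2,3)]
  have "L2_inner M (\<lambda>x. a * u x + b * v x) w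
      = (LINT x|M. a * (u x * cnj (w x)) + b * (v x * cnj (w x)))"
    by (simp add: L2_inner_def algebra_simps)
  also have "\<dots> = a * L2_inner M u w + b * L2_inner M v w"
    unfolding L2_inner_def using int
    by (subst Bochner_Integration.integral_add) (simp_all add: integrable_mult_right)
  finally show ?thesis .
qed

lemma L2_inner_commute: "L2_inner M v u = cnj (L2_inner M u v)"
proof -
  have "cnj (L2_inner M u v) = (LINT x|M. cnj (u x * cnj (v x)))"
    unfolding L2_inner_def by (rule Bochner_Integration.integral_cnj[symmetric])
  then show ?thesis by (simp add: L2_inner_def mult.commute)
qed

lemma L2_inner_lincomb_right:
  assumes "u \<in> L2 M" "v \<in> L2 M" "w \<in> L2 M"
  shows "L2_inner M w (\<lambda>x. a * u x + b * v x) = cnj a * L2_inner M w u + cnj b * L2_inner M w v"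
proof -
  have "L2_inner M w (\<lambda>x. a * u x + b * v x) = cnj (L2_inner M (\<lambda>x. a * u x + b * v x) w)"
    by (rule L2_inner_commute)
  also have "\<dots> = cnj a * cnj (L2_inner M u w) + cnj b * cnj (L2_inner M v w)"
    unfolding L2_inner_lincomb_left[OF assms] by simp
  finally show ?thesis by (simp only: L2_inner_commute[of M w, symmetric])
qed

text \<open>Deduced from the Cauchy--Schwarz inequality for nonnegative extended integrals, since both
  factors are finite there.\<close>

lemma L2_Cauchy_Schwarz:
  assumes "u \<in> L2 M" "v \<in> L2 M"
  shows "(norm (L2_inner M u v))\<^sup>2 \<le> L2_sqnorm M u * L2_sqnorm M v"
proof -
  note [measurable] = L2_measurable[OF assms(1)] L2_measurable[OF assms(2)]
  let ?I = "LINT x|M. norm (u x) * norm (v x)"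
  have int: "integrable M (\<lambda>x. norm (u x) * norm (v x))"
    using integrable_norm[OF L2_product_integrable[OF assms]] by (simp add: norm_mult)
  have I0: "0 \<le> ?I" by (intro integral_nonneg_AE) auto
  have "norm (L2_inner M u v) \<le> ?I"
    unfolding L2_inner_def using integral_norm_bound[of M "\<lambda>x. u x * cnj (v x)"]
    by (simp add: norm_mult)
  then have "(norm (L2_inner M u v))\<^sup>2 \<le> ?I\<^sup>2" by (intro power_mono) auto
  also have "?I\<^sup>2 \<le> L2_sqnorm M u * L2_sqnorm M v"
  proof -
    have "ennreal (?I\<^sup>2) = (\<integral>\<^sup>+x. ennreal (norm (u x)) * ennreal (norm (v x)) \<partial>M)\<^sup>2"
      using nn_integral_eq_integral[OF int] I0 by (simp add: ennreal_mult' ennreal_power)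
    also have "\<dots> \<le> (\<integral>\<^sup>+x. (ennreal (norm (u x)))\<^sup>2 \<partial>M) * (\<integral>\<^sup>+x. (ennreal (norm (v x)))\<^sup>2 \<partial>M)"
      by (rule Cauchy_Schwarz_nn_integral) measurable
    also have "\<dots> = ennreal (L2_sqnorm M u) * ennreal (L2_sqnorm M v)"
      unfolding L2_sqnorm_def
      using nn_integral_eq_integral[OF L2_integrable_sqnorm[OF assms(1)]]
        nn_integral_eq_integral[OF L2_integrable_sqnorm[OF assms(2)]]
      by (simp add: ennreal_power)
    also have "\<dots> = ennreal (L2_sqnorm M u * L2_sqnorm M v)"
      by (simp add: ennreal_mult L2_sqnorm_nonneg)
    finally show ?thesis
      by (subst (asm) ennreal_le_iff) (auto intro: mult_nonneg_nonneg L2_sqnorm_nonneg)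
  qed
  finally show ?thesis .
qed

lemma L2_sqnorm_lincomb:
  assumes "u \<in> L2 M" "v \<in> L2 M"
  shows "L2_sqnorm M (\<lambda>x. a * u x + b * v x) =
    (norm a)\<^sup>2 * L2_sqnorm M u + (norm b)\<^sup>2 * L2_sqnorm M v + 2 * Re (a * cnj b * L2_inner M u v)"
proof -
  have "complex_of_real (L2_sqnorm M (\<lambda>x. a * u x + b * v x))
      = a * cnj a * L2_inner M u u + b * cnj b * L2_inner M v v
        + (a * cnj b * L2_inner M u v + cnj (a * cnj b * L2_inner M u v))"
    using assms
    by (simp add: L2_inner_lincomb_left L2_inner_lincomb_right L2_lincomb L2_inner_commute[of M v u]
        algebra_simps flip: L2_inner_self)
  also have "\<dots> = complex_of_real ((norm a)\<^sup>2 * L2_sqnorm M u + (norm b)\<^sup>2 * L2_sqnorm M v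
      + 2 * Re (a * cnj b * L2_inner M u v))"
    by (simp only: complex_add_cnj L2_inner_self complex_norm_square[symmetric]) simp
  finally show ?thesis by (simp only: of_real_eq_iff)
qed

text \<open>Cauchy--Schwarz with the weights \<open>2\<^sup>k\<close>: telescoping sums of a sequence with
  square summable weighted increments have geometrically small tails.\<close>

lemma power2_sum_le_weighted:
  fixes d :: "nat \<Rightarrow> real"
  shows "(\<Sum>k\<in>{n..<m}. d k)\<^sup>2 \<le> (2 / 2 ^ n) * (\<Sum>k\<in>{n..<m}. 2 ^ k * (d k)\<^sup>2)"
proof -
  have geo: "(\<Sum>k\<in>{n..<m}. (1/2::real) ^ k) \<le> 2 / 2 ^ n"
  proof (cases "n \<le> m")
    case True
    then have "(\<Sum>k\<in>{n..<m}. (1/2::real) ^ k) = 2 / 2 ^ n - 2 / 2 ^ m"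
      by (induction m rule: dec_induct) (auto simp: power_one_over)
    then show ?thesis by simp
  qed auto
  have "(\<Sum>k\<in>{n..<m}. d k)\<^sup>2 = (\<Sum>k\<in>{n..<m}. sqrt ((1/2) ^ k) * (sqrt (2 ^ k) * d k))\<^sup>2"
    by (simp add: mult.assoc[symmetric] flip: real_sqrt_mult power_mult_distrib)
  also have "\<dots> \<le> (\<Sum>k\<in>{n..<m}. (sqrt ((1/2) ^ k))\<^sup>2) * (\<Sum>k\<in>{n..<m}. (sqrt (2 ^ k) * d k)\<^sup>2)"
    by (rule Cauchy_Schwarz_ineq_sum)
  also have "\<dots> = (\<Sum>k\<in>{n..<m}. (1/2) ^ k) * (\<Sum>k\<in>{n..<m}. 2 ^ k * (d k)\<^sup>2)"
    by (simp add: power_mult_distrib)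
  also have "\<dots> \<le> (2 / 2 ^ n) * (\<Sum>k\<in>{n..<m}. 2 ^ k * (d k)\<^sup>2)"
    by (intro mult_right_mono geo sum_nonneg) auto
  finally show ?thesis .
qed

text \<open>Riesz--Fischer for rapidly converging sequences. The weighted sum \<open>S\<close> of the squared
  increments is integrable, and the tail estimate bounds \<open>|u\<^sub>m - u\<^sub>n|\<^sup>2\<close> pointwise by
  \<open>2\<^bsup>1-n\<^esup> S\<close>. This one dominating function gives the almost everywhere limit and the
  convergence in \<open>L\<^sup>2\<close>.\<close>

lemma L2_complete:
  assumes u: "\<And>n. u n \<in> L2 M"
    and close: "\<And>n. L2_sqnorm M (\<lambda>x. u (Suc n) x - u n x) \<le> c / 4 ^ n"
  shows "\<exists>w\<in>L2 M. (\<lambda>n. L2_sqnorm M (\<lambda>x. u n x - w x)) \<longlonglongrightarrow> 0"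
proof -
  define d where "d n x = u (Suc n) x - u n x" for n x
  define s where "s n x = 2 ^ n * (norm (d n x))\<^sup>2" for n x
  define S where "S x = (\<Sum>n. s n x)" for x
  have d: "d n \<in> L2 M" for n unfolding d_def by (intro L2_diff u)
  note [measurable] = L2_measurable[OF u] L2_measurable[OF d]
  have s_int: "integrable M (s n)" for n
    unfolding s_def using L2_integrable_sqnorm[OF d] by simp
  have s_nonneg: "0 \<le> s n x" for n x by (simp add: s_def)
  have s_bound: "(LINT x|M. s n x) \<le> c * (1/2) ^ n" for n
  proof -
    have "(LINT x|M. s n x) = 2 ^ n * L2_sqnorm M (d n)"
      by (simp add: s_def L2_sqnorm_def)
    also have "\<dots> \<le> 2 ^ n * (c / 4 ^ n)"
      using close[of n] by (intro mult_left_mono) (auto simp: d_def[abs_def])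
    also have "\<dots> = c * (1/2) ^ n"
      by (simp add: field_simps flip: power_mult_distrib)
    finally show ?thesis .
  qed
  have s_sum: "summable (\<lambda>n. LINT x|M. s n x)"
    by (rule summable_comparison_test'[where g="\<lambda>n. c * (1/2) ^ n" and N=0])
       (use s_bound s_nonneg in \<open>auto intro!: summable_mult summable_geometric simp: integral_nonneg_AE\<close>)
  have S_AE: "AE x in M. summable (\<lambda>n. s n x)"
  proof -
    have "(\<integral>\<^sup>+x. (\<Sum>n. ennreal (s n x)) \<partial>M) = (\<Sum>n. \<integral>\<^sup>+x. ennreal (s n x) \<partial>M)"
      by (rule nn_integral_suminf) (simp add: s_def)
    also have "\<dots> = (\<Sum>n. ennreal (LINT x|M. s n x))"
      by (simp add: nn_integral_eq_integral[OF s_int] s_nonneg)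
    also have "\<dots> \<noteq> \<infinity>"
      using s_sum s_nonneg by (simp add: suminf_ennreal2 integral_nonneg_AE)
    finally have "AE x in M. (\<Sum>n. ennreal (s n x)) \<noteq> \<infinity>"
      by (intro nn_integral_noteq_infinite) (auto simp: s_def)
    then show ?thesis
      by eventually_elim (auto intro!: summable_suminf_not_top simp: s_nonneg)
  qed
  have S_int: "integrable M S"
    unfolding S_def by (rule integrable_suminf) (use s_int S_AE s_sum s_nonneg in auto)
  have tail: "(norm (u m x - u n x))\<^sup>2 \<le> (2 / 2 ^ n) * S x"
    if "n \<le> m" "summable (\<lambda>n. s n x)" for n m x
  proof -
    have "u m x - u n x = (\<Sum>k\<in>{n..<m}. d k x)"
      unfolding d_def using sum_Suc_diff'[OF that(1), of "\<lambda>k. u k x"] by simp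
    then have "(norm (u m x - u n x))\<^sup>2 \<le> (\<Sum>k\<in>{n..<m}. norm (d k x))\<^sup>2"
      by (simp add: norm_sum power_mono)
    also have "\<dots> \<le> (2 / 2 ^ n) * (\<Sum>k\<in>{n..<m}. s k x)"
      unfolding s_def by (rule power2_sum_le_weighted)
    also have "\<dots> \<le> (2 / 2 ^ n) * S x"
      unfolding S_def using that(2) s_nonneg by (intro mult_left_mono sum_le_suminf) auto
    finally show ?thesis .
  qed
  have conv: "convergent (\<lambda>n. u n x)" if sx: "summable (\<lambda>n. s n x)" for x
  proof -
    have "Cauchy (\<lambda>n. u n x)"
    proof (rule metric_CauchyI)
      fix e :: real assume e: "0 < e"
      have "(\<lambda>n. 2 * S x * (1/2) ^ n) \<longlonglongrightarrow> 2 * S x * 0"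
        by (intro tendsto_intros LIMSEQ_realpow_zero) auto
      then have "eventually (\<lambda>n. 2 * S x * (1/2) ^ n < (e/2)\<^sup>2) sequentially"
        using e by (intro order_tendstoD) auto
      then obtain N where N: "2 * S x * (1/2) ^ N < (e/2)\<^sup>2"
        by (auto simp: eventually_sequentially)
      have near: "dist (u m x) (u N x) < e / 2" if "N \<le> m" for m
      proof -
        have "(norm (u m x - u N x))\<^sup>2 < (e/2)\<^sup>2"
          using order.strict_trans1[OF tail[OF that sx], of "(e/2)\<^sup>2"] N
          by (simp add: power_one_over)
        then show ?thesis using e by (metis dist_norm half_gt_zero_iff less_imp_le power_less_imp_less_base)
      qed
      show "\<exists>N. \<forall>m\<ge>N. \<forall>n\<ge>N. dist (u m x) (u n x) < e"
        using near dist_triangle_half_r[of "u N x" _ e] by (metis dist_commute)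
    qed
    then show ?thesis by (rule Cauchy_convergent)
  qed
  define w where "w x = lim (\<lambda>n. u n x)" for x
  have w_meas[measurable]: "w \<in> borel_measurable M"
    unfolding w_def by (rule borel_measurable_lim_metric) measurable
  have limit: "AE x in M. (norm (u n x - w x))\<^sup>2 \<le> (2 / 2 ^ n) * S x" for n
    using S_AE
  proof eventually_elim
    case (elim x)
    have "(\<lambda>m. u m x) \<longlonglongrightarrow> w x"
      using conv[OF elim] by (simp add: w_def convergent_LIMSEQ_iff)
    then have "(\<lambda>m. (norm (u m x - u n x))\<^sup>2) \<longlonglongrightarrow> (norm (w x - u n x))\<^sup>2"
      by (intro tendsto_intros)
    then have "(norm (w x - u n x))\<^sup>2 \<le> (2 / 2 ^ n) * S x"
      by (rule LIMSEQ_le_const2) (use tail[OF _ elim] in blast)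
    then show ?case by (simp add: norm_minus_commute)
  qed
  have diff: "(\<lambda>x. u n x - w x) \<in> L2 M" for n
  proof -
    have "integrable M (\<lambda>x. (norm (u n x - w x))\<^sup>2)"
    proof (rule Bochner_Integration.integrable_bound[where f="\<lambda>x. (2 / 2 ^ n) * S x"])
      show "AE x in M. norm ((norm (u n x - w x))\<^sup>2) \<le> norm ((2 / 2 ^ n) * S x)"
        using limit[of n]
      proof eventually_elim
        case (elim x)
        then show ?case using abs_ge_self[of "(2 / 2 ^ n) * S x"] by simp
      qed
    qed (use S_int in auto)
    then show ?thesis by (simp add: L2_def)
  qed
  have "w \<in> L2 M"
    using L2_diff[OF u[of 0] diff[of 0]] by simp
  moreover have "(\<lambda>n. L2_sqnorm M (\<lambda>x. u n x - w x)) \<longlonglongrightarrow> 0"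
  proof (rule real_tendsto_sandwich)
    show "eventually (\<lambda>n. 0 \<le> L2_sqnorm M (\<lambda>x. u n x - w x)) sequentially"
      by (simp add: L2_sqnorm_nonneg)
    have "L2_sqnorm M (\<lambda>x. u n x - w x) \<le> (2 * integral\<^sup>L M S) * (1/2) ^ n" for n
    proof -
      have "L2_sqnorm M (\<lambda>x. u n x - w x) \<le> (LINT x|M. (2 / 2 ^ n) * S x)"
        unfolding L2_sqnorm_def
        using L2_integrable_sqnorm[OF diff] S_int limit[of n]
        by (intro integral_mono_AE) auto
      then show ?thesis by (simp add: power_one_over field_simps)
    qed
    then show "eventually (\<lambda>n. L2_sqnorm M (\<lambda>x. u n x - w x) \<le> (2 * integral\<^sup>L M S) * (1/2) ^ n) sequentially"
      by simp
    have "(\<lambda>n. (2 * integral\<^sup>L M S) * (1/2) ^ n) \<longlonglongrightarrow> (2 * integral\<^sup>L M S) * 0"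
      by (intro tendsto_intros LIMSEQ_realpow_zero) auto
    then show "(\<lambda>n. (2 * integral\<^sup>L M S) * (1/2) ^ n) \<longlonglongrightarrow> 0" by simp
  qed simp
  ultimately show ?thesis by blast
qed

text \<open>The first variation at a minimum vanishes.\<close>

lemma quadratic_nonneg_imp_linear_zero:
  fixes a b :: real
  assumes "\<And>t. 0 \<le> t\<^sup>2 * a + 2 * t * b"
  shows "b = 0"
proof (rule ccontr)
  assume b: "b \<noteq> 0"
  define A where "A = \<bar>a\<bar> + 1"
  have A: "A > 0" "a < A" by (auto simp: A_def)
  have "0 \<le> (- b / A)\<^sup>2 * a + 2 * (- b / A) * b" by (rule assms)
  also have "\<dots> = (b\<^sup>2 / A) * (a / A - 2)"
    using A by (simp add: field_simps power2_eq_square)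
  also have "\<dots> < 0"
    using A b by (intro mult_pos_neg) (auto simp: field_simps)
  finally show False by simp
qed

text \<open>The representing function minimises \<open>J u = \<parallel>u\<parallel>\<^sup>2 - 2 Re (l u)\<close>. By the parallelogram
  law a minimising sequence is Cauchy, and the first variation of \<open>J\<close> in the directions \<open>v\<close> and
  \<open>\<i> v\<close> gives the real and the imaginary part of the identity. The variation is carried out along
  the sequence and only then passed to the limit.\<close>

lemma L2_Riesz_representation:
  fixes l :: "('a \<Rightarrow> complex) \<Rightarrow> complex"
  assumes linear: "\<And>u v a b. u \<in> L2 M \<Longrightarrow> v \<in> L2 M \<Longrightarrow> l (\<lambda>x. a * u x + b * v x) = a * l u + b * l v"
    and bounded: "\<And>u. u \<in> L2 M \<Longrightarrow> (norm (l u))\<^sup>2 \<le> K * L2_sqnorm M u"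
  shows "\<exists>w\<in>L2 M. \<forall>v\<in>L2 M. l v = L2_inner M v w"
proof -
  define J where "J u = L2_sqnorm M u - 2 * Re (l u)" for u
  define m where "m = Inf (J ` L2 M)"
  define K' where "K' = \<bar>K\<bar> + 1"
  have K': "0 < K'" "K \<le> K'" by (auto simp: K'_def)
  have zero: "(\<lambda>x. 0) \<in> L2 M" by (simp add: L2_def)
  \<comment> \<open>\<open>J\<close> is bounded below because \<open>2 |l u|\<close> is at most \<open>|l u|\<^sup>2 / K' + K'\<close>.\<close>
  have J_lower: "- K' \<le> J u" if "u \<in> L2 M" for u
  proof -
    have "(norm (l u))\<^sup>2 \<le> K' * L2_sqnorm M u"
      using bounded[OF that] K'(2) mult_right_mono[OF K'(2) L2_sqnorm_nonneg[of M u]] by linarith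
    then have "(norm (l u))\<^sup>2 / K' \<le> L2_sqnorm M u"
      using K'(1) by (simp add: field_simps)
    moreover have "2 * norm (l u) \<le> (norm (l u))\<^sup>2 / K' + K'"
      using two_mult_le_power2_sum[of "norm (l u)" K'] K'(1)
      by (simp add: field_simps power2_eq_square)
    moreover have "Re (l u) \<le> norm (l u)" by (rule complex_Re_le_cmod)
    ultimately show ?thesis by (simp add: J_def)
  qed
  have bdd: "bdd_below (J ` L2 M)"
    using J_lower by (intro bdd_belowI2[where m="- K'"])
  have m_le: "m \<le> J u" if "u \<in> L2 M" for u
    unfolding m_def using that bdd by (intro cInf_lower) auto
  have "\<exists>u\<in>L2 M. J u < m + (1/4) ^ n" for n
    using cInf_lessD[of "J ` L2 M" "m + (1/4) ^ n"] zero by (auto simp: m_def)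
  then obtain u where u: "\<And>n. u n \<in> L2 M" and J_u: "\<And>n. J (u n) < m + (1/4) ^ n"
    by metis
  have parallelogram: "L2_sqnorm M (\<lambda>x. v x - w x) \<le> 2 * (J v - m) + 2 * (J w - m)"
    if "v \<in> L2 M" "w \<in> L2 M" for v w
  proof -
    have "L2_sqnorm M (\<lambda>x. v x - w x) = 2 * J v + 2 * J w - 4 * J (\<lambda>x. (1/2) * v x + (1/2) * w x)"
      using L2_sqnorm_lincomb[OF that, of 1 "-1"] L2_sqnorm_lincomb[OF that, of "1/2" "1/2"]
        linear[OF that, of "1/2" "1/2"]
      by (simp add: J_def power2_eq_square norm_divide algebra_simps)
    moreover have "m \<le> J (\<lambda>x. (1/2) * v x + (1/2) * w x)"
      by (intro m_le L2_lincomb that)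
    ultimately show ?thesis by simp
  qed
  have "L2_sqnorm M (\<lambda>x. u (Suc n) x - u n x) \<le> 4 / 4 ^ n" for n
  proof -
    have "L2_sqnorm M (\<lambda>x. u (Suc n) x - u n x) \<le> 2 * (J (u (Suc n)) - m) + 2 * (J (u n) - m)"
      by (rule parallelogram[OF u u])
    also have "\<dots> \<le> 2 * (1/4) ^ Suc n + 2 * (1/4) ^ n"
      using J_u[of n] J_u[of "Suc n"] by simp
    also have "\<dots> \<le> 4 / 4 ^ n" by (simp add: power_one_over field_simps)
    finally show ?thesis .
  qed
  from L2_complete[OF u this] obtain w where
    w: "w \<in> L2 M" and lim: "(\<lambda>n. L2_sqnorm M (\<lambda>x. u n x - w x)) \<longlonglongrightarrow> 0"
    by blast
  have Re_eq: "Re (L2_inner M v w) = Re (l v)" if v: "v \<in> L2 M" for v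
  proof -
    have inner_lim: "(\<lambda>n. L2_inner M v (u n)) \<longlonglongrightarrow> L2_inner M v w"
    proof -
      have "(\<lambda>n. (norm (L2_inner M v (u n) - L2_inner M v w))\<^sup>2) \<longlonglongrightarrow> 0"
      proof (rule real_tendsto_sandwich[where f="\<lambda>n. 0"])
        have "L2_inner M v (u n) - L2_inner M v w = L2_inner M v (\<lambda>x. u n x - w x)" for n
          using L2_inner_lincomb_right[OF u[of n] w v, of 1 "-1"] by simp
        then show "eventually (\<lambda>n. (norm (L2_inner M v (u n) - L2_inner M v w))\<^sup>2
            \<le> L2_sqnorm M v * L2_sqnorm M (\<lambda>x. u n x - w x)) sequentially"
          using L2_Cauchy_Schwarz[OF v L2_diff[OF u w]] by simp
        show "(\<lambda>n. L2_sqnorm M v * L2_sqnorm M (\<lambda>x. u n x - w x)) \<longlonglongrightarrow> 0"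
          using tendsto_mult_left[OF lim, of "L2_sqnorm M v"] by simp
      qed auto
      then have "(\<lambda>n. norm (L2_inner M v (u n) - L2_inner M v w)) \<longlonglongrightarrow> 0"
        using tendsto_real_sqrt by fastforce
      then show ?thesis by (simp add: LIM_zero_iff tendsto_norm_zero_iff)
    qed
    have "0 \<le> t\<^sup>2 * L2_sqnorm M v + 2 * t * (Re (L2_inner M v w) - Re (l v))" for t
    proof -
      have "- ((1/4) ^ n) \<le> t\<^sup>2 * L2_sqnorm M v + 2 * t * (Re (L2_inner M v (u n)) - Re (l v))" for n
      proof -
        have "J (\<lambda>x. of_real t * v x + 1 * u n x)
            = J (u n) + t\<^sup>2 * L2_sqnorm M v + 2 * t * (Re (L2_inner M v (u n)) - Re (l v))"
          unfolding J_def L2_sqnorm_lincomb[OF v u] linear[OF v u] by (simp add: algebra_simps)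
        then show ?thesis
          using m_le[OF L2_lincomb[OF v u, of "of_real t" 1 n]] J_u[of n] by simp
      qed
      moreover have "(\<lambda>n. t\<^sup>2 * L2_sqnorm M v + 2 * t * (Re (L2_inner M v (u n)) - Re (l v)))
          \<longlonglongrightarrow> t\<^sup>2 * L2_sqnorm M v + 2 * t * (Re (L2_inner M v w) - Re (l v))"
        by (intro tendsto_intros inner_lim)
      moreover have "(\<lambda>n. - ((1/4::real) ^ n)) \<longlonglongrightarrow> - 0"
        by (intro tendsto_intros LIMSEQ_realpow_zero) auto
      ultimately show ?thesis
        by (intro LIMSEQ_le[where X="\<lambda>n. - ((1/4::real) ^ n)"]) auto
    qed
    from quadratic_nonneg_imp_linear_zero[OF this] show ?thesis by simp
  qed
  have "l v = L2_inner M v w" if v: "v \<in> L2 M" for v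
  proof (rule complex_eqI)
    show "Re (l v) = Re (L2_inner M v w)" using Re_eq[OF v] by simp
    have "Re (L2_inner M (\<lambda>x. \<i> * v x + 0 * v x) w) = Re (l (\<lambda>x. \<i> * v x + 0 * v x))"
      by (rule Re_eq[OF L2_lincomb[OF v v]])
    then show "Im (l v) = Im (L2_inner M v w)"
      unfolding linear[OF v v] L2_inner_lincomb_left[OF v v w] by simp
  qed
  with w show ?thesis by blast
qed

section \<open>Fubini, linear substitutions and Gaussian integrals\<close>

lemma sigma_finite_lebesgue: "sigma_finite_measure (lebesgue :: 'a::euclidean_space measure)"
proof
  obtain A :: "'a set set" where "countable A" "A \<subseteq> sets lborel" "\<Union>A = space lborel"
      "\<forall>a\<in>A. emeasure lborel a \<noteq> \<infinity>"
    using lborel.sigma_finite_countable by blast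
  then show "\<exists>A::'a set set. countable A \<and> A \<subseteq> sets lebesgue \<and> \<Union>A = space lebesgue
      \<and> (\<forall>a\<in>A. emeasure lebesgue a \<noteq> \<infinity>)"
    by (intro exI[of _ A]) (auto simp: sets_completionI_sets)
qed

text \<open>Fubini in the form that suits integral operators with Gaussian kernels: the integrand is
  dominated by a product of integrable functions of one variable each.\<close>

lemma
  fixes F :: "'a \<Rightarrow> 'b \<Rightarrow> complex" and f :: "'a \<Rightarrow> real" and g :: "'b \<Rightarrow> real"
  assumes "sigma_finite_measure M" "sigma_finite_measure N"
    and F: "case_prod F \<in> borel_measurable (M \<Otimes>\<^sub>M N)"
    and f: "integrable M f" and g: "integrable N g"
    and bound: "\<And>x y. norm (F x y) \<le> f x * g y"
  shows integrals_swap_dominated: "(LINT x|M. LINT y|N. F x y) = (LINT y|N. LINT x|M. F x y)"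
    and integral_measurable_dominated: "(\<lambda>x. LINT y|N. F x y) \<in> borel_measurable M"
proof -
  interpret M: sigma_finite_measure M by fact
  interpret N: sigma_finite_measure N by fact
  interpret pair_sigma_finite M N ..
  have [measurable]: "f \<in> borel_measurable M" "g \<in> borel_measurable N" using f g by auto
  have "integrable (M \<Otimes>\<^sub>M N) (\<lambda>(x, y). f x * g y)"
  proof (rule Fubini_integrable)
    show "integrable M (\<lambda>x. LINT y|N. norm (case (x, y) of (x, y) \<Rightarrow> f x * g y))"
      using f by (simp add: abs_mult)
    show "AE x in M. integrable N (\<lambda>y. case (x, y) of (x, y) \<Rightarrow> f x * g y)"
      using g by simp
  qed measurable
  then have int: "integrable (M \<Otimes>\<^sub>M N) (case_prod F)"
    by (rule integrable_dominated[OF F, rotated]) (use bound in auto)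
  show "(LINT x|M. LINT y|N. F x y) = (LINT y|N. LINT x|M. F x y)"
    using integral_fst[OF int] integral_snd[OF int] by simp
  show "(\<lambda>x. LINT y|N. F x y) \<in> borel_measurable M"
    using integrable_fst[OF int] by auto
qed

text \<open>Functions in \<open>L2 lebesgue\<close> are only Lebesgue measurable, so products of completed
  measures occur in the applications of Fubini, while the kernels are continuous on the product
  space.\<close>

lemma borel_measurable_pair_of_id:
  fixes F :: "'a::euclidean_space \<Rightarrow> 'b::euclidean_space \<Rightarrow> 'c::topological_space"
  assumes "(\<lambda>x. x) \<in> M \<rightarrow>\<^sub>M borel" "(\<lambda>x. x) \<in> N \<rightarrow>\<^sub>M borel"
    and "(\<lambda>p. F (fst p) (snd p)) \<in> borel_measurable borel"
  shows "case_prod F \<in> borel_measurable (M \<Otimes>\<^sub>M N)"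
proof -
  have "(\<lambda>p. p) \<in> M \<Otimes>\<^sub>M N \<rightarrow>\<^sub>M borel \<Otimes>\<^sub>M borel"
    by (rule measurable_pair)
       (auto simp: o_def intro: measurable_compose[OF measurable_fst assms(1)] measurable_compose[OF measurable_snd assms(2)])
  then have "(\<lambda>p. p) \<in> M \<Otimes>\<^sub>M N \<rightarrow>\<^sub>M borel"
    by (simp add: borel_prod)
  from measurable_compose[OF this assms(3)] show ?thesis by (simp add: case_prod_unfold)
qed

lemma borel_measurable_pair_lebesgue:
  fixes F :: "'a::euclidean_space \<Rightarrow> 'b::euclidean_space \<Rightarrow> 'c::topological_space"
  assumes "(\<lambda>p. F (fst p) (snd p)) \<in> borel_measurable borel"
  shows "case_prod F \<in> borel_measurable (lebesgue \<Otimes>\<^sub>M lebesgue)"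
  by (rule borel_measurable_pair_of_id[OF _ _ assms]) (auto intro: measurable_completion)

lemma continuous_on_imp_borel_measurable_lebesgue:
  fixes f :: "'a::euclidean_space \<Rightarrow> 'b::topological_space"
  shows "continuous_on UNIV f \<Longrightarrow> f \<in> borel_measurable lebesgue"
  by (rule measurable_completion) (simp add: borel_measurable_continuous_onI)

lemma nn_integral_lborel_translate:
  fixes f :: "'a::euclidean_space \<Rightarrow> ennreal"
  assumes [measurable]: "f \<in> borel_measurable borel"
  shows "(\<integral>\<^sup>+x. f (a + x) \<partial>lborel) = (\<integral>\<^sup>+x. f x \<partial>lborel)"
proof -
  have "(\<integral>\<^sup>+x. f x \<partial>distr lborel borel ((+) a)) = (\<integral>\<^sup>+x. f (a + x) \<partial>lborel)"
    by (rule nn_integral_distr) simp_all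
  then show ?thesis by (simp add: lborel_distr_plus)
qed

lemma emeasure_lborel_open_bounded:
  fixes S :: "'a::euclidean_space set"
  assumes "open S" "bounded S" "S \<noteq> {}"
  shows "\<exists>r>0. emeasure lborel S = ennreal r"
proof -
  have fin: "emeasure lborel S < \<infinity>" by (rule emeasure_bounded_finite) fact
  obtain x e where e: "e > 0" "ball x e \<subseteq> S"
    using assms by (meson all_not_in_conv openE)
  have "emeasure lborel (ball x e) \<noteq> 0"
    using content_ball_pos[OF e(1), of x] by (auto simp: measure_def)
  moreover have "emeasure lborel (ball x e) \<le> emeasure lborel S"
    using e(2) assms(1) by (intro emeasure_mono) auto
  ultimately have "emeasure lborel S \<noteq> 0" by auto
  moreover have "emeasure lborel S = ennreal (measure lborel S)"
    using fin by (intro emeasure_eq_ennreal_measure) auto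
  ultimately show ?thesis
    by (metis ennreal_0 measure_nonneg order_le_less)
qed

text \<open>The image of Lebesgue measure under a linear isomorphism is translation invariant, hence a
  multiple of Lebesgue measure by the uniqueness of Haar measure. This argument covers at once
  isomorphisms of \<open>\<real>\<^sup>n\<close> and of \<open>\<complex>\<^sup>n\<close>, regarded as a real vector space; the factors
  are later absorbed into \<open>C\<close>.\<close>

lemma lborel_linear_image:
  fixes L :: "'a::euclidean_space \<Rightarrow> 'b::euclidean_space"
  assumes L: "linear L" and bij: "bij L"
  shows "\<exists>c>0. distr lborel borel L = density lborel (\<lambda>_. ennreal c)"
proof -
  define B where "B = ball (0::'b) 1"
  let ?\<mu> = "distr lborel borel L"
  have contL: "continuous_on UNIV L" using L by (simp add: linear_continuous_on linear_linear)
  have [measurable]: "L \<in> borel_measurable borel"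
    by (rule borel_measurable_continuous_onI[OF contL])
  obtain Li where Li: "linear Li" "\<And>x. Li (L x) = x" "\<And>y. L (Li y) = y"
    using L bij linear_injective_left_inverse[OF L] bij_is_inj[OF bij] bij_is_surj[OF bij]
    by (metis comp_apply id_apply surj_def)
  have vim: "L -` ball 0 r = Li ` ball 0 r" for r
    by (auto simp: Li(3) intro!: image_eqI[where f=Li] Li(2)[symmetric])
  have fin_ball: "\<exists>s>0. emeasure ?\<mu> (ball 0 r) = ennreal s" if "r > 0" for r
  proof -
    have *: "emeasure ?\<mu> (ball 0 r) = emeasure lborel (L -` ball 0 r)"
      by (simp add: emeasure_distr)
    have "\<exists>s>0. emeasure lborel (L -` ball 0 r) = ennreal s"
    proof (rule emeasure_lborel_open_bounded)
      show "open (L -` ball 0 r)" using contL by (simp add: continuous_on_open_vimage)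
      show "bounded (L -` ball 0 r)"
        unfolding vim using Li(1) by (simp add: bounded_linear_image linear_linear)
      show "L -` ball 0 r \<noteq> {}" unfolding vim using that by simp
    qed
    then show ?thesis unfolding * .
  qed
  interpret mu: sigma_finite_measure ?\<mu>
  proof
    have "\<forall>a\<in>range (\<lambda>n. ball (0::'b) (real (Suc n))). emeasure ?\<mu> a \<noteq> \<infinity>"
    proof (rule ballI)
      fix a assume "a \<in> range (\<lambda>n. ball (0::'b) (real (Suc n)))"
      then obtain n where a: "a = ball 0 (real (Suc n))" by blast
      obtain s where "emeasure ?\<mu> (ball 0 (real (Suc n))) = ennreal s"
        using fin_ball[of "real (Suc n)"] by auto
      then show "emeasure ?\<mu> a \<noteq> \<infinity>" unfolding a by (simp only: infinity_ennreal_def ennreal_neq_top not_False_eq_True)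
    qed
    moreover have "\<Union>(range (\<lambda>n. ball (0::'b) (real (Suc n)))) = space ?\<mu>"
    proof -
      have "\<exists>n. norm x < real (Suc n)" for x :: 'b
        by (metis lessI of_nat_less_iff order.strict_trans reals_Archimedean2)
      then show ?thesis by auto
    qed
    ultimately show "\<exists>A. countable A \<and> A \<subseteq> sets ?\<mu> \<and> \<Union>A = space ?\<mu> \<and> (\<forall>a\<in>A. emeasure ?\<mu> a \<noteq> \<infinity>)"
      by (intro exI[of _ "range (\<lambda>n. ball (0::'b) (real (Suc n)))"] conjI) (simp_all add: image_subset_iff)
  qed
  interpret pair: pair_sigma_finite ?\<mu> lborel ..
  have transl: "(\<integral>\<^sup>+x. f (a + x) \<partial>?\<mu>) = (\<integral>\<^sup>+x. f x \<partial>?\<mu>)"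
    if [measurable]: "f \<in> borel_measurable borel" for f :: "'b \<Rightarrow> ennreal" and a
  proof -
    have "(\<integral>\<^sup>+x. f (a + x) \<partial>?\<mu>) = (\<integral>\<^sup>+x. f (L (Li a + x)) \<partial>lborel)"
      by (simp add: nn_integral_distr linear_add[OF L] Li(3))
    also have "\<dots> = (\<integral>\<^sup>+x. f (L x) \<partial>lborel)"
      by (rule nn_integral_lborel_translate) measurable
    finally show ?thesis by (simp add: nn_integral_distr)
  qed
  \<comment> \<open>Uniqueness of translation invariant measures: both orders of integration of
    \<open>1\<^sub>B x * 1\<^sub>A (x + y)\<close>, once translating in \<open>y\<close>, once in \<open>x\<close>.\<close>
  have unique: "emeasure ?\<mu> B * emeasure lborel A = emeasure lborel B * emeasure ?\<mu> A"
    if A[measurable]: "A \<in> sets borel" for A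
  proof -
    have [measurable]: "B \<in> sets borel" by (simp add: B_def)
    have "emeasure ?\<mu> B * emeasure lborel A
        = (\<integral>\<^sup>+x. indicator B x * (\<integral>\<^sup>+y. indicator A y \<partial>lborel) \<partial>?\<mu>)"
      by (subst nn_integral_multc) simp_all
    also have "\<dots> = (\<integral>\<^sup>+x. indicator B x * (\<integral>\<^sup>+y. indicator A (x + y) \<partial>lborel) \<partial>?\<mu>)"
      by (subst nn_integral_lborel_translate) simp_all
    also have "\<dots> = (\<integral>\<^sup>+x. \<integral>\<^sup>+y. indicator B x * indicator A (x + y) \<partial>lborel \<partial>?\<mu>)"
      by (intro nn_integral_cong nn_integral_cmult[symmetric]) measurable
    also have "\<dots> = (\<integral>\<^sup>+y. \<integral>\<^sup>+x. indicator B x * indicator A (x + y) \<partial>?\<mu> \<partial>lborel)"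
      by (rule pair.Fubini'[symmetric]) measurable
    also have "\<dots> = (\<integral>\<^sup>+y. \<integral>\<^sup>+x. indicator B (- y + x) * indicator A x \<partial>?\<mu> \<partial>lborel)"
    proof (rule nn_integral_cong)
      fix y
      show "(\<integral>\<^sup>+x. indicator B x * indicator A (x + y) \<partial>?\<mu>)
          = (\<integral>\<^sup>+x. indicator B (- y + x) * indicator A x \<partial>?\<mu>)"
        using transl[of "\<lambda>x. indicator B x * indicator A (x + y)" "- y"]
        by (simp add: algebra_simps)
    qed
    also have "\<dots> = (\<integral>\<^sup>+x. \<integral>\<^sup>+y. indicator B (- y + x) * indicator A x \<partial>lborel \<partial>?\<mu>)"
      by (rule pair.Fubini') measurable
    also have "\<dots> = (\<integral>\<^sup>+x. emeasure lborel B * indicator A x \<partial>?\<mu>)"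
    proof (rule nn_integral_cong)
      fix x
      have "(\<integral>\<^sup>+y. indicator B (- y + x) \<partial>lborel) = (\<integral>\<^sup>+y. indicator B (- x + y) \<partial>(lborel :: 'b measure) :: ennreal)"
        by (intro nn_integral_cong) (auto simp: B_def indicator_def norm_minus_commute)
      also have "\<dots> = emeasure lborel B"
        by (subst nn_integral_lborel_translate) simp_all
      finally show "(\<integral>\<^sup>+y. indicator B (- y + x) * indicator A x \<partial>lborel) = emeasure lborel B * indicator A x"
        by (simp add: nn_integral_multc)
    qed
    also have "\<dots> = emeasure lborel B * emeasure ?\<mu> A"
      by (subst nn_integral_cmult) simp_all
    finally show ?thesis .
  qed
  obtain p where p: "p > 0" "emeasure ?\<mu> B = ennreal p" using fin_ball[of 1] by (auto simp: B_def)
  obtain q where q: "q > 0" "emeasure lborel B = ennreal q"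
    using emeasure_lborel_open_bounded[of B] by (auto simp: B_def)
  have "?\<mu> = density lborel (\<lambda>_. ennreal (p / q))"
  proof (rule measure_eqI)
    fix A assume "A \<in> sets ?\<mu>"
    then have A: "A \<in> sets borel" by simp
    have "ennreal (1 / q) * (ennreal p * emeasure lborel A) = ennreal (1 / q) * (ennreal q * emeasure ?\<mu> A)"
      using unique[OF A] by (simp add: p q)
    then have "ennreal (p / q) * emeasure lborel A = emeasure ?\<mu> A"
      using p q by (simp add: mult.assoc[symmetric] ennreal_mult'[symmetric])
    then show "emeasure ?\<mu> A = emeasure (density lborel (\<lambda>_. ennreal (p / q))) A"
      using A by (simp add: emeasure_density_const)
  qed simp
  then show ?thesis using p q by (intro exI[of _ "p / q"]) auto
qed

text \<open>Passage to completions; null sets correspond because the factor is not zero.\<close>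

lemma lebesgue_linear_image:
  fixes L :: "'a::euclidean_space \<Rightarrow> 'b::euclidean_space"
  assumes L: "linear L" and bij: "bij L"
  shows "L \<in> lebesgue \<rightarrow>\<^sub>M lebesgue"
    and "\<exists>c>0. distr lebesgue lebesgue L = density lebesgue (\<lambda>_. ennreal c)"
proof -
  obtain c where c: "c > 0" "distr lborel borel L = density lborel (\<lambda>_. ennreal c)"
    using lborel_linear_image[OF assms] by blast
  have [measurable]: "L \<in> lborel \<rightarrow>\<^sub>M lborel"
    using L by (simp add: borel_measurable_continuous_onI linear_continuous_on linear_linear)
  have d: "distr lebesgue lborel L = density lborel (\<lambda>_. ennreal c)"
    using distr_completion[OF \<open>L \<in> lborel \<rightarrow>\<^sub>M lborel\<close>] c(2)
      distr_cong[OF refl sets_lborel refl, of lborel L]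
    by simp
  have null: "null_sets (distr lebesgue lborel L) = null_sets lborel"
    unfolding d using c(1) by (auto simp: null_sets_def emeasure_density_const)
  have meas: "L \<in> lebesgue \<rightarrow>\<^sub>M lborel" by (rule measurable_completion) measurable
  show "L \<in> lebesgue \<rightarrow>\<^sub>M lebesgue"
    by (rule completion.measurable_completion2[OF meas]) (simp add: null)
  have "distr lebesgue lebesgue L = completion (distr lebesgue lborel L)"
    by (rule completion.completion_distr_eq[symmetric, OF meas null])
  also have "\<dots> = density lebesgue (\<lambda>_. ennreal c)"
    unfolding d by (rule completion_density_eq) (use c(1) in auto)
  finally show "\<exists>c>0. distr lebesgue lebesgue L = density lebesgue (\<lambda>_. ennreal c)"
    using c(1) by blast
qed

lemma lebesgue_integrable_linear_iff:
  fixes L :: "'a::euclidean_space \<Rightarrow> 'b::euclidean_space" and g :: "'b \<Rightarrow> real"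
  assumes L: "linear L" and bij: "bij L" and [measurable]: "g \<in> borel_measurable lebesgue"
  shows "integrable lebesgue (\<lambda>x. g (L x)) \<longleftrightarrow> integrable lebesgue g"
proof -
  note [measurable] = lebesgue_linear_image(1)[OF L bij]
  obtain c where c: "c > 0" "distr lebesgue lebesgue L = density lebesgue (\<lambda>_. ennreal c)"
    using lebesgue_linear_image(2)[OF L bij] by blast
  have "integrable lebesgue (\<lambda>x. g (L x)) \<longleftrightarrow> integrable (distr lebesgue lebesgue L) g"
    by (rule integrable_distr_eq[symmetric]) measurable
  also have "\<dots> \<longleftrightarrow> integrable lebesgue (\<lambda>y. c *\<^sub>R g y)"
    unfolding c(2) using c(1) by (subst integrable_density) auto
  finally show ?thesis using c(1) by simp
qed

lemma lebesgue_linear_change_of_variables: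
  fixes L :: "'a::euclidean_space \<Rightarrow> 'b::euclidean_space"
  assumes L: "linear L" and bij: "bij L"
  obtains c where "c > 0"
    and "\<And>g :: 'b \<Rightarrow> complex. g \<in> borel_measurable lebesgue \<Longrightarrow>
        (LINT x|lebesgue. g (L x)) = complex_of_real c * (LINT y|lebesgue. g y)"
proof -
  note [measurable] = lebesgue_linear_image(1)[OF assms]
  obtain c where c: "c > 0" "distr lebesgue lebesgue L = density lebesgue (\<lambda>_. ennreal c)"
    using lebesgue_linear_image(2)[OF assms] by blast
  have "(LINT x|lebesgue. g (L x)) = complex_of_real c * (LINT y|lebesgue. g y)"
    if g[measurable]: "g \<in> borel_measurable lebesgue" for g :: "'b \<Rightarrow> complex"
  proof -
    have "(LINT x|lebesgue. g (L x)) = (LINT y|distr lebesgue lebesgue L. g y)"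
      by (rule integral_distr[symmetric]) measurable
    also have "\<dots> = (LINT y|lebesgue. c *\<^sub>R g y)"
      unfolding c(2) using c(1) by (subst integral_density) auto
    finally show ?thesis by (simp add: scaleR_conv_of_real)
  qed
  with that c(1) show ?thesis by blast
qed

lemma lebesgue_integral_translate:
  fixes g :: "'a::euclidean_space \<Rightarrow> complex"
  assumes [measurable]: "g \<in> borel_measurable borel"
  shows "(LINT x|lebesgue. g (a + x)) = (LINT x|lebesgue. g x)"
proof -
  have "(LINT x|lborel. g (a + x)) = (LINT x|distr lborel borel ((+) a). g x)"
    by (rule integral_distr[symmetric]) simp_all
  then show ?thesis by (simp add: integral_completion lborel_distr_plus)
qed

lemma lebesgue_integrable_translate:
  fixes g :: "'a::euclidean_space \<Rightarrow> real"
  assumes [measurable]: "g \<in> borel_measurable borel"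
  shows "integrable lebesgue (\<lambda>x. g (a + x)) \<longleftrightarrow> integrable lebesgue g"
proof -
  have "integrable lborel (\<lambda>x. g (a + x)) = integrable (distr lborel borel ((+) a)) g"
    by (rule integrable_distr_eq[symmetric]) simp_all
  then show ?thesis by (simp add: integrable_completion lborel_distr_plus)
qed

lemma gaussian_integrable:
  assumes "c > 0"
  shows "integrable lebesgue (\<lambda>x::'a::euclidean_space. exp (- c * (norm x)\<^sup>2))"
proof -
  have one: "(\<integral>\<^sup>+t. ennreal (exp (- c * t\<^sup>2)) \<partial>(lborel :: real measure)) < \<infinity>"
  proof -
    define s where "s = sqrt (1 / (2 * c))"
    have s: "s > 0" "s\<^sup>2 = 1 / (2 * c)" using assms by (auto simp: s_def)
    have "integrable lborel (\<lambda>t. sqrt (2 * pi * s\<^sup>2) * normal_density 0 s t)"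
      using integrable_normal_density[OF s(1), of 0] by simp
    moreover have "sqrt (2 * pi * s\<^sup>2) * normal_density 0 s t = exp (- c * t\<^sup>2)" for t
      using s assms by (simp add: normal_density_def)
    ultimately have "integrable lborel (\<lambda>t::real. exp (- c * t\<^sup>2))" by simp
    then show ?thesis by (simp add: integrable_iff_bounded)
  qed
  have "exp (- c * (norm x)\<^sup>2) = (\<Prod>b\<in>Basis. exp (- c * (x \<bullet> b)\<^sup>2))" for x :: 'a
    unfolding power2_norm_eq_inner euclidean_inner[of x x]
    by (simp add: exp_sum[symmetric] sum_distrib_left power2_eq_square sum_negf)
  then have "(\<integral>\<^sup>+x. ennreal (exp (- c * (norm x)\<^sup>2)) \<partial>(lborel :: 'a measure))
      = (\<integral>\<^sup>+x. (\<Prod>b\<in>Basis. ennreal (exp (- c * (x \<bullet> b)\<^sup>2))) \<partial>(lborel :: 'a measure))"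
    by (simp add: prod_ennreal)
  also have "\<dots> = (\<Prod>b\<in>(Basis::'a set). \<integral>\<^sup>+t. ennreal (exp (- c * t\<^sup>2)) \<partial>lborel)"
    by (rule nn_integral_lborel_prod) auto
  also have "\<dots> < \<infinity>"
    using one by (simp add: power_less_top_ennreal)
  finally have "integrable lborel (\<lambda>x::'a. exp (- c * (norm x)\<^sup>2))"
    by (simp add: integrable_iff_bounded)
  then show ?thesis by (simp add: integrable_completion)
qed

text \<open>Completing the square absorbs the linear term into half of the quadratic one.\<close>

lemma gaussian_linear_integrable:
  assumes "c > 0"
  shows "integrable lebesgue (\<lambda>x::'a::euclidean_space. exp (a * norm x - c * (norm x)\<^sup>2))"
proof (rule integrable_dominated)
  show "integrable lebesgue (\<lambda>x::'a. exp (a\<^sup>2 / (2 * c)) * exp (- (c / 2) * (norm x)\<^sup>2))"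
    using gaussian_integrable[of "c / 2"] assms by simp
  have "a * norm x - c * (norm x)\<^sup>2 \<le> a\<^sup>2 / (2 * c) + - (c / 2) * (norm x)\<^sup>2" for x :: 'a
  proof -
    have "0 \<le> (c * norm x - a)\<^sup>2 / (2 * c)" using assms by simp
    also have "\<dots> = a\<^sup>2 / (2 * c) + (c / 2) * (norm x)\<^sup>2 - a * norm x"
      using assms by (simp add: power2_diff field_simps power2_eq_square)
    finally show ?thesis by (simp add: algebra_simps)
  qed
  then show "norm (exp (a * norm x - c * (norm x)\<^sup>2))
      \<le> exp (a\<^sup>2 / (2 * c)) * exp (- (c / 2) * (norm x)\<^sup>2)" for x :: 'a
    by (simp flip: exp_add)
qed (intro continuous_on_imp_borel_measurable_lebesgue continuous_intros)

section \<open>Entire functions of several variables and the Gaussian Laplace transform\<close>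

text \<open>The bilinear (not Hermitian) product, which is holomorphic in both arguments; the Hermitian
  product of \<open>z\<close> and \<open>w\<close> is \<open>cdot z (cnj_vec w)\<close>.\<close>

definition cdot :: "complex^'n \<Rightarrow> complex^'n \<Rightarrow> complex" where
  "cdot z w = (\<Sum>i\<in>UNIV. z $ i * w $ i)"

definition cnj_vec :: "complex^'n \<Rightarrow> complex^'n" where
  "cnj_vec z = (\<chi> i. cnj (z $ i))"

lemma cdot_commute: "cdot z w = cdot w z"
  by (simp add: cdot_def mult.commute)

lemma cdot_add_left: "cdot (z + z') w = cdot z w + cdot z' w"
  by (simp add: cdot_def algebra_simps sum.distrib)

lemma cdot_diff_left: "cdot (z - z') w = cdot z w - cdot z' w"
  by (simp add: cdot_def algebra_simps sum_subtractf)

lemma cdot_diff_right: "cdot w (z - z') = cdot w z - cdot w z'"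
  by (simp add: cdot_def algebra_simps sum_subtractf)

lemma cdot_scale_left: "cdot (c *s z) w = c * cdot z w"
  by (simp add: cdot_def algebra_simps sum_distrib_left)

lemma cdot_scale_right: "cdot z (c *s w) = c * cdot z w"
  by (simp add: cdot_def algebra_simps sum_distrib_left)

lemma cdot_scaleR_left: "cdot (r *\<^sub>R z) w = of_real r * cdot z w"
  by (simp add: cdot_def sum_distrib_left mult.assoc) (simp add: scaleR_conv_of_real mult.assoc)

lemma cdot_zero_left [simp]: "cdot 0 w = 0"
  by (simp add: cdot_def)

lemma cdot_cnj_vec: "cdot (cnj_vec z) (cnj_vec w) = cnj (cdot z w)"
  by (simp add: cdot_def cnj_vec_def)

lemma cnj_vec_cnj_vec [simp]: "cnj_vec (cnj_vec z) = z"
  by (simp add: cnj_vec_def vec_eq_iff)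

lemma norm_vec_sq: "(norm (x :: 'a::real_normed_vector^'n))\<^sup>2 = (\<Sum>i\<in>UNIV. (norm (x $ i))\<^sup>2)"
  by (simp add: norm_vec_def L2_set_def sum_nonneg)

lemma cdot_self_cnj_vec: "cdot z (cnj_vec z) = complex_of_real ((norm z)\<^sup>2)"
  by (simp add: cdot_def cnj_vec_def norm_vec_sq complex_norm_square[symmetric])

lemma norm_of_real_vec [simp]: "norm (of_real_vec y) = norm y"
  by (simp add: of_real_vec_def norm_vec_def)

lemma norm_cdot_le: "norm (cdot z w) \<le> norm z * norm w"
proof -
  have "norm (cdot z w) \<le> (\<Sum>i\<in>UNIV. norm (z $ i) * norm (w $ i))"
    unfolding cdot_def by (rule order_trans[OF norm_sum]) (simp add: norm_mult)
  also have "\<dots> \<le> norm z * norm w"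
    unfolding norm_vec_def using L2_set_mult_ineq[of "\<lambda>i. norm (z $ i)" "\<lambda>i. norm (w $ i)" UNIV] by simp
  finally show ?thesis .
qed

lemma continuous_on_of_real_vec [continuous_intros]:
  "continuous_on S f \<Longrightarrow> continuous_on S (\<lambda>x. of_real_vec (f x))"
  unfolding of_real_vec_def by (intro continuous_intros)

lemma continuous_on_cnj_vec [continuous_intros]:
  "continuous_on S f \<Longrightarrow> continuous_on S (\<lambda>x. cnj_vec (f x))"
  unfolding cnj_vec_def by (intro continuous_intros)

lemma continuous_on_cdot [continuous_intros]:
  "continuous_on S f \<Longrightarrow> continuous_on S g \<Longrightarrow> continuous_on S (\<lambda>x. cdot (f x) (g x))"
  unfolding cdot_def by (intro continuous_intros)

lemma continuous_on_vector_scale [continuous_intros]: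
  fixes f :: "'a::topological_space \<Rightarrow> complex"
  shows "continuous_on S f \<Longrightarrow> continuous_on S g \<Longrightarrow> continuous_on S (\<lambda>x. f x *s g x)"
  unfolding vector_scalar_mult_def by (intro continuous_intros)

lemma Hol_I:
  "(\<And>z. \<exists>f'. (f has_derivative f') (at z) \<and> (\<forall>c v. f' (c *s v) = c * f' v)) \<Longrightarrow> f \<in> Hol"
  by (simp add: Hol_def)

lemma Hol_D:
  assumes "f \<in> Hol"
  obtains f' where "(f has_derivative f') (at z)" "\<And>c v. f' (c *s v) = c * f' v"
  using assms unfolding Hol_def by blast

lemma Hol_continuous: "f \<in> Hol \<Longrightarrow> continuous_on UNIV f"
  by (meson Hol_D continuous_at_imp_continuous_on has_derivative_continuous)

lemma Hol_compose_field:
  assumes "f \<in> Hol" "\<And>w. (g has_field_derivative g' w) (at w)"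
  shows "(\<lambda>z. g (f z)) \<in> Hol"
proof (rule Hol_I)
  fix z
  obtain f' where f': "(f has_derivative f') (at z)" "\<And>c v. f' (c *s v) = c * f' v"
    using assms(1) by (rule Hol_D) blast
  have "((\<lambda>z. g (f z)) has_derivative (\<lambda>v. g' (f z) * f' v)) (at z)"
    using has_derivative_compose[OF f'(1)] assms(2)[of "f z"]
    by (simp add: has_field_derivative_def)
  then show "\<exists>F. ((\<lambda>z. g (f z)) has_derivative F) (at z) \<and> (\<forall>c v. F (c *s v) = c * F v)"
    using f'(2) by (intro exI[of _ "\<lambda>v. g' (f z) * f' v"]) simp
qed

lemma Hol_add:
  assumes "f \<in> Hol" "g \<in> Hol" shows "(\<lambda>z. f z + g z) \<in> Hol"
proof (rule Hol_I)
  fix z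
  obtain f' where f': "(f has_derivative f') (at z)" "\<And>c v. f' (c *s v) = c * f' v"
    using assms(1) by (rule Hol_D) blast
  obtain g' where g': "(g has_derivative g') (at z)" "\<And>c v. g' (c *s v) = c * g' v"
    using assms(2) by (rule Hol_D) blast
  have "((\<lambda>z. f z + g z) has_derivative (\<lambda>v. f' v + g' v)) (at z)"
    by (intro derivative_intros f' g')
  then show "\<exists>F. ((\<lambda>z. f z + g z) has_derivative F) (at z) \<and> (\<forall>c v. F (c *s v) = c * F v)"
    using f'(2) g'(2) by (intro exI[of _ "\<lambda>v. f' v + g' v"]) (simp add: algebra_simps)
qed

lemma Hol_mult:
  assumes "f \<in> Hol" "g \<in> Hol" shows "(\<lambda>z. f z * g z) \<in> Hol"
proof (rule Hol_I)
  fix z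
  obtain f' where f': "(f has_derivative f') (at z)" "\<And>c v. f' (c *s v) = c * f' v"
    using assms(1) by (rule Hol_D) blast
  obtain g' where g': "(g has_derivative g') (at z)" "\<And>c v. g' (c *s v) = c * g' v"
    using assms(2) by (rule Hol_D) blast
  have "((\<lambda>z. f z * g z) has_derivative (\<lambda>v. f z * g' v + f' v * g z)) (at z)"
    by (intro derivative_intros f' g')
  then show "\<exists>F. ((\<lambda>z. f z * g z) has_derivative F) (at z) \<and> (\<forall>c v. F (c *s v) = c * F v)"
    using f'(2) g'(2) by (intro exI[of _ "\<lambda>v. f z * g' v + f' v * g z"]) (simp add: algebra_simps)
qed

lemma Hol_const: "(\<lambda>z. c) \<in> Hol"
  by (rule Hol_I) (auto intro!: exI[of _ "\<lambda>v. 0"])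

lemma Hol_nth: "(\<lambda>z. z $ i) \<in> Hol"
  by (rule Hol_I) (auto intro!: exI[of _ "\<lambda>v. v $ i"] bounded_linear_imp_has_derivative bounded_linear_vec_nth)

lemma Hol_sum: "finite I \<Longrightarrow> (\<And>i. i \<in> I \<Longrightarrow> f i \<in> Hol) \<Longrightarrow> (\<lambda>z. \<Sum>i\<in>I. f i z) \<in> Hol"
  by (induction I rule: finite_induct) (auto intro: Hol_const Hol_add)

lemma Hol_exp: "f \<in> Hol \<Longrightarrow> (\<lambda>z. exp (f z)) \<in> Hol"
  by (rule Hol_compose_field) (auto intro: DERIV_exp)

lemma Hol_cdot:
  "(\<And>i. (\<lambda>z. f z $ i) \<in> Hol) \<Longrightarrow> (\<And>i. (\<lambda>z. g z $ i) \<in> Hol) \<Longrightarrow> (\<lambda>z. cdot (f z) (g z)) \<in> Hol"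
  unfolding cdot_def by (intro Hol_sum Hol_mult) auto

lemma Hol_compose_affine:
  fixes L :: "complex^'n \<Rightarrow> complex^'m"
  assumes "f \<in> Hol" "linear L" "\<And>c v. L (c *s v) = c *s L v"
  shows "(\<lambda>z. f (L z + a)) \<in> Hol"
proof (rule Hol_I)
  fix z
  obtain f' where f': "(f has_derivative f') (at (L z + a))" "\<And>c v. f' (c *s v) = c * f' v"
    using assms(1) by (rule Hol_D) blast
  have "((\<lambda>z. L z + a) has_derivative L) (at z)"
    using assms(2) by (auto intro!: derivative_eq_intros linear_imp_has_derivative)
  then have "((\<lambda>z. f (L z + a)) has_derivative (\<lambda>v. f' (L v))) (at z)"
    using has_derivative_compose f'(1) by blast
  then show "\<exists>F. ((\<lambda>z. f (L z + a)) has_derivative F) (at z) \<and> (\<forall>c v. F (c *s v) = c * F v)"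
    using f'(2) assms(3) by (intro exI[of _ "\<lambda>v. f' (L v)"]) simp
qed

text \<open>Restriction to complex lines makes the theory of one complex variable available.\<close>

lemma Hol_along_line:
  assumes "f \<in> Hol"
  shows "(\<lambda>t. f (a + t *s b)) holomorphic_on UNIV"
proof -
  have "(\<lambda>t. f (a + t *s b)) field_differentiable at t" for t
  proof -
    obtain f' where f': "(f has_derivative f') (at (a + t *s b))" "\<And>c v. f' (c *s v) = c * f' v"
      using assms by (rule Hol_D) blast
    have "linear (\<lambda>t::complex. t *s b)"
      by (rule linearI) (simp_all add: vector_sadd_rdistrib vec_eq_iff)
    then have "((\<lambda>t. a + t *s b) has_derivative (\<lambda>s. s *s b)) (at t)"
      by (auto intro!: derivative_eq_intros linear_imp_has_derivative)
    then have "((\<lambda>t. f (a + t *s b)) has_derivative (\<lambda>s. f' (s *s b))) (at t)"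
      using has_derivative_compose f'(1) by blast
    then have "((\<lambda>t. f (a + t *s b)) has_field_derivative (f' b)) (at t)"
      unfolding has_field_derivative_def f'(2) by (simp add: mult_commute_abs)
    then show ?thesis unfolding field_differentiable_def by blast
  qed
  then show ?thesis by (simp add: holomorphic_on_def)
qed

lemma has_derivative_quadratic_remainder:
  fixes f :: "'a::real_normed_vector \<Rightarrow> 'b::real_normed_vector"
  assumes f': "bounded_linear f'"
    and remainder: "\<And>v. norm v \<le> 1 \<Longrightarrow> norm (f (x + v) - f x - f' v) \<le> K * (norm v)\<^sup>2"
  shows "(f has_derivative f') (at x)"
  unfolding has_derivative_at2
proof (intro conjI f')
  show "((\<lambda>y. (1 / norm (y - x)) *\<^sub>R (f y - (f x + f' (y - x)))) \<longlongrightarrow> 0) (at x)"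
  proof (rule Lim_null_comparison)
    show "eventually (\<lambda>y. norm ((1 / norm (y - x)) *\<^sub>R (f y - (f x + f' (y - x)))) \<le> K * norm (y - x)) (at x)"
    proof (rule eventually_at[THEN iffD2], intro exI[of _ 1] conjI ballI impI)
      fix y assume "y \<noteq> x \<and> dist y x < 1"
      then have y: "y \<noteq> x" "norm (y - x) \<le> 1" by (auto simp: dist_norm)
      have "norm (f y - (f x + f' (y - x))) \<le> K * (norm (y - x))\<^sup>2"
        using remainder[OF y(2)] by (simp add: algebra_simps)
      then show "norm ((1 / norm (y - x)) *\<^sub>R (f y - (f x + f' (y - x)))) \<le> K * norm (y - x)"
        unfolding norm_scaleR using y(1) by (simp add: divide_le_eq power2_eq_square mult.assoc)
    qed simp
    have "((\<lambda>y. K * norm (y - x)) \<longlongrightarrow> K * norm (x - x)) (at x)"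
      by (intro tendsto_intros)
    then show "((\<lambda>y. K * norm (y - x)) \<longlongrightarrow> 0) (at x)" by simp
  qed
qed

lemma power2_le_two_exp: "t\<^sup>2 \<le> 2 * exp (t::real)" if "0 \<le> t"
  using exp_lower_Taylor_quadratic[OF that] that by simp

lemma exp_norm_cdot_le: "norm (exp (cdot z w)) \<le> exp (norm z * norm w)"
  using norm_exp[of "cdot z w"] norm_cdot_le[of z w] by (meson exp_le_cancel_iff order_trans)

text \<open>Differentiation under the integral sign: \<open>|e\<^sup>s - 1 - s| \<le> e\<^bsup>|Re s|\<^esup> |s|\<^sup>2\<close> with
  \<open>s = v \<cdot> y\<close> yields a quadratic remainder, whose constant is finite because \<open>w\<close> decays faster
  than every exponential.\<close>

lemma Laplace_transform_Hol:
  fixes w :: "real^'n \<Rightarrow> complex"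
  assumes [measurable]: "w \<in> borel_measurable lebesgue"
    and decay: "\<And>a. integrable lebesgue (\<lambda>y. exp (a * norm y) * norm (w y))"
  shows "(\<lambda>z. LINT y|lebesgue. exp (cdot z (of_real_vec y)) * w y) \<in> Hol"
proof (rule Hol_I)
  fix z :: "complex^'n"
  let ?E = "\<lambda>v y. exp (cdot v (of_real_vec y)) * w y"
  let ?D = "\<lambda>v y. cdot v (of_real_vec y) * (exp (cdot z (of_real_vec y)) * w y)"
  have [measurable]: "(\<lambda>y. cdot v (of_real_vec y)) \<in> borel_measurable lebesgue" for v
    by (intro continuous_on_imp_borel_measurable_lebesgue continuous_intros)
  have E_le: "norm (?E v y) \<le> exp (norm v * norm y) * norm (w y)" for v y
    using exp_norm_cdot_le[of v "of_real_vec y"] by (simp add: norm_mult mult_right_mono)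
  have E_int: "integrable lebesgue (?E v)" for v
    by (rule integrable_dominated[OF _ E_le decay]) measurable
  have D_le: "norm (?D v y) \<le> norm v * (exp ((norm z + 1) * norm y) * norm (w y))" for v y
  proof -
    have "norm (?D v y) \<le> (norm v * norm y) * (exp (norm z * norm y) * norm (w y))"
      using norm_cdot_le[of v "of_real_vec y"] E_le[of z y]
      unfolding norm_mult[of "cdot v (of_real_vec y)"] by (intro mult_mono) auto
    also have "\<dots> \<le> (norm v * exp (norm y)) * (exp (norm z * norm y) * norm (w y))"
    proof -
      have "norm y \<le> exp (norm y)" using exp_ge_add_one_self[of "norm y"] by linarith
      then show ?thesis by (intro mult_right_mono mult_left_mono) auto
    qed
    also have "\<dots> = norm v * (exp ((norm z + 1) * norm y) * norm (w y))"
      by (simp add: algebra_simps exp_add)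
    finally show ?thesis .
  qed
  have D_int: "integrable lebesgue (?D v)" for v
    by (rule integrable_dominated[OF _ D_le]) (use decay in \<open>auto intro: integrable_mult_right\<close>)
  define f' where "f' v = (LINT y|lebesgue. ?D v y)" for v
  have f'_scale: "f' (c *s v) = c * f' v" for c v
    by (simp add: f'_def cdot_scale_left mult.assoc)
  have f'_bl: "bounded_linear f'"
  proof (rule bounded_linear_intro)
    show "f' (u + v) = f' u + f' v" for u v
      using D_int by (simp add: f'_def cdot_add_left distrib_right)
    show "f' (r *\<^sub>R v) = r *\<^sub>R f' v" for r v
      by (simp only: f'_def cdot_scaleR_left mult.assoc integral_mult_right_zero
          scaleR_conv_of_real[where 'a=complex])
    show "norm (f' v) \<le> norm v * (LINT y|lebesgue. exp ((norm z + 1) * norm y) * norm (w y))" for v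
    proof -
      have "norm (f' v) \<le> (LINT y|lebesgue. norm (?D v y))"
        unfolding f'_def by (rule integral_norm_bound)
      also have "\<dots> \<le> (LINT y|lebesgue. norm v * (exp ((norm z + 1) * norm y) * norm (w y)))"
        using decay by (intro integral_mono D_le integrable_norm D_int integrable_mult_right) auto
      finally show ?thesis by simp
    qed
  qed
  define K where "K = (LINT y|lebesgue. 2 * (exp ((norm z + 2) * norm y) * norm (w y)))"
  have "((\<lambda>z. LINT y|lebesgue. ?E z y) has_derivative f') (at z)"
  proof (rule has_derivative_quadratic_remainder[OF f'_bl, where K=K])
    fix v :: "complex^'n" assume v: "norm v \<le> 1"
    let ?s = "\<lambda>y. cdot v (of_real_vec y)"
    let ?R = "\<lambda>y. (exp (?s y) - 1 - ?s y) * ?E z y"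
    have R_eq: "?R y = ?E (z + v) y - ?E z y - ?D v y" for y
      by (simp add: cdot_add_left exp_add algebra_simps)
    have R_le: "norm (?R y) \<le> (norm v)\<^sup>2 * (2 * (exp ((norm z + 2) * norm y) * norm (w y)))" for y
    proof -
      have s: "norm (?s y) \<le> norm v * norm y" using norm_cdot_le[of v "of_real_vec y"] by simp
      have "norm (exp (?s y) - 1 - ?s y) \<le> exp \<bar>Re (?s y)\<bar> * (norm (?s y))\<^sup>2"
        using Taylor_exp[of "?s y" 1] by (simp add: power2_eq_square algebra_simps)
      also have "\<dots> \<le> exp (norm y) * (norm v * norm y)\<^sup>2"
      proof (intro mult_mono power_mono s)
        have "\<bar>Re (?s y)\<bar> \<le> norm y"
          using abs_Re_le_cmod[of "?s y"] s mult_right_mono[OF v norm_ge_zero, of y] by simp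
        then show "exp \<bar>Re (?s y)\<bar> \<le> exp (norm y)" by simp
      qed auto
      also have "\<dots> \<le> exp (norm y) * ((norm v)\<^sup>2 * (2 * exp (norm y)))"
        using power2_le_two_exp[of "norm y"]
        by (simp add: power_mult_distrib mult_left_mono)
      finally have "norm (?R y) \<le> (exp (norm y) * ((norm v)\<^sup>2 * (2 * exp (norm y)))) * (exp (norm z * norm y) * norm (w y))"
        unfolding norm_mult[of "exp (?s y) - 1 - ?s y"] using E_le[of z y] by (intro mult_mono) auto
      also have "\<dots> = (norm v)\<^sup>2 * (2 * (exp ((norm z + 2) * norm y) * norm (w y)))"
      proof -
        have "exp ((norm z + 2) * norm y) = exp (norm y) * (exp (norm y) * exp (norm z * norm y))"
          by (simp add: algebra_simps flip: exp_add)
        then show ?thesis by (simp only: mult_ac)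
      qed
      finally show ?thesis .
    qed
    have R_int: "integrable lebesgue ?R"
      unfolding R_eq using E_int D_int by simp
    have "(LINT y|lebesgue. ?E (z + v) y) - (LINT y|lebesgue. ?E z y) - f' v = (LINT y|lebesgue. ?R y)"
      unfolding R_eq f'_def using E_int D_int by simp
    also have "norm \<dots> \<le> (LINT y|lebesgue. norm (?R y))" by (rule integral_norm_bound)
    also have "\<dots> \<le> (LINT y|lebesgue. (norm v)\<^sup>2 * (2 * (exp ((norm z + 2) * norm y) * norm (w y))))"
      using decay by (intro integral_mono R_le integrable_norm R_int integrable_mult_right) auto
    also have "\<dots> = K * (norm v)\<^sup>2" by (simp add: K_def)
    finally show "norm ((LINT y|lebesgue. ?E (z + v) y) - (LINT y|lebesgue. ?E z y) - f' v) \<le> K * (norm v)\<^sup>2" .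
  qed
  then show "\<exists>F. ((\<lambda>z. LINT y|lebesgue. ?E z y) has_derivative F) (at z) \<and> (\<forall>c v. F (c *s v) = c * F v)"
    using f'_scale by blast
qed

text \<open>The number is \<open>\<pi>\<^bsup>n/2\<^esup>\<close>; the type argument records the dimension \<open>n\<close>.\<close>

definition gaussian_mass :: "'n::finite itself \<Rightarrow> real" where
  "gaussian_mass _ = (LINT y|lebesgue. exp (- (norm (y :: real^'n))\<^sup>2))"

lemma integral_pos_of_pos_continuous:
  fixes f :: "'a::euclidean_space \<Rightarrow> real"
  assumes "integrable lebesgue f" "\<And>x. f x > 0"
  shows "0 < (LINT x|lebesgue. f x)"
proof -
  have "(LINT x|lebesgue. f x) \<noteq> 0"
  proof
    assume "(LINT x|lebesgue. f x) = 0"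
    then have "AE x in lebesgue. f x = 0"
      using integral_nonneg_eq_0_iff_AE[OF assms(1)] assms(2) by (simp add: less_imp_le)
    then have "AE x in (lebesgue :: 'a measure). False"
      by eventually_elim (use assms(2) in \<open>metis less_irrefl\<close>)
    then have "emeasure lebesgue (UNIV :: 'a set) = 0"
      by (simp add: AE_iff_measurable[OF _ refl])
    then show False by simp
  qed
  moreover have "0 \<le> (LINT x|lebesgue. f x)"
    using assms(2) by (intro integral_nonneg_AE) (simp add: less_imp_le)
  ultimately show ?thesis by simp
qed

lemma gaussian_mass_pos: "0 < gaussian_mass TYPE('n::finite)"
  unfolding gaussian_mass_def
  using gaussian_integrable[of 1] by (intro integral_pos_of_pos_continuous) auto

lemma norm_diff_half_sq:
  fixes x y :: "'a::real_inner"
  shows "- (norm (- (1/2) *\<^sub>R x + y))\<^sup>2 = x \<bullet> y - (norm y)\<^sup>2 - (norm x)\<^sup>2 / 4"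
  unfolding power2_norm_eq_inner by (simp add: algebra_simps inner_commute)

lemma cdot_of_real_vec: "cdot (of_real_vec x) (of_real_vec y) = complex_of_real (x \<bullet> y)"
  by (simp add: cdot_def of_real_vec_def inner_vec_def)

text \<open>For real \<open>z\<close> this is completion of the square followed by a translation; both sides being
  entire, the identity theorem extends it to all complex \<open>z\<close>.\<close>

lemma gaussian_Laplace_transform:
  fixes z :: "complex^'n"
  shows "(LINT y|lebesgue. exp (cdot z (of_real_vec y)) * exp (- complex_of_real ((norm y)\<^sup>2)))
    = of_real (gaussian_mass TYPE('n)) * exp (cdot z z / 4)"
proof -
  let ?w = "\<lambda>y::real^'n. exp (- complex_of_real ((norm y)\<^sup>2))"
  define F where "F z = (LINT y|lebesgue. exp (cdot z (of_real_vec y)) * ?w y)" for z :: "complex^'n"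
  define G where "G z = of_real (gaussian_mass TYPE('n)) * exp (cdot z z * (1 / 4))" for z :: "complex^'n"
  have norm_w: "norm (?w y) = exp (- (norm y)\<^sup>2)" for y :: "real^'n"
    by (simp add: norm_exp_eq_Re flip: of_real_power)
  have F_Hol: "F \<in> Hol"
    unfolding F_def
  proof (rule Laplace_transform_Hol)
    show "?w \<in> borel_measurable lebesgue"
      by (intro continuous_on_imp_borel_measurable_lebesgue continuous_intros)
    show "integrable lebesgue (\<lambda>y::real^'n. exp (a * norm y) * norm (?w y))" for a
      unfolding norm_w using gaussian_linear_integrable[of 1 a] by (simp add: exp_diff exp_minus divide_inverse)
  qed
  have G_Hol: "G \<in> Hol"
    unfolding G_def by (intro Hol_mult Hol_const Hol_exp Hol_cdot Hol_nth)
  have real_case: "F (of_real_vec x) = G (of_real_vec x)" for x :: "real^'n"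
  proof -
    have "F (of_real_vec x) = (LINT y|lebesgue. of_real (exp ((norm x)\<^sup>2 / 4)) * of_real (exp (- (norm (- (1/2) *\<^sub>R x + y))\<^sup>2)))"
      unfolding F_def norm_diff_half_sq cdot_of_real_vec
      by (intro Bochner_Integration.integral_cong refl) (simp flip: exp_of_real exp_add)
    also have "\<dots> = of_real (exp ((norm x)\<^sup>2 / 4)) * (LINT y|lebesgue. complex_of_real (exp (- (norm (- (1/2) *\<^sub>R x + y))\<^sup>2)))"
      by (rule integral_mult_right_zero)
    also have "(LINT y|lebesgue. complex_of_real (exp (- (norm (- (1/2) *\<^sub>R x + y))\<^sup>2)))
        = (LINT y|lebesgue. complex_of_real (exp (- (norm (y :: real^'n))\<^sup>2)))"
      by (rule lebesgue_integral_translate) (intro borel_measurable_continuous_onI continuous_intros)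
    also have "\<dots> = of_real (gaussian_mass TYPE('n))"
      by (simp only: gaussian_mass_def integral_complex_of_real)
    finally show ?thesis
      by (simp add: G_def cdot_of_real_vec power2_norm_eq_inner mult.commute flip: exp_of_real)
  qed
  \<comment> \<open>Both sides are entire along the complex line through the real points \<open>Re z\<close> and
    \<open>Re z + Im z\<close>, agree at its real points, and \<open>z\<close> is the point with parameter \<open>\<i>\<close>.\<close>
  define a where "a = (\<chi> i. Re (z $ i))"
  define b where "b = (\<chi> i. Im (z $ i))"
  define H where "H t = F (of_real_vec a + t *s of_real_vec b) - G (of_real_vec a + t *s of_real_vec b)" for t
  have "H \<i> = 0"
  proof (rule analytic_continuation[where f=H and S=UNIV and U="range complex_of_real" and \<xi>=0])
    show "H holomorphic_on UNIV"
      unfolding H_def using F_Hol G_Hol by (intro holomorphic_on_diff Hol_along_line)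
    show "0 islimpt range complex_of_real"
    proof (rule islimpt_approachable[THEN iffD2], intro allI impI)
      fix e :: real assume "0 < e"
      then show "\<exists>x'\<in>range complex_of_real. x' \<noteq> 0 \<and> dist x' 0 < e"
        by (intro bexI[OF _ rangeI[of complex_of_real "e/2"]]) auto
    qed
    show "H t = 0" if t: "t \<in> range complex_of_real" for t
    proof -
      obtain r where "t = complex_of_real r" using t by blast
      then have "of_real_vec a + t *s of_real_vec b = of_real_vec (a + r *\<^sub>R b)"
        by (simp add: of_real_vec_def vec_eq_iff)
      then show ?thesis by (simp add: H_def real_case)
    qed
  qed auto
  moreover have "of_real_vec a + \<i> *s of_real_vec b = z"
    by (simp add: of_real_vec_def vec_eq_iff a_def b_def complex_eq[symmetric])
  ultimately have "F z = G z" by (simp add: H_def)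
  then show ?thesis by (simp add: F_def G_def)
qed

section \<open>The Bargmann transform, coherent states and the adjoint\<close>

text \<open>The factor \<open>e\<^bsup>z \<cdot> z / 4\<^esup>\<close> is chosen so that the target weight is the rotation invariant Gaussian
  \<open>e\<^bsup>-|z|\<^sup>2/2\<^esup>\<close>; without it the weight would be \<open>e\<^bsup>-|Im z|\<^sup>2\<^esup>\<close>.\<close>

definition bargmann_kernel :: "complex^'n \<Rightarrow> real^'n \<Rightarrow> complex" where
  "bargmann_kernel z y =
     exp (cdot z z / 4 + \<i> * cdot z (of_real_vec y) - complex_of_real ((norm y)\<^sup>2 / 2))"

definition bargmann :: "(real^'n \<Rightarrow> complex) \<Rightarrow> complex^'n \<Rightarrow> complex" where
  "bargmann u z = (LINT y|lebesgue. bargmann_kernel z y * u y)"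

text \<open>The Fock space is \<open>H_space fock_weight 1\<close>; the density \<open>e\<^bsup>-2\<Phi>\<^esup>\<close> is then \<open>e\<^bsup>-|z|\<^sup>2/2\<^esup>\<close>.\<close>

abbreviation fock_weight :: "complex^'n \<Rightarrow> real" where
  "fock_weight \<equiv> (\<lambda>z. (norm z)\<^sup>2 / 4)"

abbreviation fock :: "(complex^'n) measure" where
  "fock \<equiv> weighted_lebesgue fock_weight 1"

lemma fock_eq: "fock = density lebesgue (\<lambda>z. ennreal (exp (- ((norm z)\<^sup>2 / 2))))"
  by (simp add: weighted_lebesgue_def)

lemma sets_weighted_lebesgue [measurable_cong]: "sets (weighted_lebesgue \<Phi> h) = sets lebesgue"
  by (simp add: weighted_lebesgue_def)

lemma space_weighted_lebesgue [simp]: "space (weighted_lebesgue \<Phi> h) = UNIV"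
  by (simp add: weighted_lebesgue_def)

lemma borel_measurable_weighted_lebesgue [simp]:
  "borel_measurable (weighted_lebesgue \<Phi> h) = borel_measurable lebesgue"
  by (rule measurable_cong_sets) (simp_all add: sets_weighted_lebesgue)

lemma exp_quadratic_measurable [measurable]:
  "(\<lambda>z::'a::euclidean_space. exp (- ((norm z)\<^sup>2 / 2))) \<in> borel_measurable lebesgue"
  by (intro continuous_on_imp_borel_measurable_lebesgue continuous_intros) auto

lemma finite_measure_fock: "finite_measure (fock :: (complex^'n) measure)"
proof (rule finite_measureI)
  have "integrable lebesgue (\<lambda>z::complex^'n. exp (- ((norm z)\<^sup>2 / 2)))"
    using gaussian_integrable[of "1/2"] by simp
  then have "(\<integral>\<^sup>+z. ennreal (exp (- ((norm (z :: complex^'n))\<^sup>2 / 2))) \<partial>lebesgue) < \<infinity>"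
    by (simp add: integrable_iff_bounded)
  then show "emeasure (fock :: (complex^'n) measure) (space fock) \<noteq> \<infinity>"
    unfolding fock_eq by (simp add: emeasure_density)
qed

lemma sigma_finite_fock: "sigma_finite_measure (fock :: (complex^'n) measure)"
  using finite_measure_fock by (rule finite_measure.axioms(1))

lemma nn_integral_fock:
  fixes f :: "complex^'n \<Rightarrow> ennreal"
  assumes "f \<in> borel_measurable lebesgue"
  shows "(\<integral>\<^sup>+z. f z \<partial>fock) = (\<integral>\<^sup>+z. ennreal (exp (- ((norm z)\<^sup>2 / 2))) * f z \<partial>lborel)"
  unfolding fock_eq using assms by (simp add: nn_integral_density nn_integral_completion)

lemma integral_fock:
  fixes f :: "complex^'n \<Rightarrow> complex"
  assumes "f \<in> borel_measurable lebesgue"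
  shows "(LINT z|fock. f z) = (LINT z|lebesgue. of_real (exp (- ((norm z)\<^sup>2 / 2))) * f z)"
  unfolding fock_eq using assms by (subst integral_density) (auto simp: scaleR_conv_of_real)

lemma fock_L2_iff:
  fixes F :: "complex^'n \<Rightarrow> complex"
  assumes [measurable]: "F \<in> borel_measurable lebesgue"
  shows "F \<in> L2 fock \<longleftrightarrow> integrable lebesgue (\<lambda>z. exp (- ((norm z)\<^sup>2 / 2)) * (norm (F z))\<^sup>2)"
proof -
  have "integrable fock (\<lambda>z. (norm (F z))\<^sup>2)
      \<longleftrightarrow> integrable lebesgue (\<lambda>z. exp (- ((norm z)\<^sup>2 / 2)) * (norm (F z))\<^sup>2)"
    unfolding fock_eq by (subst integrable_density) auto
  then show ?thesis by (simp add: L2_def)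
qed

lemma norm_integral_le_nn_integral:
  fixes f :: "'a \<Rightarrow> 'b::{banach, second_countable_topology}"
  shows "ennreal (norm (integral\<^sup>L M f)) \<le> (\<integral>\<^sup>+x. ennreal (norm (f x)) \<partial>M)"
  by (cases "integrable M f") (auto simp: integral_norm_bound_ennreal not_integrable_integral_eq)

lemma continuous_on_bargmann_kernel [continuous_intros]:
  "continuous_on S f \<Longrightarrow> continuous_on S g \<Longrightarrow> continuous_on S (\<lambda>x. bargmann_kernel (f x) (g x))"
  unfolding bargmann_kernel_def by (intro continuous_intros) auto

lemma bargmann_kernel_eq:
  "bargmann_kernel z y = exp (cdot z z / 4) * (exp (cdot (\<i> *s z) (of_real_vec y)) * of_real (exp (- ((norm y)\<^sup>2 / 2))))"
  unfolding bargmann_kernel_def cdot_scale_left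
  by (simp add: exp_of_real[symmetric] exp_add[symmetric] algebra_simps)

lemma norm_bargmann_kernel_le:
  assumes "norm z \<le> R"
  shows "norm (bargmann_kernel z y) \<le> exp (R\<^sup>2 / 4) * exp (R * norm y - (norm y)\<^sup>2 / 2)"
proof -
  have "norm (bargmann_kernel z y) = exp (Re (cdot z z) / 4 + Re (\<i> * cdot z (of_real_vec y)) - (norm y)\<^sup>2 / 2)"
    unfolding bargmann_kernel_def by (simp add: norm_exp_eq_Re)
  also have "\<dots> \<le> exp (R\<^sup>2 / 4 + R * norm y - (norm y)\<^sup>2 / 2)"
  proof -
    have "Re (cdot z z) \<le> norm z * norm z"
      using complex_Re_le_cmod[of "cdot z z"] norm_cdot_le[of z z] by linarith
    moreover have "norm z * norm z \<le> R\<^sup>2"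
      using power_mono[OF assms norm_ge_zero, of 2] by (simp add: power2_eq_square)
    moreover have "Re (\<i> * cdot z (of_real_vec y)) \<le> norm z * norm y"
      using complex_Re_le_cmod[of "\<i> * cdot z (of_real_vec y)"] norm_cdot_le[of z "of_real_vec y"]
      by (simp add: norm_mult)
    moreover have "norm z * norm y \<le> R * norm y"
      using assms by (simp add: mult_right_mono)
    ultimately show ?thesis by simp
  qed
  finally show ?thesis by (simp flip: exp_add add: add_diff_eq)
qed

lemma bargmann_kernel_measurable: "bargmann_kernel z \<in> borel_measurable lebesgue"
  by (intro continuous_on_imp_borel_measurable_lebesgue continuous_intros)

lemma gaussian_bound_L2:
  fixes v :: "real^'n \<Rightarrow> complex"
  assumes [measurable]: "v \<in> borel_measurable lebesgue"
    and le: "\<And>y. norm (v y) \<le> C * exp (a * norm y - (norm y)\<^sup>2 / 2)"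
  shows "v \<in> L2 lebesgue"
proof -
  have "integrable lebesgue (\<lambda>y. (norm (v y))\<^sup>2)"
  proof (rule integrable_dominated)
    show "integrable lebesgue (\<lambda>y::real^'n. C\<^sup>2 * exp (2 * a * norm y - 1 * (norm y)\<^sup>2))"
      by (intro integrable_mult_right gaussian_linear_integrable) simp
    show "norm ((norm (v y))\<^sup>2) \<le> C\<^sup>2 * exp (2 * a * norm y - 1 * (norm y)\<^sup>2)" for y
    proof -
      have "(norm (v y))\<^sup>2 \<le> (C * exp (a * norm y - (norm y)\<^sup>2 / 2))\<^sup>2"
        using le by (intro power_mono) auto
      also have "\<dots> = C\<^sup>2 * exp (2 * a * norm y - 1 * (norm y)\<^sup>2)"
        by (simp add: power_mult_distrib exp_double[symmetric] algebra_simps)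
      finally show ?thesis by simp
    qed
  qed measurable
  then show ?thesis by (simp add: L2_def)
qed

lemma bargmann_kernel_L2: "bargmann_kernel z \<in> L2 lebesgue"
  by (rule gaussian_bound_L2[OF bargmann_kernel_measurable norm_bargmann_kernel_le[OF order_refl]])

lemma gaussian_exp_L2:
  "(\<lambda>y::real^'n. complex_of_real (exp (a * norm y - (norm y)\<^sup>2 / 2))) \<in> L2 lebesgue"
proof (rule gaussian_bound_L2[where C=1 and a=a])
  show "(\<lambda>y::real^'n. complex_of_real (exp (a * norm y - (norm y)\<^sup>2 / 2))) \<in> borel_measurable lebesgue"
    by (intro continuous_on_imp_borel_measurable_lebesgue continuous_intros) auto
qed simp

lemma L2_gaussian_decay_integrable:
  fixes u :: "real^'n \<Rightarrow> complex"
  assumes "u \<in> L2 lebesgue"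
  shows "integrable lebesgue (\<lambda>y. exp (a * norm y - (norm y)\<^sup>2 / 2) * norm (u y))"
  using integrable_norm[OF L2_product_integrable[OF gaussian_exp_L2[of a] assms]]
  by (simp add: norm_mult)

lemma bargmann_Hol:
  fixes u :: "real^'n \<Rightarrow> complex"
  assumes u: "u \<in> L2 lebesgue"
  shows "bargmann u \<in> Hol"
proof -
  define w where "w y = of_real (exp (- ((norm y)\<^sup>2 / 2))) * u y" for y :: "real^'n"
  note [measurable] = L2_measurable[OF u]
  have "(\<lambda>z. LINT y|lebesgue. exp (cdot z (of_real_vec y)) * w y) \<in> Hol"
  proof (rule Laplace_transform_Hol)
    show "w \<in> borel_measurable lebesgue" unfolding w_def by measurable
    show "integrable lebesgue (\<lambda>y. exp (a * norm y) * norm (w y))" for a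
    proof -
      have "exp (a * norm y) * norm (w y) = exp (a * norm y - (norm y)\<^sup>2 / 2) * norm (u y)" for y
        by (simp add: w_def norm_mult mult.assoc[symmetric] flip: exp_add)
      then show ?thesis using L2_gaussian_decay_integrable[OF u, of a] by (simp only:)
    qed
  qed
  then have "(\<lambda>z. LINT y|lebesgue. exp (cdot (\<i> *s z + 0) (of_real_vec y)) * w y) \<in> Hol"
    by (rule Hol_compose_affine)
       (auto intro!: linearI simp: vec_eq_iff algebra_simps)
  moreover have "(\<lambda>z::complex^'n. exp (cdot z z * (1 / 4))) \<in> Hol"
    by (intro Hol_mult Hol_const Hol_exp Hol_cdot Hol_nth)
  ultimately have "(\<lambda>z. exp (cdot z z * (1 / 4)) * (LINT y|lebesgue. exp (cdot (\<i> *s z + 0) (of_real_vec y)) * w y)) \<in> Hol"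
    by (rule Hol_mult[rotated])
  moreover have "bargmann u = (\<lambda>z. exp (cdot z z * (1 / 4)) * (LINT y|lebesgue. exp (cdot (\<i> *s z + 0) (of_real_vec y)) * w y))"
    unfolding bargmann_def bargmann_kernel_eq w_def mult.assoc integral_mult_right_zero by simp
  ultimately show ?thesis by simp
qed

lemma bargmann_measurable:
  "u \<in> L2 lebesgue \<Longrightarrow> bargmann u \<in> borel_measurable borel"
  by (intro borel_measurable_continuous_onI Hol_continuous bargmann_Hol)

lemma bargmann_lincomb:
  assumes "u \<in> L2 lebesgue" "v \<in> L2 lebesgue"
  shows "bargmann (\<lambda>y. a * u y + b * v y) z = a * bargmann u z + b * bargmann v z"
proof -
  note int = L2_product_integrable[OF bargmann_kernel_L2[of z] assms(1)]
    L2_product_integrable[OF bargmann_kernel_L2[of z] assms(2)]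
  have "bargmann (\<lambda>y. a * u y + b * v y) z
      = (LINT y|lebesgue. a * (bargmann_kernel z y * u y) + b * (bargmann_kernel z y * v y))"
    by (simp add: bargmann_def algebra_simps)
  also have "\<dots> = a * bargmann u z + b * bargmann v z"
    unfolding bargmann_def using int
    by (subst Bochner_Integration.integral_add) simp_all
  finally show ?thesis .
qed

text \<open>These functions represent the point evaluations of the Bargmann transform.\<close>

definition coherent_state :: "complex^'n \<Rightarrow> real^'n \<Rightarrow> complex" where
  "coherent_state w y = cnj (bargmann_kernel w y)"

lemma coherent_state_L2: "coherent_state w \<in> L2 lebesgue"
  unfolding coherent_state_def[abs_def] by (rule L2_cnj[OF bargmann_kernel_L2])

lemma bargmann_eq_inner: "bargmann u w = L2_inner lebesgue u (coherent_state w)"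
  by (simp add: bargmann_def L2_inner_def coherent_state_def mult.commute)

text \<open>The integrand is a Gaussian in \<open>y\<close> with complex linear term \<open>\<i> (z - cnj w) \<cdot> y\<close>; after
  integration the squares \<open>z \<cdot> z\<close> and \<open>cnj w \<cdot> cnj w\<close> cancel and only the cross term remains.\<close>

lemma bargmann_coherent_state:
  fixes w :: "complex^'n"
  shows "bargmann (coherent_state w) z
    = of_real (gaussian_mass TYPE('n)) * exp (cdot z (cnj_vec w) / 2)"
proof -
  let ?c = "cdot z z / 4 + cnj (cdot w w) / 4"
  have cnj_real: "cnj (cdot w (of_real_vec y)) = cdot (cnj_vec w) (of_real_vec y)" for y
    by (simp add: cdot_def cnj_vec_def of_real_vec_def)
  have "bargmann_kernel z y * coherent_state w y
      = exp ?c * (exp (cdot (\<i> *s (z - cnj_vec w)) (of_real_vec y)) * exp (- complex_of_real ((norm y)\<^sup>2)))" for y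
    unfolding bargmann_kernel_def coherent_state_def exp_cnj
    by (simp add: cnj_real cdot_scale_left cdot_diff_left algebra_simps flip: exp_add)
  then have "bargmann (coherent_state w) z
      = exp ?c * (of_real (gaussian_mass TYPE('n)) * exp (cdot (\<i> *s (z - cnj_vec w)) (\<i> *s (z - cnj_vec w)) / 4))"
    unfolding bargmann_def by (simp only: integral_mult_right_zero gaussian_Laplace_transform)
  also have "\<dots> = of_real (gaussian_mass TYPE('n)) * exp (?c + cdot (\<i> *s (z - cnj_vec w)) (\<i> *s (z - cnj_vec w)) / 4)"
    by (simp add: exp_add)
  also have "?c + cdot (\<i> *s (z - cnj_vec w)) (\<i> *s (z - cnj_vec w)) / 4 = cdot z (cnj_vec w) / 2"
    unfolding cdot_scale_left cdot_scale_right cdot_diff_left cdot_diff_right cdot_cnj_vec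
    by (simp add: cdot_commute[of "cnj_vec w" z] field_simps)
  finally show ?thesis .
qed

text \<open>The adjoint on bounded functions with bounded support, where it is given by an absolutely
  convergent integral. On a ball the kernel is dominated by one Gaussian in \<open>y\<close>, which justifies
  Fubini.\<close>

lemma
  fixes g :: "complex^'n \<Rightarrow> complex"
  assumes g[measurable]: "g \<in> borel_measurable lebesgue"
    and g_le: "\<And>z. norm (g z) \<le> B * indicator (cball 0 R) z"
  defines "v \<equiv> \<lambda>y. LINT z|fock. coherent_state z y * g z"
  shows bargmann_adjoint_L2: "v \<in> L2 lebesgue"
    and bargmann_adjoint: "u \<in> L2 lebesgue \<Longrightarrow> L2_inner fock (bargmann u) g = L2_inner lebesgue u v"
proof -
  interpret fock: finite_measure "fock :: (complex^'n) measure" by (rule finite_measure_fock)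
  let ?e = "\<lambda>y::real^'n. exp (R * norm y - (norm y)\<^sup>2 / 2)"
  define f where "f z = exp (R\<^sup>2 / 4) * (B * indicator (cball 0 R) z)" for z :: "complex^'n"
  have f_int: "integrable fock f"
  proof -
    have "(indicator (cball 0 R) :: complex^'n \<Rightarrow> real) \<in> borel_measurable lebesgue"
      by (intro borel_measurable_indicator) simp
    then have "integrable fock (indicator (cball 0 R) :: complex^'n \<Rightarrow> real)"
      by (intro fock.integrable_const_bound[where B=1]) (simp_all add: indicator_def)
    then show ?thesis unfolding f_def by simp
  qed
  have [measurable]: "case_prod coherent_state \<in> borel_measurable ((lebesgue :: (complex^'n) measure) \<Otimes>\<^sub>M lebesgue)"
    unfolding coherent_state_def[abs_def]
    by (intro borel_measurable_pair_lebesgue borel_measurable_continuous_onI continuous_intros)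
  have pair_sets: "sets (fock \<Otimes>\<^sub>M lebesgue) = sets ((lebesgue :: (complex^'n) measure) \<Otimes>\<^sub>M (lebesgue :: (real^'n) measure))"
    by (intro sets_pair_measure_cong sets_weighted_lebesgue refl)
  have kernel_le: "norm (coherent_state z y * g z) \<le> f z * ?e y" for z y
  proof (cases "norm z \<le> R")
    case True
    have "norm (coherent_state z y * g z) \<le> (exp (R\<^sup>2 / 4) * ?e y) * (B * indicator (cball 0 R) z)"
      unfolding norm_mult coherent_state_def complex_mod_cnj
      using norm_bargmann_kernel_le[OF True] g_le by (intro mult_mono) auto
    then show ?thesis by (simp add: f_def mult_ac)
  next
    case False
    then have "g z = 0" using g_le[of z] by simp
    then show ?thesis using False by (simp add: f_def)
  qed
  have e_int: "integrable lebesgue ?e"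
    using gaussian_linear_integrable[of "1/2" R] by simp
  show v: "v \<in> L2 lebesgue"
  proof (rule gaussian_bound_L2)
    show "v \<in> borel_measurable lebesgue"
      unfolding v_def
    proof (rule integral_measurable_dominated[OF sigma_finite_lebesgue sigma_finite_fock _ e_int f_int])
      show "(\<lambda>(y, z). coherent_state z y * g z) \<in> borel_measurable (lebesgue \<Otimes>\<^sub>M fock)"
        by measurable
      show "norm (coherent_state z y * g z) \<le> ?e y * f z" for y z
        using kernel_le[of z y] by (simp add: mult.commute)
    qed
    show "norm (v y) \<le> (LINT z|fock. f z) * exp (R * norm y - (norm y)\<^sup>2 / 2)" for y
    proof -
      have "norm (v y) \<le> (LINT z|fock. norm (coherent_state z y * g z))"
        unfolding v_def by (rule integral_norm_bound)
      also have "\<dots> \<le> (LINT z|fock. f z * ?e y)"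
      proof (rule integral_mono_AE')
        show "integrable fock (\<lambda>z. f z * ?e y)" using f_int by simp
        show "AE z in fock. norm (coherent_state z y * g z) \<le> f z * ?e y" using kernel_le by simp
        show "AE z in fock. 0 \<le> f z * ?e y"
          using order_trans[OF norm_ge_zero kernel_le] by simp
      qed
      finally show ?thesis by simp
    qed
  qed
  assume u: "u \<in> L2 lebesgue"
  note [measurable] = L2_measurable[OF u]
  let ?F = "\<lambda>z y. (bargmann_kernel z y * u y) * cnj (g z)"
  have F_eq: "?F z y = u y * cnj (coherent_state z y * g z)" for z y
    by (simp add: coherent_state_def)
  have "L2_inner fock (bargmann u) g = (LINT z|fock. LINT y|lebesgue. ?F z y)"
    by (simp add: L2_inner_def bargmann_def)
  also have "\<dots> = (LINT y|lebesgue. LINT z|fock. ?F z y)"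
  proof (rule integrals_swap_dominated[OF sigma_finite_fock sigma_finite_lebesgue _ f_int])
    show "(\<lambda>(z, y). ?F z y) \<in> borel_measurable (fock \<Otimes>\<^sub>M lebesgue)"
      unfolding F_eq by measurable
    show "integrable lebesgue (\<lambda>y. ?e y * norm (u y))"
      by (rule L2_gaussian_decay_integrable[OF u])
    show "norm (?F z y) \<le> f z * (?e y * norm (u y))" for z y
      unfolding F_eq norm_mult[of "u y"] complex_mod_cnj
      using mult_right_mono[OF kernel_le[of z y] norm_ge_zero[of "u y"]] by (simp add: mult_ac)
  qed
  also have "\<dots> = L2_inner lebesgue u v"
    unfolding F_eq L2_inner_def v_def by (simp del: complex_cnj_mult)
  finally show "L2_inner fock (bargmann u) g = L2_inner lebesgue u v" .
qed

section \<open>Boundedness on the Fock space\<close>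

text \<open>The Schur test for a symmetric convolution kernel: bound \<open>G x * G y\<close> by the mean of the
  squares and integrate out the other variable.\<close>

lemma nn_integral_Schur_convolution:
  fixes G E :: "'a::euclidean_space \<Rightarrow> ennreal"
  assumes [measurable]: "G \<in> borel_measurable borel" "E \<in> borel_measurable borel"
    and even: "\<And>x. E (- x) = E x"
  shows "(\<integral>\<^sup>+x. \<integral>\<^sup>+y. G x * G y * E (x - y) \<partial>lborel \<partial>lborel)
    \<le> (\<integral>\<^sup>+x. E x \<partial>lborel) * (\<integral>\<^sup>+x. (G x)\<^sup>2 \<partial>lborel)"
proof -
  let ?I = "\<integral>\<^sup>+x. \<integral>\<^sup>+y. G x * G y * E (x - y) \<partial>lborel \<partial>lborel"
  let ?E = "\<integral>\<^sup>+x. E x \<partial>lborel"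
  have transl: "(\<integral>\<^sup>+y. E (x - y) \<partial>lborel) = ?E" for x
    using nn_integral_lborel_translate[of E "- x"] even[of "x - y" for y] by simp
  have transl': "(\<integral>\<^sup>+x. E (x - y) \<partial>lborel) = ?E" for y
    using nn_integral_lborel_translate[of E "- y"] by simp
  have "2 * ?I = (\<integral>\<^sup>+x. \<integral>\<^sup>+y. (2 * G x * G y) * E (x - y) \<partial>lborel \<partial>lborel)"
    by (simp add: nn_integral_cmult[symmetric] mult.assoc)
  also have "\<dots> \<le> (\<integral>\<^sup>+x. \<integral>\<^sup>+y. (G x)\<^sup>2 * E (x - y) + (G y)\<^sup>2 * E (x - y) \<partial>lborel \<partial>lborel)"
    by (intro nn_integral_mono) (simp add: distrib_right[symmetric] mult_right_mono sum_of_squares_ge_ennreal)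
  also have "\<dots> = (\<integral>\<^sup>+x. \<integral>\<^sup>+y. (G x)\<^sup>2 * E (x - y) \<partial>lborel \<partial>lborel)
      + (\<integral>\<^sup>+x. \<integral>\<^sup>+y. (G y)\<^sup>2 * E (x - y) \<partial>lborel \<partial>lborel)"
    by (simp add: nn_integral_add)
  also have "(\<integral>\<^sup>+x. \<integral>\<^sup>+y. (G y)\<^sup>2 * E (x - y) \<partial>lborel \<partial>lborel)
      = (\<integral>\<^sup>+y. \<integral>\<^sup>+x. (G y)\<^sup>2 * E (x - y) \<partial>lborel \<partial>lborel)"
    by (rule lborel_pair.Fubini') measurable
  also have "\<dots> = ?E * (\<integral>\<^sup>+x. (G x)\<^sup>2 \<partial>lborel)"
    by (simp add: nn_integral_cmult transl' nn_integral_multc mult.commute)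
  also have "(\<integral>\<^sup>+x. \<integral>\<^sup>+y. (G x)\<^sup>2 * E (x - y) \<partial>lborel \<partial>lborel) = ?E * (\<integral>\<^sup>+x. (G x)\<^sup>2 \<partial>lborel)"
    by (simp add: nn_integral_cmult transl nn_integral_multc mult.commute)
  finally have "2 * ?I \<le> 2 * (?E * (\<integral>\<^sup>+x. (G x)\<^sup>2 \<partial>lborel))" by (simp add: mult_2)
  then show ?thesis by (subst (asm) ennreal_mult_le_mult_iff) auto
qed

lemma norm_diff_sq_cdot:
  "(norm (z - w))\<^sup>2 = (norm z)\<^sup>2 + (norm w)\<^sup>2 - 2 * Re (cdot w (cnj_vec z))"
proof -
  have "complex_of_real ((norm (z - w))\<^sup>2) = cdot (z - w) (cnj_vec z - cnj_vec w)"
    unfolding cdot_self_cnj_vec[symmetric] by (simp add: cnj_vec_def vector_minus_component vec_eq_iff cdot_def)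
  also have "\<dots> = complex_of_real ((norm z)\<^sup>2) + complex_of_real ((norm w)\<^sup>2)
      - (cdot w (cnj_vec z) + cnj (cdot w (cnj_vec z)))"
    unfolding cdot_diff_left cdot_diff_right cdot_self_cnj_vec
    using cdot_cnj_vec[of w "cnj_vec z"] by (simp add: cdot_commute[of "cnj_vec w"])
  also have "\<dots> = complex_of_real ((norm z)\<^sup>2 + (norm w)\<^sup>2 - 2 * Re (cdot w (cnj_vec z)))"
    by (simp only: complex_add_cnj of_real_add of_real_diff)
  finally show ?thesis by (simp only: of_real_eq_iff)
qed

text \<open>The bound of the Schur test for the kernel of \<open>B B\<^sup>*\<close>, whose modulus with symmetrically
  distributed weight is \<open>e\<^bsup>-|z - w|\<^sup>2/4\<^esup>\<close>, up to \<open>gaussian_mass\<close>.\<close>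

definition schur_constant :: "'n::finite itself \<Rightarrow> real" where
  "schur_constant _ = gaussian_mass TYPE('n) * (LINT z|lebesgue. exp (- (1/4) * (norm (z :: complex^'n))\<^sup>2))"

text \<open>Boundedness of the adjoint is read off from \<open>\<parallel>B\<^sup>* g\<parallel>\<^sup>2 = \<langle>B B\<^sup>* g, g\<rangle>\<close>. By the adjoint
  relation, \<open>B B\<^sup>*\<close> is the integral operator whose kernel is the transform of the coherent states,
  and \<open>e\<^bsup>Re (w \<cdot> cnj z)/2\<^esup> e\<^bsup>-|z|\<^sup>2/4\<^esup> e\<^bsup>-|w|\<^sup>2/4\<^esup> = e\<^bsup>-|z - w|\<^sup>2/4\<^esup>\<close> is a convolution kernel. The bound
  does not depend on the support of \<open>g\<close>.\<close>

lemma bargmann_adjoint_sqnorm_le: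
  fixes g :: "complex^'n \<Rightarrow> complex"
  assumes g[measurable]: "g \<in> borel_measurable borel"
    and g_L2: "g \<in> L2 fock"
    and g_le: "\<And>z. norm (g z) \<le> B * indicator (cball 0 R) z"
  defines "v \<equiv> \<lambda>y. LINT z|fock. coherent_state z y * g z"
  shows "L2_sqnorm lebesgue v \<le> schur_constant TYPE('n) * L2_sqnorm fock g"
proof -
  let ?\<gamma> = "\<lambda>z::complex^'n. ennreal (exp (- ((norm z)\<^sup>2 / 2)))"
  have g': "g \<in> borel_measurable lebesgue" using g by (intro measurable_completion) simp
  have [measurable]: "(\<lambda>z::complex^'n. exp (a * (norm z)\<^sup>2)) \<in> borel_measurable borel" for a
    by (intro borel_measurable_continuous_onI continuous_intros)
  define c where "c = gaussian_mass TYPE('n)"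
  have c: "0 < c" by (simp add: c_def gaussian_mass_pos)
  define k where "k z w = c * exp (Re (cdot w (cnj_vec z)) / 2)" for z w :: "complex^'n"
  let ?J = "\<lambda>z. \<integral>\<^sup>+w. ?\<gamma> w * ennreal (k z w * norm (g w)) \<partial>lborel"
  define G where "G z = ennreal (exp (- (1/4) * (norm z)\<^sup>2) * norm (g z))" for z
  define E where "E z = ennreal (exp (- (1/4) * (norm z)\<^sup>2))" for z :: "complex^'n"
  have [measurable]: "G \<in> borel_measurable borel" "E \<in> borel_measurable borel"
    unfolding G_def[abs_def] E_def[abs_def] by measurable
  have v: "v \<in> L2 lebesgue"
    unfolding v_def by (rule bargmann_adjoint_L2[OF g' g_le])
  \<comment> \<open>The adjoint relation is used for \<open>v\<close> itself and, to evaluate \<open>B v\<close>, for the coherent states.\<close>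
  note adj = bargmann_adjoint[OF g' g_le, folded v_def]
  have k_meas: "k z \<in> borel_measurable borel" for z
    unfolding k_def by (intro borel_measurable_continuous_onI continuous_intros) auto
  have Bv: "ennreal (norm (bargmann v z)) \<le> (\<integral>\<^sup>+w. ennreal (k z w * norm (g w)) \<partial>fock)" for z
  proof -
    have "norm (bargmann v z) = norm (L2_inner lebesgue (coherent_state z) v)"
      unfolding bargmann_eq_inner by (subst L2_inner_commute) simp
    also have "\<dots> = norm (LINT w|fock. bargmann (coherent_state z) w * cnj (g w))"
      unfolding adj[OF coherent_state_L2, symmetric] by (simp add: L2_inner_def)
    finally show ?thesis
      using norm_integral_le_nn_integral[of fock "\<lambda>w. bargmann (coherent_state z) w * cnj (g w)"] c
      by (simp add: bargmann_coherent_state norm_mult norm_exp_eq_Re k_def c_def)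
  qed
  have "ennreal (L2_sqnorm lebesgue v) = ennreal (norm (L2_inner lebesgue v v))"
    unfolding L2_inner_self by (simp add: L2_sqnorm_nonneg)
  also have "\<dots> = ennreal (norm (LINT z|fock. bargmann v z * cnj (g z)))"
    unfolding adj[OF v, symmetric] by (simp add: L2_inner_def)
  also have "\<dots> \<le> (\<integral>\<^sup>+z. ennreal (norm (bargmann v z)) * ennreal (norm (g z)) \<partial>fock)"
    using norm_integral_le_nn_integral[of fock "\<lambda>z. bargmann v z * cnj (g z)"]
    by (simp add: norm_mult ennreal_mult)
  also have "\<dots> \<le> (\<integral>\<^sup>+z. (\<integral>\<^sup>+w. ennreal (k z w * norm (g w)) \<partial>fock) * ennreal (norm (g z)) \<partial>fock)"
    by (intro nn_integral_mono mult_right_mono Bv) simp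
  also have "\<dots> = (\<integral>\<^sup>+z. ?J z * ennreal (norm (g z)) \<partial>fock)"
  proof -
    have "(\<integral>\<^sup>+w. ennreal (k z w * norm (g w)) \<partial>fock)
        = ?J z" for z
      using k_meas[of z] g by (intro nn_integral_fock measurable_completion) simp_all
    then show ?thesis by simp
  qed
  also have "\<dots> = (\<integral>\<^sup>+z. ?\<gamma> z *
      (?J z * ennreal (norm (g z))) \<partial>lborel)"
  proof (intro nn_integral_fock measurable_completion)
    have "(\<lambda>p. k (fst p) (snd p)) \<in> borel_measurable borel"
      unfolding k_def by (intro borel_measurable_continuous_onI continuous_intros) auto
    then have [measurable]: "(\<lambda>(z, w). k z w) \<in> borel_measurable (borel \<Otimes>\<^sub>M borel)"
      by (simp add: borel_prod case_prod_unfold)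
    have [measurable]: "(\<lambda>z::complex^'n. exp (- ((norm z)\<^sup>2 / 2))) \<in> borel_measurable borel"
      by (intro borel_measurable_continuous_onI continuous_intros) auto
    show "(\<lambda>z. ?J z * ennreal (norm (g z)))
        \<in> borel_measurable lborel"
      by measurable
  qed
  also have "\<dots> = (\<integral>\<^sup>+z. \<integral>\<^sup>+w. ennreal c * (G z * G w * E (z - w)) \<partial>lborel \<partial>lborel)"
  proof (intro nn_integral_cong)
    fix z
    have eq: "exp (- ((norm z)\<^sup>2 / 2)) * norm (g z) * (exp (- ((norm w)\<^sup>2 / 2)) * (k z w * norm (g w)))
        = c * (exp (- (1/4) * (norm z)\<^sup>2) * norm (g z) * (exp (- (1/4) * (norm w)\<^sup>2) * norm (g w))
            * exp (- (1/4) * (norm (z - w))\<^sup>2))" for w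
    proof -
      have "exp (- ((norm z)\<^sup>2 / 2)) * exp (- ((norm w)\<^sup>2 / 2)) * exp (Re (cdot w (cnj_vec z)) / 2)
          = exp (- (1/4) * (norm z)\<^sup>2) * exp (- (1/4) * (norm w)\<^sup>2) * exp (- (1/4) * (norm (z - w))\<^sup>2)"
        unfolding norm_diff_sq_cdot exp_add[symmetric] by (simp add: field_simps)
      then show ?thesis by (simp add: k_def mult_ac)
    qed
    have "?\<gamma> z *
        (?J z * ennreal (norm (g z)))
      = ennreal (exp (- ((norm z)\<^sup>2 / 2)) * norm (g z)) * ?J z"
      by (simp add: ennreal_mult mult_ac)
    also have "\<dots> = (\<integral>\<^sup>+w. ennreal (exp (- ((norm z)\<^sup>2 / 2)) * norm (g z)) * (?\<gamma> w * ennreal (k z w * norm (g w))) \<partial>lborel)"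
    proof (rule nn_integral_cmult[symmetric])
      have [measurable]: "(\<lambda>z::complex^'n. exp (- ((norm z)\<^sup>2 / 2))) \<in> borel_measurable borel"
        by (intro borel_measurable_continuous_onI continuous_intros) auto
      note [measurable] = k_meas[of z]
      show "(\<lambda>w. ?\<gamma> w * ennreal (k z w * norm (g w))) \<in> borel_measurable lborel"
        by measurable
    qed
    also have "\<dots> = (\<integral>\<^sup>+w. ennreal c * (G z * G w * E (z - w)) \<partial>lborel)"
    proof (rule nn_integral_cong)
      fix w
      have "0 \<le> k z w" using c by (simp add: k_def)
      then show "ennreal (exp (- ((norm z)\<^sup>2 / 2)) * norm (g z)) * (?\<gamma> w * ennreal (k z w * norm (g w)))
          = ennreal c * (G z * G w * E (z - w))"
        unfolding G_def E_def using c eq[of w] by (simp add: ennreal_mult'[symmetric])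
    qed
    finally show "?\<gamma> z *
        (?J z * ennreal (norm (g z)))
      = (\<integral>\<^sup>+w. ennreal c * (G z * G w * E (z - w)) \<partial>lborel)" .
  qed
  also have "\<dots> = ennreal c * (\<integral>\<^sup>+z. \<integral>\<^sup>+w. G z * G w * E (z - w) \<partial>lborel \<partial>lborel)"
    by (simp add: nn_integral_cmult)
  also have "\<dots> \<le> ennreal c * ((\<integral>\<^sup>+z. E z \<partial>lborel) * (\<integral>\<^sup>+z. (G z)\<^sup>2 \<partial>lborel))"
    by (intro mult_left_mono nn_integral_Schur_convolution) (simp_all add: E_def)
  also have "(\<integral>\<^sup>+z. E z \<partial>lborel) = ennreal (LINT z|lebesgue. exp (- (1/4) * (norm (z :: complex^'n))\<^sup>2))"
    unfolding E_def using gaussian_integrable[of "1/4"]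
    by (subst nn_integral_completion[symmetric]) (intro nn_integral_eq_integral, auto)
  also have "(\<integral>\<^sup>+z. (G z)\<^sup>2 \<partial>lborel) = ennreal (L2_sqnorm fock g)"
  proof -
    have "ennreal (L2_sqnorm fock g) = (\<integral>\<^sup>+z. ennreal ((norm (g z))\<^sup>2) \<partial>fock)"
      unfolding L2_sqnorm_def by (rule nn_integral_eq_integral[symmetric, OF L2_integrable_sqnorm[OF g_L2]]) simp
    also have "\<dots> = (\<integral>\<^sup>+z. ?\<gamma> z * ennreal ((norm (g z))\<^sup>2) \<partial>lborel)"
      using g by (intro nn_integral_fock measurable_completion) simp
    also have "\<dots> = (\<integral>\<^sup>+z. (G z)\<^sup>2 \<partial>lborel)"
    proof (rule nn_integral_cong)
      fix z :: "complex^'n"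
      have "exp (- ((norm z)\<^sup>2 / 2)) = (exp (- (1/4) * (norm z)\<^sup>2))\<^sup>2"
        by (simp add: exp_double[symmetric])
      then show "?\<gamma> z * ennreal ((norm (g z))\<^sup>2) = (G z)\<^sup>2"
        unfolding G_def by (simp add: ennreal_power power_mult_distrib ennreal_mult)
    qed
    finally show ?thesis by simp
  qed
  also have "ennreal c * (ennreal (LINT z|lebesgue. exp (- (1/4) * (norm (z :: complex^'n))\<^sup>2)) * ennreal (L2_sqnorm fock g))
      = ennreal (schur_constant TYPE('n) * L2_sqnorm fock g)"
    using c unfolding schur_constant_def c_def[symmetric]
    by (simp add: ennreal_mult'[symmetric] L2_sqnorm_nonneg mult.assoc)
  finally show ?thesis
  proof (rule ennreal_le_iff[THEN iffD1, rotated])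
    have "0 \<le> schur_constant TYPE('n)"
      unfolding schur_constant_def by (intro mult_nonneg_nonneg integral_nonneg_AE less_imp_le[OF gaussian_mass_pos]) auto
    then show "0 \<le> schur_constant TYPE('n) * L2_sqnorm fock g"
      by (simp add: L2_sqnorm_nonneg)
  qed
qed

text \<open>Test \<open>B u\<close> against its own truncations \<open>g\<^sub>n\<close> to balls:
  \<open>\<parallel>g\<^sub>n\<parallel>\<^sup>2 = \<langle>B u, g\<^sub>n\<rangle> = \<langle>u, B\<^sup>* g\<^sub>n\<rangle> \<le> \<parallel>u\<parallel> sqrt K \<parallel>g\<^sub>n\<parallel>\<close>. The finite quantity \<open>\<parallel>g\<^sub>n\<parallel>\<close>
  can be divided out, and monotone convergence removes the truncation.\<close>

lemma
  fixes u :: "real^'n \<Rightarrow> complex"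
  assumes u: "u \<in> L2 lebesgue"
  shows bargmann_L2: "bargmann u \<in> L2 fock"
    and bargmann_sqnorm_le: "L2_sqnorm fock (bargmann u) \<le> schur_constant TYPE('n) * L2_sqnorm lebesgue u"
proof -
  interpret fock: finite_measure "fock :: (complex^'n) measure" by (rule finite_measure_fock)
  let ?K = "schur_constant TYPE('n)"
  have Bu[measurable]: "bargmann u \<in> borel_measurable borel" by (rule bargmann_measurable[OF u])
  have Bu': "bargmann u \<in> borel_measurable lebesgue" by (rule measurable_completion) simp
  define g where "g n z = indicator (cball 0 (real n)) z * bargmann u z" for n z
  have g_meas[measurable]: "g n \<in> borel_measurable borel" for n
    unfolding g_def[abs_def] by (intro borel_measurable_times borel_measurable_indicator borel_closed closed_cball Bu)
  have g_leb: "g n \<in> borel_measurable lebesgue" for n by (rule measurable_completion) simp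
  have "\<exists>B. \<forall>z. norm (g n z) \<le> B * indicator (cball 0 (real n)) z" for n
  proof -
    have "compact (bargmann u ` cball 0 (real n))"
      by (intro compact_continuous_image continuous_on_subset[OF Hol_continuous[OF bargmann_Hol[OF u]]]) auto
    then obtain B where "\<forall>z\<in>cball 0 (real n). norm (bargmann u z) \<le> B"
      by (auto dest!: compact_imp_bounded simp: bounded_iff)
    then show ?thesis by (intro exI[of _ B]) (auto simp: g_def indicator_def)
  qed
  then obtain B where g_le: "\<And>n z. norm (g n z) \<le> B n * indicator (cball 0 (real n)) z" by metis
  have g_L2: "g n \<in> L2 fock" for n
  proof -
    have "norm ((norm (g n z))\<^sup>2) \<le> (B n)\<^sup>2" for z
      using g_le[of n z] power_mono[OF g_le[of n z] norm_ge_zero, of 2]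
      by (cases "z \<in> cball 0 (real n)") auto
    then have "integrable fock (\<lambda>z. (norm (g n z))\<^sup>2)"
      using g_leb by (intro fock.integrable_const_bound[where B="(B n)\<^sup>2"]) auto
    then show ?thesis using g_leb by (simp add: L2_def)
  qed
  have bound: "L2_sqnorm fock (g n) \<le> ?K * L2_sqnorm lebesgue u" for n
  proof -
    define v where "v = (\<lambda>y. LINT z|fock. coherent_state z y * g n z)"
    let ?N = "L2_sqnorm fock (g n)"
    have "bargmann u z * cnj (g n z) = g n z * cnj (g n z)" for z
      by (simp add: g_def indicator_def)
    then have "complex_of_real ?N = L2_inner fock (bargmann u) (g n)"
      unfolding L2_inner_self[symmetric] L2_inner_def by (simp only:)
    also have "\<dots> = L2_inner lebesgue u v"
      using bargmann_adjoint[OF g_leb[of n] g_le[of n] u] unfolding v_def .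
    finally have N_eq: "complex_of_real ?N = L2_inner lebesgue u v" .
    have "?N\<^sup>2 = (norm (L2_inner lebesgue u v))\<^sup>2"
      unfolding N_eq[symmetric] by simp
    also have "\<dots> \<le> L2_sqnorm lebesgue u * L2_sqnorm lebesgue v"
      unfolding v_def by (rule L2_Cauchy_Schwarz[OF u bargmann_adjoint_L2[OF g_leb[of n] g_le[of n]]])
    also have "\<dots> \<le> L2_sqnorm lebesgue u * (?K * ?N)"
      unfolding v_def by (intro mult_left_mono bargmann_adjoint_sqnorm_le[OF g_meas[of n] g_L2[of n] g_le[of n]] L2_sqnorm_nonneg)
    finally have "?N * ?N \<le> (?K * L2_sqnorm lebesgue u) * ?N" by (simp add: power2_eq_square mult_ac)
    moreover have "0 \<le> ?K * L2_sqnorm lebesgue u"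
      unfolding schur_constant_def
      by (intro mult_nonneg_nonneg integral_nonneg_AE less_imp_le[OF gaussian_mass_pos] L2_sqnorm_nonneg) auto
    ultimately show ?thesis
      using L2_sqnorm_nonneg[of fock "g n"] by (cases "?N = 0") (auto simp: mult_le_cancel_right)
  qed
  have mono: "incseq (\<lambda>n. L2_sqnorm fock (g n))"
    unfolding L2_sqnorm_def
    by (intro incseq_SucI integral_mono L2_integrable_sqnorm g_L2) (auto simp: g_def indicator_def)
  obtain l where l: "(\<lambda>n. L2_sqnorm fock (g n)) \<longlonglongrightarrow> l" "\<forall>n. L2_sqnorm fock (g n) \<le> l"
    using incseq_convergent[OF mono, of "?K * L2_sqnorm lebesgue u"] bound by blast
  have i1: "integrable fock (\<lambda>z. (norm (g n z))\<^sup>2)" for n by (rule L2_integrable_sqnorm[OF g_L2])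
  have i2: "AE z in fock. mono (\<lambda>n. (norm (g n z))\<^sup>2)"
    by (auto simp: g_def indicator_def mono_def)
  have i3: "AE z in fock. (\<lambda>n. (norm (g n z))\<^sup>2) \<longlonglongrightarrow> (norm (bargmann u z))\<^sup>2"
  proof (rule AE_I2)
    fix z :: "complex^'n"
    obtain N where "norm z \<le> real N" using real_arch_simple by blast
    then have "\<forall>n\<ge>N. (norm (g n z))\<^sup>2 = (norm (bargmann u z))\<^sup>2"
      by (auto simp: g_def indicator_def dest: order_trans)
    then show "(\<lambda>n. (norm (g n z))\<^sup>2) \<longlonglongrightarrow> (norm (bargmann u z))\<^sup>2"
      by (intro tendsto_eventually) (auto simp: eventually_sequentially)
  qed
  have i4: "(\<lambda>n. LINT z|fock. (norm (g n z))\<^sup>2) \<longlonglongrightarrow> l" using l(1) by (simp add: L2_sqnorm_def)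
  have i5: "(\<lambda>z. (norm (bargmann u z))\<^sup>2) \<in> borel_measurable fock" using Bu' by simp
  have i0: "AE z in fock. 0 \<le> (norm (g n z))\<^sup>2" for n by simp
  note monotone_limit = integral_monotone_convergence_nonneg[OF i1 i2 i0 i3 i4 i5]
  have "integrable fock (\<lambda>z. (norm (bargmann u z))\<^sup>2)" "L2_sqnorm fock (bargmann u) = l"
    using monotone_limit by (auto simp: L2_sqnorm_def)
  moreover have "l \<le> ?K * L2_sqnorm lebesgue u"
    using LIMSEQ_le_const2[OF l(1)] bound by blast
  ultimately show "bargmann u \<in> L2 fock" "L2_sqnorm fock (bargmann u) \<le> ?K * L2_sqnorm lebesgue u"
    using Bu' by (simp_all add: L2_def)
qed

section \<open>The reproducing property\<close>

text \<open>Cauchy's integral formula on the unit circle.\<close>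

lemma circle_mean_value:
  assumes "g holomorphic_on UNIV"
  shows "(LINT t|lebesgue_on {0..1}. g (exp (2 * of_real pi * \<i> * of_real t))) = g 0"
proof -
  let ?e = "\<lambda>t::real. exp (2 * of_real pi * \<i> * of_real t)"
  have "((\<lambda>u. g u / (u - 0)) has_contour_integral (2 * of_real pi * \<i> * g 0)) (circlepath 0 1)"
    using assms by (intro Cauchy_integral_circlepath_simple) (auto intro: holomorphic_on_subset)
  then have "((\<lambda>t. g (circlepath 0 1 t) / (circlepath 0 1 t - 0) * vector_derivative (circlepath 0 1) (at t within {0..1}))
      has_integral (2 * of_real pi * \<i> * g 0)) {0..1}"
    by (simp add: has_contour_integral_def)
  then have "((\<lambda>t. 2 * of_real pi * \<i> * g (?e t)) has_integral (2 * of_real pi * \<i> * g 0)) {0..1}"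
    by (rule has_integral_eq[rotated]) (simp add: vector_derivative_circlepath01, simp add: circlepath)
  then have "((\<lambda>t. inverse (2 * of_real pi * \<i>) * (2 * of_real pi * \<i> * g (?e t)))
      has_integral inverse (2 * of_real pi * \<i>) * (2 * of_real pi * \<i> * g 0)) {0..1}"
    by (rule has_integral_mult_right)
  moreover have "inverse (2 * of_real pi * \<i>) * (2 * of_real pi * \<i> * x) = x" for x :: complex
    using pi_neq_zero by (simp add: field_simps)
  ultimately have "((\<lambda>t. g (?e t)) has_integral g 0) {0..1}"
    by (simp only:)
  then have int: "integral {0..1} (\<lambda>t. g (?e t)) = g 0" by (rule integral_unique)
  have cont: "continuous_on {0..1} (\<lambda>t. g (?e t))"
    using holomorphic_on_imp_continuous_on[OF assms]
    by (rule continuous_on_compose2[of UNIV g]) (intro continuous_intros, simp)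
  show ?thesis
    unfolding int[symmetric]
    using continuous_imp_integrable[of 0 1 "\<lambda>t. g (?e t)"] cont
    by (intro lebesgue_integral_eq_integral) simp_all
qed

definition fock_mass :: "'n::finite itself \<Rightarrow> real" where
  "fock_mass _ = (LINT z|lebesgue. exp (- ((norm (z :: complex^'n))\<^sup>2 / 2)))"

lemma fock_mass_pos: "0 < fock_mass TYPE('n::finite)"
  unfolding fock_mass_def using gaussian_integrable[of "1/2"]
  by (intro integral_pos_of_pos_continuous) simp_all

lemma integral_fock_const: "(LINT z|(fock :: (complex^'n) measure). c) = of_real (fock_mass TYPE('n)) * (c :: complex)"
  unfolding fock_mass_def
  by (subst integral_fock) (simp_all only: integral_mult_left_zero integral_complex_of_real borel_measurable_const)

lemma norm_unimodular_scale: "norm c = 1 \<Longrightarrow> norm (c *s z) = norm (z :: complex^'n)"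
  by (simp add: norm_vec_def norm_mult)

lemma linear_vector_scale: "linear (\<lambda>z :: complex^'n. c *s z)"
  by (rule linearI) (simp_all add: vec_eq_iff algebra_simps)

text \<open>Multiplication by a unimodular scalar multiplies Lebesgue measure by some constant \<open>k\<close> and
  preserves the Gaussian; comparing total masses shows \<open>k = 1\<close>.\<close>

lemma
  fixes F :: "complex^'n \<Rightarrow> complex"
  assumes c: "norm c = 1" and F[measurable]: "F \<in> borel_measurable borel"
  shows integral_fock_rotate: "(LINT z|fock. F (c *s z)) = (LINT z|fock. F z)"
    and integrable_fock_rotate: "integrable fock F \<Longrightarrow> integrable fock (\<lambda>z. F (c *s z))"
proof -
  let ?L = "\<lambda>z :: complex^'n. c *s z"
  let ?w = "\<lambda>z :: complex^'n. exp (- ((norm z)\<^sup>2 / 2))"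
  have "c \<noteq> 0" using c by auto
  then have bij: "bij ?L"
    by (intro o_bij[of "\<lambda>z. inverse c *s z"]) (auto simp: fun_eq_iff vec_eq_iff)
  have [measurable]: "?L \<in> borel_measurable borel"
    by (intro borel_measurable_continuous_onI continuous_intros)
  have w_meas[measurable]: "?w \<in> borel_measurable borel"
    by (intro borel_measurable_continuous_onI continuous_intros) auto
  obtain k where k: "k > 0"
    and sub: "\<And>g :: complex^'n \<Rightarrow> complex. g \<in> borel_measurable lebesgue \<Longrightarrow>
        (LINT x|lebesgue. g (?L x)) = complex_of_real k * (LINT y|lebesgue. g y)"
    by (rule lebesgue_linear_change_of_variables[OF linear_vector_scale bij]) blast
  have leb: "f \<in> borel_measurable lebesgue" if "f \<in> borel_measurable borel" for f :: "complex^'n \<Rightarrow> 'x::topological_space"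
    using that by (intro measurable_completion) simp
  have rot: "(LINT z|fock. f (c *s z)) = complex_of_real k * (LINT z|fock. f z)"
    if [measurable]: "f \<in> borel_measurable borel" for f :: "complex^'n \<Rightarrow> complex"
  proof -
    have "(LINT z|fock. f (c *s z)) = (LINT z|lebesgue. of_real (?w (c *s z)) * f (c *s z))"
      by (subst integral_fock) (simp_all add: leb norm_unimodular_scale c)
    also have "\<dots> = complex_of_real k * (LINT z|lebesgue. of_real (?w z) * f z)"
      by (rule sub) (intro leb, measurable)
    finally show ?thesis by (subst integral_fock) (simp_all add: leb)
  qed
  have "k = 1"
    using rot[of "\<lambda>z. 1"] fock_mass_pos[where 'n='n] unfolding integral_fock_const by simp
  then show "(LINT z|fock. F (c *s z)) = (LINT z|fock. F z)" using rot[OF F] by simp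
  assume int: "integrable fock F"
  have fock_int: "integrable fock f \<longleftrightarrow> integrable lebesgue (\<lambda>z. ?w z * norm (f z))"
    if [measurable]: "f \<in> borel_measurable borel" for f :: "complex^'n \<Rightarrow> complex"
  proof -
    have "integrable fock f \<longleftrightarrow> integrable lebesgue (\<lambda>z. ?w z *\<^sub>R f z)"
      unfolding fock_eq by (rule integrable_density) (auto intro!: leb)
    also have "\<dots> \<longleftrightarrow> integrable lebesgue (\<lambda>z. norm (?w z *\<^sub>R f z))"
      by (intro integrable_norm_iff[symmetric] leb) measurable
    finally show ?thesis by simp
  qed
  have "integrable lebesgue (\<lambda>z. ?w (c *s z) * norm (F (c *s z)))"
    using int fock_int[OF F] lebesgue_integrable_linear_iff[OF linear_vector_scale bij, of "\<lambda>z. ?w z * norm (F z)"] by (simp add: leb)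
  then show "integrable fock (\<lambda>z. F (c *s z))"
    by (subst fock_int) (simp_all add: norm_unimodular_scale c)
qed

text \<open>Average over the rotations \<open>z \<mapsto> e\<^bsup>2\<pi>\<i>t\<^esup> z\<close>, which preserve the measure. On each complex line
  through \<open>0\<close> the average of \<open>F\<close> is \<open>F 0\<close> by the mean value property in one variable.\<close>

lemma fock_mean_value:
  fixes F :: "complex^'n \<Rightarrow> complex"
  assumes F: "F \<in> Hol" and int: "integrable fock F"
  shows "(LINT z|fock. F z) = of_real (fock_mass TYPE('n)) * F 0"
proof -
  let ?e = "\<lambda>t::real. exp (2 * of_real pi * \<i> * of_real t) :: complex"
  let ?I = "lebesgue_on {0..1::real}"
  have ne: "norm (?e t) = 1" for t by (simp add: norm_exp_eq_Re)
  have contF: "continuous_on UNIV F" by (rule Hol_continuous[OF F])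
  have F_meas: "F \<in> borel_measurable borel" by (rule borel_measurable_continuous_onI[OF contF])
  interpret fock: finite_measure "fock :: (complex^'n) measure" by (rule finite_measure_fock)
  interpret I: finite_measure ?I by (rule finite_measure_lebesgue_on) simp
  interpret pair: pair_sigma_finite ?I "fock :: (complex^'n) measure" ..
  have meas: "(\<lambda>(t, z). F (?e t *s z)) \<in> borel_measurable (?I \<Otimes>\<^sub>M fock)"
  proof (rule borel_measurable_pair_of_id)
    show "(\<lambda>x. x) \<in> ?I \<rightarrow>\<^sub>M borel"
      by (intro measurable_restrict_space1 measurable_completion) simp
    have "(\<lambda>x. x) \<in> (lebesgue :: (complex^'n) measure) \<rightarrow>\<^sub>M borel"
      by (intro measurable_completion) simp
    then show "(\<lambda>x. x) \<in> (fock :: (complex^'n) measure) \<rightarrow>\<^sub>M borel" by simp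
    show "(\<lambda>p. F (?e (fst p) *s snd p)) \<in> borel_measurable borel"
      by (intro borel_measurable_continuous_onI continuous_on_compose2[OF contF] continuous_intros) auto
  qed
  have abs_const: "(LINT z|fock. norm (F (?e t *s z))) = (LINT z|fock. norm (F z))" for t
  proof -
    have "(LINT z|fock. complex_of_real (norm (F (?e t *s z)))) = (LINT z|fock. complex_of_real (norm (F z)))"
      by (rule integral_fock_rotate[OF ne]) (use F_meas in measurable)
    then show ?thesis unfolding integral_complex_of_real of_real_eq_iff .
  qed
  have "integrable (?I \<Otimes>\<^sub>M fock) (\<lambda>(t, z). F (?e t *s z))"
  proof (rule pair.Fubini_integrable[OF meas])
    show "integrable ?I (\<lambda>t. LINT z|fock. norm (case (t, z) of (t, z) \<Rightarrow> F (?e t *s z)))"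
      by (simp add: abs_const)
    show "AE t in ?I. integrable fock (\<lambda>z. case (t, z) of (t, z) \<Rightarrow> F (?e t *s z))"
      using integrable_fock_rotate[OF ne F_meas int] by simp
  qed
  then have "(LINT z|fock. LINT t|?I. F (?e t *s z)) = (LINT t|?I. LINT z|fock. F (?e t *s z))"
    by (rule pair.Fubini_integral)
  also have "\<dots> = (LINT t|?I. LINT z|fock. F z)"
    by (simp only: integral_fock_rotate[OF ne F_meas])
  also have "\<dots> = (LINT z|fock. F z)"
    by (simp add: measure_restrict_space)
  also have "(LINT z|fock. LINT t|?I. F (?e t *s z)) = (LINT z|(fock :: (complex^'n) measure). F 0)"
  proof (rule Bochner_Integration.integral_cong[OF refl])
    fix z
    show "(LINT t|?I. F (?e t *s z)) = F 0"
      using circle_mean_value[OF Hol_along_line[OF F, of 0 z]] by simp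
  qed
  also have "\<dots> = of_real (fock_mass TYPE('n)) * F 0" by (rule integral_fock_const)
  finally show ?thesis by simp
qed

lemma norm_add_sq_cdot:
  "(norm (z + w))\<^sup>2 = (norm z)\<^sup>2 + (norm w)\<^sup>2 + 2 * Re (cdot z (cnj_vec w))"
  using norm_diff_sq_cdot[of "- w" z]
  by (simp add: cdot_def cnj_vec_def sum_negf norm_minus_commute add.commute)

text \<open>The case \<open>w = 0\<close> is the mean value property. The general case follows by applying it to
  \<open>G z = F (z + w) e\<^bsup>-z \<cdot> cnj w / 2\<^esup>\<close>: this combination of a translation with a multiplication by an entire
  function is, up to a scalar, a unitary operator of the Fock space.\<close>

lemma fock_reproducing:
  fixes F :: "complex^'n \<Rightarrow> complex"
  assumes F: "F \<in> Hol" and L2: "F \<in> L2 fock"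
  shows "L2_inner fock F (\<lambda>z. exp (cdot z (cnj_vec w) / 2)) = of_real (fock_mass TYPE('n)) * F w"
proof -
  interpret fock: finite_measure "fock :: (complex^'n) measure" by (rule finite_measure_fock)
  let ?w = "\<lambda>z :: complex^'n. exp (- ((norm z)\<^sup>2 / 2))"
  have [measurable]: "F \<in> borel_measurable borel" by (intro borel_measurable_continuous_onI Hol_continuous F)
  have w_meas[measurable]: "?w \<in> borel_measurable borel"
    by (intro borel_measurable_continuous_onI continuous_intros) auto
  have leb: "f \<in> borel_measurable lebesgue" if "f \<in> borel_measurable borel" for f :: "complex^'n \<Rightarrow> 'x::topological_space"
    using that by (intro measurable_completion) simp
  define G where "G z = F (z + w) * exp (cdot z (cnj_vec w) * (- 1 / 2))" for z
  have G_Hol: "G \<in> Hol"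
    unfolding G_def
    by (intro Hol_mult Hol_exp Hol_cdot Hol_nth Hol_const Hol_compose_affine[OF F, where L="\<lambda>z. z"])
       (auto intro: linearI)
  have G_meas[measurable]: "G \<in> borel_measurable borel" by (intro borel_measurable_continuous_onI Hol_continuous G_Hol)
  \<comment> \<open>Up to a constant, the weighted modulus of \<open>G\<close> is that of \<open>F\<close> translated by \<open>w\<close>.\<close>
  have sq: "?w z * (norm (G z))\<^sup>2 = exp ((norm w)\<^sup>2 / 2) * (?w (w + z) * (norm (F (w + z)))\<^sup>2)" for z
  proof -
    have "?w z * (exp (Re (cdot z (cnj_vec w)) * (- 1 / 2)))\<^sup>2 = exp ((norm w)\<^sup>2 / 2) * ?w (z + w)"
      unfolding norm_add_sq_cdot by (simp add: exp_double[symmetric] exp_add[symmetric] field_simps)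
    then show ?thesis
      by (simp add: G_def norm_mult norm_exp_eq_Re power_mult_distrib add.commute[of w] mult_ac)
  qed
  have "integrable lebesgue (\<lambda>z. ?w (w + z) * (norm (F (w + z)))\<^sup>2)"
    using L2 lebesgue_integrable_translate[of "\<lambda>z. ?w z * (norm (F z))\<^sup>2" w]
    by (simp add: fock_L2_iff leb)
  then have "G \<in> L2 fock"
    by (simp add: fock_L2_iff leb sq)
  then have "integrable fock (\<lambda>z. norm ((G z)\<^sup>2))"
    unfolding norm_power by (rule L2_integrable_sqnorm)
  then have "integrable fock (\<lambda>z. (G z)\<^sup>2)"
    using leb[OF G_meas] by (subst (asm) integrable_norm_iff) auto
  then have "integrable fock G"
    by (rule fock.square_integrable_imp_integrable[rotated]) (use leb[OF G_meas] in simp)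
  note mean = fock_mean_value[OF G_Hol this]
  have "of_real (fock_mass TYPE('n)) * F w = (LINT z|fock. G z)"
    unfolding mean by (simp add: G_def)
  also have "\<dots> = (LINT z|lebesgue. of_real (?w z) * G z)"
    by (rule integral_fock[OF leb[OF G_meas]])
  also have "\<dots> = (LINT z|lebesgue. of_real (?w (- w + z)) * G (- w + z))"
    by (rule lebesgue_integral_translate[symmetric]) measurable
  also have "\<dots> = (LINT z|lebesgue. of_real (?w z) * (F z * cnj (exp (cdot z (cnj_vec w) / 2))))"
  proof (rule Bochner_Integration.integral_cong[OF refl])
    fix z
    let ?c = "cdot z (cnj_vec w)"
    have "norm (- w + z) = norm (z - w)" by simp
    then have n: "(norm (- w + z))\<^sup>2 = (norm z)\<^sup>2 + (norm w)\<^sup>2 - 2 * Re ?c"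
      using norm_diff_sq_cdot[of w z] by (simp add: norm_minus_commute)
    have "complex_of_real (2 * Re ?c) = ?c + cnj ?c" by (simp only: complex_add_cnj)
    then have "complex_of_real (- ((norm (- w + z))\<^sup>2 / 2)) + cdot (- w + z) (cnj_vec w) * (- 1 / 2)
        = complex_of_real (- ((norm z)\<^sup>2 / 2)) + cnj (?c / 2)"
      unfolding n cdot_add_left
      using cdot_self_cnj_vec[of w]
      by (simp add: cdot_def sum_negf field_simps)
    then have "of_real (?w (- w + z)) * exp (cdot (- w + z) (cnj_vec w) * (- 1 / 2))
        = of_real (?w z) * cnj (exp (?c / 2))"
      unfolding exp_cnj exp_of_real[symmetric] exp_add[symmetric] by (simp only:)
    then show "of_real (?w (- w + z)) * G (- w + z) = of_real (?w z) * (F z * cnj (exp (?c / 2)))"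
      by (simp add: G_def mult_ac)
  qed
  also have "\<dots> = (LINT z|fock. F z * cnj (exp (cdot z (cnj_vec w) / 2)))"
  proof (rule integral_fock[symmetric], rule leb)
    have [measurable]: "(\<lambda>z. exp (cdot z (cnj_vec w) / 2)) \<in> borel_measurable borel"
      by (intro borel_measurable_continuous_onI continuous_intros) auto
    show "(\<lambda>z. F z * cnj (exp (cdot z (cnj_vec w) / 2))) \<in> borel_measurable borel" by measurable
  qed
  finally show ?thesis by (simp add: L2_inner_def)
qed

section \<open>Injectivity, isometry and surjectivity of the Bargmann transform\<close>

text \<open>A Lebesgue measurable function is almost everywhere a limit of continuous functions. Applied
  to the conjugate phase of \<open>w\<close>, with the approximants cut off to modulus at most one, dominated
  convergence gives \<open>\<integral> |w| = 0\<close>.\<close>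

lemma AE_eq_0_of_continuous_tests:
  fixes w :: "'a::euclidean_space \<Rightarrow> complex"
  assumes w: "integrable lebesgue w"
    and test: "\<And>h. continuous_on UNIV h \<Longrightarrow> (\<And>x. norm (h x) \<le> 1) \<Longrightarrow> (LINT x|lebesgue. w x * h x) = 0"
  shows "AE x in lebesgue. w x = 0"
proof -
  have w_meas[measurable]: "w \<in> borel_measurable lebesgue" using w by auto
  have sgn_meas: "(\<lambda>x. cnj (sgn (w x))) \<in> borel_measurable lebesgue"
    unfolding sgn_div_norm by measurable
  then have "(\<lambda>x. cnj (sgn (w x))) measurable_on UNIV"
    by (intro lebesgue_measurable_imp_measurable_on) auto
  then obtain N h where N: "negligible N" and h_cont: "\<And>n. continuous_on UNIV (h n)"
    and h_lim: "\<And>x. x \<notin> N \<Longrightarrow> (\<lambda>n. h n x) \<longlonglongrightarrow> cnj (sgn (w x))"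
    unfolding measurable_on_def by auto
  \<comment> \<open>Division by \<open>max 1 |h|\<close> keeps continuity and does not change limits of modulus at most one.\<close>
  define g where "g n x = h n x / of_real (max 1 (norm (h n x)))" for n x
  have g_cont: "continuous_on UNIV (g n)" for n
    unfolding g_def by (intro continuous_intros h_cont) auto
  have g_le: "norm (g n x) \<le> 1" for n x
    by (simp add: g_def norm_divide divide_le_eq)
  have g_lim: "(\<lambda>n. w x * g n x) \<longlonglongrightarrow> of_real (norm (w x))" if "x \<notin> N" for x
  proof -
    have "(\<lambda>n. w x * g n x) \<longlonglongrightarrow> w x * (cnj (sgn (w x)) / of_real (max 1 (norm (cnj (sgn (w x))))))"
      unfolding g_def by (intro tendsto_intros h_lim that) auto
    also have "w x * (cnj (sgn (w x)) / of_real (max 1 (norm (cnj (sgn (w x)))))) = of_real (norm (w x))"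
    proof (cases "w x = 0")
      case False
      have "w x * cnj (w x) = of_real (norm (w x)) * of_real (norm (w x))"
        by (simp add: complex_norm_square[symmetric] power2_eq_square)
      moreover have "norm (cnj (sgn (w x))) = 1" using False by (simp add: norm_sgn)
      ultimately show ?thesis
        using False by (simp add: sgn_div_norm scaleR_conv_of_real field_simps)
    qed simp
    finally show ?thesis .
  qed
  have N_AE: "AE x in lebesgue. x \<notin> N"
    using N by (simp add: negligible_iff_null_sets AE_not_in)
  have "(\<lambda>n. LINT x|lebesgue. w x * g n x) \<longlonglongrightarrow> (LINT x|lebesgue. complex_of_real (norm (w x)))"
  proof (rule integral_dominated_convergence)
    show "integrable lebesgue (\<lambda>x. norm (w x))" using w by (rule integrable_norm)
    show "AE x in lebesgue. (\<lambda>n. w x * g n x) \<longlonglongrightarrow> of_real (norm (w x))"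
      using N_AE by eventually_elim (rule g_lim)
    show "AE x in lebesgue. norm (w x * g n x) \<le> norm (w x)" for n
      using g_le[of n] by (simp add: norm_mult mult_left_le)
    show "(\<lambda>x. w x * g n x) \<in> borel_measurable lebesgue" for n
      using continuous_on_imp_borel_measurable_lebesgue[OF g_cont[of n]] by measurable
  qed measurable
  moreover have "(LINT x|lebesgue. w x * g n x) = 0" for n by (rule test[OF g_cont g_le])
  ultimately have "(LINT x|lebesgue. complex_of_real (norm (w x))) = 0"
    by (simp only: LIMSEQ_const_iff)
  then have "(LINT x|lebesgue. norm (w x)) = 0"
    by (simp only: integral_complex_of_real of_real_eq_0_iff)
  then have "AE x in lebesgue. norm (w x) = 0"
    using integral_nonneg_eq_0_iff_AE[OF integrable_norm[OF w]] by simp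
  then show ?thesis by eventually_elim simp
qed

text \<open>Superposing the characters with Gaussian weights shows that \<open>w\<close> is orthogonal to every
  translate of every Gaussian \<open>e\<^bsup>-r\<^sup>2|y|\<^sup>2\<^esup>\<close> (\<open>gauss\<close>), hence to all convolutions of an integrable
  continuous \<open>g\<close> with such Gaussians (\<open>smoothed\<close>). As \<open>r\<close> tends to infinity these approximate
  a multiple of \<open>g\<close> (\<open>test\<close>).\<close>

lemma Fourier_transform_injective:
  fixes w :: "real^'n \<Rightarrow> complex"
  assumes w: "integrable lebesgue w"
    and zero: "\<And>\<xi>. (LINT y|lebesgue. exp (\<i> * of_real (\<xi> \<bullet> y)) * w y) = 0"
  shows "AE y in lebesgue. w y = 0"
proof -
  have w_meas[measurable]: "w \<in> borel_measurable lebesgue" using w by auto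
  define c where "c = gaussian_mass TYPE('n)"
  have c: "c > 0" by (simp add: c_def gaussian_mass_pos)
  have gauss_int: "integrable lebesgue (\<lambda>y::real^'n. exp (- (norm y)\<^sup>2))"
    using gaussian_integrable[of 1] by simp
  have gauss: "(LINT y|lebesgue. w y * of_real (exp (- (r\<^sup>2 * (norm (y - a))\<^sup>2)))) = 0" for r :: real and a
  proof -
    let ?F = "\<lambda>\<xi> y. exp (\<i> * of_real (((2 * r) *\<^sub>R \<xi>) \<bullet> (y - a))) * of_real (exp (- (norm \<xi>)\<^sup>2)) * w y"
    have swap: "(LINT \<xi>|lebesgue. LINT y|lebesgue. ?F \<xi> y) = (LINT y|lebesgue. LINT \<xi>|lebesgue. ?F \<xi> y)"
    proof (rule integrals_swap_dominated[OF sigma_finite_lebesgue sigma_finite_lebesgue _ gauss_int integrable_norm[OF w]])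
      have [measurable]: "(\<lambda>(\<xi>, y). exp (\<i> * of_real (((2 * r) *\<^sub>R \<xi>) \<bullet> (y - a))) * of_real (exp (- (norm \<xi>)\<^sup>2)) :: complex)
          \<in> borel_measurable (lebesgue \<Otimes>\<^sub>M (lebesgue :: (real^'n) measure))"
        by (intro borel_measurable_pair_lebesgue borel_measurable_continuous_onI continuous_intros)
      show "(\<lambda>(\<xi>, y). ?F \<xi> y) \<in> borel_measurable (lebesgue \<Otimes>\<^sub>M lebesgue)" by measurable
      show "norm (?F \<xi> y) \<le> exp (- (norm \<xi>)\<^sup>2) * norm (w y)" for \<xi> y
        by (simp add: norm_mult)
    qed
    have in_y: "(LINT y|lebesgue. ?F \<xi> y) = 0" for \<xi>
    proof -
      let ?\<eta> = "(2 * r) *\<^sub>R \<xi>"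
      have "?F \<xi> y = (exp (- (\<i> * of_real (?\<eta> \<bullet> a))) * of_real (exp (- (norm \<xi>)\<^sup>2))) * (exp (\<i> * of_real (?\<eta> \<bullet> y)) * w y)" for y
      proof -
        have "exp (\<i> * of_real (?\<eta> \<bullet> (y - a))) = exp (- (\<i> * of_real (?\<eta> \<bullet> a))) * exp (\<i> * of_real (?\<eta> \<bullet> y))"
          by (simp add: inner_diff_right algebra_simps flip: exp_add)
        then show ?thesis by (simp only: mult_ac)
      qed
      then show ?thesis
        by (simp only: integral_mult_right_zero zero mult_zero_right)
    qed
    have in_xi: "(LINT \<xi>|lebesgue. ?F \<xi> y) = of_real c * (w y * of_real (exp (- (r\<^sup>2 * (norm (y - a))\<^sup>2))))" for y
    proof -
      let ?z = "(\<i> * of_real (2 * r)) *s of_real_vec (y - a)"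
      have "?F \<xi> y = (exp (cdot ?z (of_real_vec \<xi>)) * exp (- complex_of_real ((norm \<xi>)\<^sup>2))) * w y" for \<xi>
        by (simp add: cdot_scale_left cdot_of_real_vec inner_commute mult.assoc flip: exp_of_real)
      then have "(LINT \<xi>|lebesgue. ?F \<xi> y) = (of_real c * exp (cdot ?z ?z / 4)) * w y"
        by (simp only: integral_mult_left_zero gaussian_Laplace_transform c_def)
      also have "cdot ?z ?z / 4 = of_real (- (r\<^sup>2 * (norm (y - a))\<^sup>2))"
        unfolding power2_norm_eq_inner cdot_scale_left cdot_scale_right cdot_of_real_vec
        by (simp add: complex_eq_iff power2_eq_square)
      finally show ?thesis by (simp only: exp_of_real mult_ac)
    qed
    have "of_real c * (LINT y|lebesgue. w y * of_real (exp (- (r\<^sup>2 * (norm (y - a))\<^sup>2)))) = 0"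
      using swap by (simp only: in_y in_xi integral_mult_right_zero) simp
    then show ?thesis using c by simp
  qed
  have smoothed: "(LINT y|lebesgue. w y * (LINT t|lebesgue. g (y + (1 / r) *\<^sub>R t) * of_real (exp (- (norm t)\<^sup>2)))) = 0"
    if g: "continuous_on UNIV g" and g_int: "integrable lebesgue g" and r: "r > 0"
    for g :: "real^'n \<Rightarrow> complex" and r :: real
  proof -
    let ?e = "\<lambda>x::real^'n. complex_of_real (exp (- (r\<^sup>2 * (norm x)\<^sup>2)))"
    have g_meas[measurable]: "g \<in> borel_measurable borel" by (rule borel_measurable_continuous_onI[OF g])
    let ?L = "\<lambda>t::real^'n. (1 / r) *\<^sub>R t"
    have lin: "linear ?L" by (rule linear_scaleR)
    have bij: "bij ?L"
      using r by (intro o_bij[of "\<lambda>t. r *\<^sub>R t"]) (auto simp: fun_eq_iff)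
    obtain k where k: "k > 0" and sub: "\<And>f :: real^'n \<Rightarrow> complex. f \<in> borel_measurable lebesgue \<Longrightarrow>
        (LINT x|lebesgue. f (?L x)) = complex_of_real k * (LINT y|lebesgue. f y)"
      by (rule lebesgue_linear_change_of_variables[OF lin bij]) blast
    have inner: "(LINT t|lebesgue. g (y + ?L t) * of_real (exp (- (norm t)\<^sup>2)))
        = of_real k * (LINT a|lebesgue. g a * ?e (y - a))" for y
    proof -
      have "(LINT t|lebesgue. g (y + ?L t) * of_real (exp (- (norm t)\<^sup>2)))
          = (LINT t|lebesgue. g (y + ?L t) * ?e (?L t))"
        using r by (simp add: power_mult_distrib power_divide)
      also have "\<dots> = of_real k * (LINT x|lebesgue. g (y + x) * ?e x)"
        by (rule sub) (intro continuous_on_imp_borel_measurable_lebesgue continuous_on_compose2[OF g] continuous_intros, auto)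
      also have "(LINT x|lebesgue. g (y + x) * ?e x) = (LINT x|lebesgue. g (y + x) * ?e (y - (y + x)))"
        by simp
      also have "\<dots> = (LINT a|lebesgue. g a * ?e (y - a))"
        by (rule lebesgue_integral_translate[of "\<lambda>a. g a * ?e (y - a)"])
           (intro borel_measurable_continuous_onI g continuous_intros)
      finally show ?thesis .
    qed
    have "(LINT y|lebesgue. w y * (LINT t|lebesgue. g (y + ?L t) * of_real (exp (- (norm t)\<^sup>2))))
        = of_real k * (LINT y|lebesgue. LINT a|lebesgue. w y * (g a * ?e (y - a)))"
      unfolding inner
      by (simp only: mult.left_commute[of _ "complex_of_real k"] integral_mult_right_zero)
    also have "(LINT y|lebesgue. LINT a|lebesgue. w y * (g a * ?e (y - a)))
        = (LINT a|lebesgue. LINT y|lebesgue. w y * (g a * ?e (y - a)))"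
    proof (rule integrals_swap_dominated[OF sigma_finite_lebesgue sigma_finite_lebesgue _
          integrable_norm[OF w] integrable_norm[OF g_int]])
      have [measurable]: "(\<lambda>(y, a). g a * ?e (y - a)) \<in> borel_measurable (lebesgue \<Otimes>\<^sub>M lebesgue)"
        by (intro borel_measurable_pair_lebesgue borel_measurable_continuous_onI continuous_on_compose2[OF g] continuous_intros) auto
      show "(\<lambda>(y, a). w y * (g a * ?e (y - a))) \<in> borel_measurable (lebesgue \<Otimes>\<^sub>M lebesgue)" by measurable
      show "norm (w y * (g a * ?e (y - a))) \<le> norm (w y) * norm (g a)" for y a
        by (simp add: norm_mult mult_left_le mult_left_mono)
    qed
    also have "\<dots> = (LINT a|lebesgue. g a * (LINT y|lebesgue. w y * ?e (y - a)))"
    proof -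
      have "w y * (g a * ?e (y - a)) = g a * (w y * ?e (y - a))" for y a
        by (rule mult.left_commute)
      then show ?thesis by (simp only: integral_mult_right_zero)
    qed
    also have "\<dots> = 0" unfolding gauss by simp
    finally show ?thesis by simp
  qed
  have test: "(LINT y|lebesgue. w y * g y) = 0"
    if g: "continuous_on UNIV g" and g_int: "integrable lebesgue g" and g_le: "\<And>x. norm (g x) \<le> 1"
    for g :: "real^'n \<Rightarrow> complex"
  proof -
    let ?e = "\<lambda>t::real^'n. complex_of_real (exp (- (norm t)\<^sup>2))"
    let ?F = "\<lambda>n y t. g (y + (1 / real (Suc n)) *\<^sub>R t) * ?e t"
    let ?I = "\<lambda>n y. LINT t|lebesgue. ?F n y t"
    have e_meas[measurable]: "?e \<in> borel_measurable lebesgue"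
      by (intro continuous_on_imp_borel_measurable_lebesgue continuous_intros)
    have I_lim: "(\<lambda>n. ?I n y) \<longlonglongrightarrow> (LINT t|lebesgue. g y * ?e t)" for y
    proof (rule integral_dominated_convergence[OF _ _ gauss_int])
      show "AE t in lebesgue. (\<lambda>n. ?F n y t) \<longlonglongrightarrow> g y * ?e t"
      proof (intro AE_I2 tendsto_mult tendsto_const)
        fix t
        have "(\<lambda>n. y + (1 / real (Suc n)) *\<^sub>R t) \<longlonglongrightarrow> y + 0 *\<^sub>R t"
          using LIMSEQ_inverse_real_of_nat unfolding inverse_eq_divide by (intro tendsto_intros)
        then show "(\<lambda>n. g (y + (1 / real (Suc n)) *\<^sub>R t)) \<longlonglongrightarrow> g y"
          using g by (intro continuous_on_tendsto_compose[OF g]) auto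
      qed
      show "AE t in lebesgue. norm (?F n y t) \<le> exp (- (norm t)\<^sup>2)" for n
        using g_le by (simp add: norm_mult mult_left_le_one_le)
      show "(\<lambda>t. ?F n y t) \<in> borel_measurable lebesgue" for n
        by (intro continuous_on_imp_borel_measurable_lebesgue continuous_on_compose2[OF g] continuous_intros) auto
    qed measurable
    have mass: "(LINT t|lebesgue. g y * ?e t) = of_real c * g y" for y
      by (simp only: integral_mult_right_zero integral_complex_of_real c_def gaussian_mass_def mult.commute)
    have "(\<lambda>n. LINT y|lebesgue. w y * ?I n y) \<longlonglongrightarrow> (LINT y|lebesgue. w y * (of_real c * g y))"
    proof (rule integral_dominated_convergence)
      show "integrable lebesgue (\<lambda>y. norm (w y) * c)" using w by simp
      show "AE y in lebesgue. (\<lambda>n. w y * ?I n y) \<longlonglongrightarrow> w y * (of_real c * g y)"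
        using I_lim unfolding mass by (intro AE_I2 tendsto_mult tendsto_const)
      show "AE y in lebesgue. norm (w y * ?I n y) \<le> norm (w y) * c" for n
      proof (rule AE_I2)
        fix y
        have "norm (?I n y) \<le> (LINT t::real^'n|lebesgue. exp (- (norm t)\<^sup>2))"
        proof -
          have "norm (?I n y) \<le> (LINT t|lebesgue. norm (?F n y t))"
            by (rule integral_norm_bound)
          also have "\<dots> \<le> (LINT t::real^'n|lebesgue. exp (- (norm t)\<^sup>2))"
          proof (rule integral_mono_AE')
            show "integrable lebesgue (\<lambda>t::real^'n. exp (- (norm t)\<^sup>2))" by (rule gauss_int)
            show "AE t in lebesgue. norm (?F n y t) \<le> exp (- (norm t)\<^sup>2)"
              using g_le by (simp add: norm_mult mult_left_le_one_le)
          qed simp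
          finally show ?thesis .
        qed
        then show "norm (w y * ?I n y) \<le> norm (w y) * c"
          by (simp add: norm_mult mult_left_mono c_def gaussian_mass_def)
      qed
      show "(\<lambda>y. w y * ?I n y) \<in> borel_measurable lebesgue" for n
      proof -
        have "(\<lambda>y. LINT t|lebesgue. w y * (?F n y t)) \<in> borel_measurable lebesgue"
        proof (rule integral_measurable_dominated[OF sigma_finite_lebesgue sigma_finite_lebesgue _ integrable_norm[OF w] gauss_int])
          have [measurable]: "(\<lambda>(y, t). ?F n y t) \<in> borel_measurable (lebesgue \<Otimes>\<^sub>M lebesgue)"
            by (intro borel_measurable_pair_lebesgue borel_measurable_continuous_onI continuous_on_compose2[OF g] continuous_intros) auto
          show "(\<lambda>(y, t). w y * (?F n y t)) \<in> borel_measurable (lebesgue \<Otimes>\<^sub>M lebesgue)"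
            by measurable
          show "norm (w y * (?F n y t)) \<le> norm (w y) * exp (- (norm t)\<^sup>2)" for y t
            using g_le by (simp add: norm_mult mult_left_mono mult_left_le_one_le)
        qed
        then show ?thesis by (simp only: integral_mult_right_zero)
      qed
      show "(\<lambda>y. w y * (of_real c * g y)) \<in> borel_measurable lebesgue"
        using continuous_on_imp_borel_measurable_lebesgue[OF g] by measurable
    qed
    then have "(\<lambda>n. 0) \<longlonglongrightarrow> (LINT y|lebesgue. w y * (of_real c * g y))"
      using smoothed[OF g g_int] by simp
    then have "(LINT y|lebesgue. of_real c * (w y * g y)) = 0"
      by (simp only: LIMSEQ_const_iff mult.left_commute[of _ "of_real c"])
    then show ?thesis using c by simp
  qed
  \<comment> \<open>The Gaussian factor makes every bounded continuous test function integrable.\<close>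
  have "AE y in lebesgue. w y * of_real (exp (- (norm y)\<^sup>2)) = 0"
  proof (rule AE_eq_0_of_continuous_tests)
    have e_meas[measurable]: "(\<lambda>t::real^'n. complex_of_real (exp (- (norm t)\<^sup>2))) \<in> borel_measurable lebesgue"
      by (intro continuous_on_imp_borel_measurable_lebesgue continuous_intros)
    show "integrable lebesgue (\<lambda>y. w y * of_real (exp (- (norm y)\<^sup>2)))"
    proof (rule integrable_dominated[OF _ _ integrable_norm[OF w]])
      show "norm (w y * of_real (exp (- (norm y)\<^sup>2))) \<le> norm (w y)" for y
        by (simp add: norm_mult mult_left_le)
    qed measurable
    fix h :: "real^'n \<Rightarrow> complex" assume h: "continuous_on UNIV h" "\<And>x. norm (h x) \<le> 1"
    have "(LINT y|lebesgue. w y * (of_real (exp (- (norm y)\<^sup>2)) * h y)) = 0"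
    proof (rule test)
      show cont: "continuous_on UNIV (\<lambda>y::real^'n. of_real (exp (- (norm y)\<^sup>2)) * h y)"
        by (intro continuous_intros h(1))
      show "integrable lebesgue (\<lambda>y::real^'n. of_real (exp (- (norm y)\<^sup>2)) * h y)"
      proof (rule integrable_dominated[OF _ _ gauss_int])
        show "norm (of_real (exp (- (norm y)\<^sup>2)) * h y) \<le> exp (- (norm y)\<^sup>2)" for y :: "real^'n"
          using h(2) by (simp add: norm_mult mult_left_le)
      qed (rule continuous_on_imp_borel_measurable_lebesgue[OF cont])
      show "norm (of_real (exp (- (norm y)\<^sup>2)) * h y) \<le> 1" for y :: "real^'n"
        using mult_mono[of "exp (- (norm y)\<^sup>2)" 1 "norm (h y)" 1] h(2) by (simp add: norm_mult)
    qed
    then show "(LINT y|lebesgue. w y * of_real (exp (- (norm y)\<^sup>2)) * h y) = 0"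
      by (simp only: mult.assoc)
  qed
  then show ?thesis by eventually_elim simp
qed

text \<open>At real points \<open>B u\<close> is, up to nonvanishing factors, the Fourier transform of
  \<open>e\<^bsup>-|y|\<^sup>2/2\<^esup> u\<close>.\<close>

lemma bargmann_injective:
  fixes u :: "real^'n \<Rightarrow> complex"
  assumes u: "u \<in> L2 lebesgue" and zero: "\<And>z. bargmann u z = 0"
  shows "AE y in lebesgue. u y = 0"
proof -
  note [measurable] = L2_measurable[OF u]
  define w where "w y = of_real (exp (- ((norm y)\<^sup>2 / 2))) * u y" for y :: "real^'n"
  have "AE y in lebesgue. w y = 0"
  proof (rule Fourier_transform_injective)
    show "integrable lebesgue w"
    proof (rule integrable_dominated[OF _ _ L2_gaussian_decay_integrable[OF u, of 0]])
      show "w \<in> borel_measurable lebesgue" unfolding w_def by measurable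
    qed (simp add: w_def norm_mult)
    fix \<xi> :: "real^'n"
    let ?z = "of_real_vec \<xi>"
    have "bargmann u ?z = exp (cdot ?z ?z / 4) * (LINT y|lebesgue. exp (\<i> * of_real (\<xi> \<bullet> y)) * w y)"
      unfolding bargmann_def bargmann_kernel_eq cdot_scale_left cdot_of_real_vec w_def mult.assoc
      by (simp only: integral_mult_right_zero)
    then show "(LINT y|lebesgue. exp (\<i> * of_real (\<xi> \<bullet> y)) * w y) = 0"
      using zero[of ?z] by simp
  qed
  then show ?thesis by eventually_elim (simp add: w_def)
qed

text \<open>The constant \<open>c\<close> in \<open>B\<^sup>* B = c\<close> on \<open>L\<^sup>2(\<real>\<^sup>n)\<close> and \<open>B B\<^sup>* = c\<close> on the Fock space.\<close>

definition bargmann_constant :: "'n::finite itself \<Rightarrow> real" where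
  "bargmann_constant _ = gaussian_mass TYPE('n) * fock_mass TYPE('n)"

lemma bargmann_constant_pos: "0 < bargmann_constant TYPE('n::finite)"
  by (simp add: bargmann_constant_def gaussian_mass_pos fock_mass_pos)

lemma bargmann_dual_exists:
  fixes f :: "complex^'n \<Rightarrow> complex"
  assumes f: "f \<in> L2 fock"
  shows "\<exists>u\<in>L2 lebesgue. \<forall>v\<in>L2 lebesgue. L2_inner fock (bargmann v) f = L2_inner lebesgue v u"
proof (rule L2_Riesz_representation)
  fix u v :: "real^'n \<Rightarrow> complex" and a b
  assume u: "u \<in> L2 lebesgue" and v: "v \<in> L2 lebesgue"
  show "L2_inner fock (bargmann (\<lambda>x. a * u x + b * v x)) f
      = a * L2_inner fock (bargmann u) f + b * L2_inner fock (bargmann v) f"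
    unfolding bargmann_lincomb[OF u v, abs_def]
    by (rule L2_inner_lincomb_left[OF bargmann_L2[OF u] bargmann_L2[OF v] f])
next
  fix u :: "real^'n \<Rightarrow> complex"
  assume u: "u \<in> L2 lebesgue"
  have "(norm (L2_inner fock (bargmann u) f))\<^sup>2 \<le> L2_sqnorm fock (bargmann u) * L2_sqnorm fock f"
    by (rule L2_Cauchy_Schwarz[OF bargmann_L2[OF u] f])
  also have "\<dots> \<le> (schur_constant TYPE('n) * L2_sqnorm lebesgue u) * L2_sqnorm fock f"
    by (intro mult_right_mono bargmann_sqnorm_le[OF u] L2_sqnorm_nonneg)
  finally show "(norm (L2_inner fock (bargmann u) f))\<^sup>2
      \<le> (schur_constant TYPE('n) * L2_sqnorm fock f) * L2_sqnorm lebesgue u"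
    by (simp add: mult_ac)
qed

text \<open>This is \<open>B B\<^sup>* f = c f\<close> for entire \<open>f\<close>, with \<open>u\<close> in the role of \<open>B\<^sup>* f\<close>: evaluate \<open>B u\<close> by a
  coherent state, move \<open>B\<close> to the other side and use the reproducing property.\<close>

lemma bargmann_dual_section:
  fixes f :: "complex^'n \<Rightarrow> complex"
  assumes f: "f \<in> Hol" "f \<in> L2 fock" and u: "u \<in> L2 lebesgue"
    and dual: "\<And>v. v \<in> L2 lebesgue \<Longrightarrow> L2_inner fock (bargmann v) f = L2_inner lebesgue v u"
  shows "bargmann u w = of_real (bargmann_constant TYPE('n)) * f w"
proof -
  have "bargmann u w = cnj (L2_inner lebesgue (coherent_state w) u)"
    unfolding bargmann_eq_inner by (rule L2_inner_commute)
  also have "\<dots> = L2_inner fock f (bargmann (coherent_state w))"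
    unfolding dual[OF coherent_state_L2, symmetric] by (rule L2_inner_commute[symmetric])
  also have "\<dots> = of_real (gaussian_mass TYPE('n)) * L2_inner fock f (\<lambda>z. exp (cdot z (cnj_vec w) / 2))"
    unfolding L2_inner_def bargmann_coherent_state
    by (simp only: complex_cnj_mult complex_cnj_complex_of_real integral_mult_right_zero
        mult.left_commute[of _ "complex_of_real (gaussian_mass TYPE('n))"])
  also have "\<dots> = of_real (bargmann_constant TYPE('n)) * f w"
    unfolding fock_reproducing[OF f] bargmann_constant_def by simp
  finally show ?thesis .
qed

lemma bargmann_surjective:
  fixes f :: "complex^'n \<Rightarrow> complex"
  assumes f: "f \<in> Hol" "f \<in> L2 fock"
  shows "\<exists>u\<in>L2 lebesgue. bargmann u = f"
proof -
  let ?c = "complex_of_real (bargmann_constant TYPE('n))"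
  have c: "?c \<noteq> 0" using bargmann_constant_pos[where 'n='n] by simp
  obtain u where u: "u \<in> L2 lebesgue"
    and dual: "\<And>v. v \<in> L2 lebesgue \<Longrightarrow> L2_inner fock (bargmann v) f = L2_inner lebesgue v u"
    using bargmann_dual_exists[OF f(2)] by blast
  have "bargmann u z = ?c * f z" for z
    by (rule bargmann_dual_section[OF f u dual])
  then have "bargmann (\<lambda>y. inverse ?c * u y + 0 * u y) z = f z" for z
    unfolding bargmann_lincomb[OF u u] using c by simp
  then show ?thesis
    using L2_lincomb[OF u u, of "inverse ?c" 0] by blast
qed

text \<open>For \<open>v' = B\<^sup>* B v\<close> the preceding identity with \<open>f = B v\<close> says \<open>B (v' - c v) = 0\<close>, so
  \<open>v' = c v\<close> almost everywhere by injectivity.\<close>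

lemma bargmann_isometry:
  fixes u v :: "real^'n \<Rightarrow> complex"
  assumes u: "u \<in> L2 lebesgue" and v: "v \<in> L2 lebesgue"
  shows "L2_inner fock (bargmann u) (bargmann v) = of_real (bargmann_constant TYPE('n)) * L2_inner lebesgue u v"
proof -
  let ?c = "complex_of_real (bargmann_constant TYPE('n))"
  obtain v' where v': "v' \<in> L2 lebesgue"
    and dual: "\<And>u. u \<in> L2 lebesgue \<Longrightarrow> L2_inner fock (bargmann u) (bargmann v) = L2_inner lebesgue u v'"
    using bargmann_dual_exists[OF bargmann_L2[OF v]] by blast
  have "bargmann v' z = ?c * bargmann v z" for z
    by (rule bargmann_dual_section[OF bargmann_Hol[OF v] bargmann_L2[OF v] v' dual])
  then have "bargmann (\<lambda>y. 1 * v' y + (- ?c) * v y) z = 0" for z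
    unfolding bargmann_lincomb[OF v' v] by simp
  then have "AE y in lebesgue. 1 * v' y + (- ?c) * v y = 0"
    by (intro bargmann_injective L2_lincomb v v')
  then have AE: "AE y in lebesgue. v' y = ?c * v y + 0 * v y" by eventually_elim simp
  note [measurable] = L2_measurable[OF u] L2_measurable[OF v] L2_measurable[OF v']
  have "L2_inner lebesgue u v' = L2_inner lebesgue u (\<lambda>y. ?c * v y + 0 * v y)"
    unfolding L2_inner_def by (rule integral_cong_AE) (use AE in auto)
  also have "\<dots> = ?c * L2_inner lebesgue u v"
    unfolding L2_inner_lincomb_right[OF v v u] by simp
  finally show ?thesis using dual[OF u] by simp
qed

section \<open>Reduction to the Bargmann transform\<close>

text \<open>The factor is explicit because it carries the dependence on \<open>h\<close>.\<close>

lemma lebesgue_integral_scale: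
  fixes g :: "'a::euclidean_space \<Rightarrow> complex"
  assumes s: "s > 0" and [measurable]: "g \<in> borel_measurable lebesgue"
  shows "(LINT x|lebesgue. g (s *\<^sub>R x)) = of_real (1 / s ^ DIM('a)) * (LINT x|lebesgue. g x)"
proof -
  let ?T = "\<lambda>x::'a. 0 + (\<Sum>j\<in>Basis. (s * (x \<bullet> j)) *\<^sub>R j)"
  have T: "?T = (\<lambda>x. s *\<^sub>R x)"
    by (simp add: fun_eq_iff scaleR_scaleR[symmetric] scaleR_sum_right[symmetric] euclidean_representation
        del: scaleR_scaleR)
  have [measurable]: "(\<lambda>x::'a. s *\<^sub>R x) \<in> lebesgue \<rightarrow>\<^sub>M lebesgue"
    using lebesgue_affine_measurable[of "\<lambda>_::'a. s" 0] s unfolding T by simp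
  have "(lebesgue :: 'a measure) = density (distr lebesgue lebesgue (\<lambda>x. s *\<^sub>R x)) (\<lambda>_. ennreal (s ^ DIM('a)))"
    using lebesgue_affine_euclidean[of "\<lambda>_::'a. s" 0] s unfolding T by simp
  then have "(LINT x|lebesgue. g x)
      = (LINT x|density (distr lebesgue lebesgue (\<lambda>x. s *\<^sub>R x)) (\<lambda>_. ennreal (s ^ DIM('a))). g x)"
    by simp
  also have "\<dots> = (LINT x|distr lebesgue lebesgue (\<lambda>x. s *\<^sub>R x). s ^ DIM('a) *\<^sub>R g x)"
    using s by (subst integral_density) simp_all
  also have "\<dots> = (LINT x|lebesgue. s ^ DIM('a) *\<^sub>R g (s *\<^sub>R x))"
    by (rule integral_distr) measurable
  finally show ?thesis
    using s by (simp add: scaleR_conv_of_real field_simps)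
qed

text \<open>Gram--Schmidt for the inner product defined by \<open>Q\<close>, adding one index at a time; as long as
  an index is missing, some vector lies outside the span of those already found.\<close>

lemma pos_def_orthonormalizing_map:
  fixes Q :: "real^'n^'n"
  assumes "pos_def_matrix Q"
  obtains f :: "'n \<Rightarrow> real^'n" where
    "\<And>i j. f i \<bullet> (Q *v f j) = (if i = j then 1 else 0)"
proof -
  define b where "b x y = x \<bullet> (Q *v y)" for x y
  have pos: "b x x > 0" if "x \<noteq> 0" for x
    using assms that by (simp add: b_def pos_def_matrix_def)
  have sym: "b x y = b y x" for x y
    using assms unfolding b_def pos_def_matrix_def by (metis dot_lmul_matrix inner_commute vector_transpose_matrix)
  have b_add: "b x (y + z) = b x y + b x z" for x y z
    by (simp add: b_def matrix_vector_right_distrib inner_add_right)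
  have b_scale: "b x (r *\<^sub>R y) = r * b x y" for x y r
    by (simp add: b_def matrix_vector_mult_scaleR)
  have b_sum: "b x (\<Sum>j\<in>S. g j) = (\<Sum>j\<in>S. b x (g j))" if "finite S" for x S and g :: "'n \<Rightarrow> real^'n"
    using that by (induction S rule: finite_induct) (simp_all add: b_add, simp add: b_def)
  have "finite S \<Longrightarrow> \<exists>f. \<forall>i\<in>S. \<forall>j\<in>S. b (f i) (f j) = (if i = j then 1 else 0)" for S :: "'n set"
  proof (induction S rule: finite_induct)
    case (insert k S)
    then obtain f where f: "\<And>i j. i \<in> S \<Longrightarrow> j \<in> S \<Longrightarrow> b (f i) (f j) = (if i = j then 1 else 0)" by blast
    have "card (f ` S) < CARD('n)"
      using insert.hyps card_image_le[OF insert.hyps(1), of f] psubset_card_mono[of UNIV S] by (metis card_seteq finite linorder_not_le order_trans top_greatest UNIV_I)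
    then have "dim (span (f ` S)) < DIM(real^'n)"
      using dim_le_card[of "f ` S" "f ` S"] insert.hyps(1) span_superset[of "f ` S"] by simp
    then have "span (f ` S) \<noteq> UNIV" by (metis dim_UNIV less_irrefl)
    then obtain v where v: "v \<notin> span (f ` S)" by blast
    define w where "w = v - (\<Sum>j\<in>S. b (f j) v *\<^sub>R f j)"
    have "w \<noteq> 0"
    proof
      assume "w = 0"
      then have "v = (\<Sum>j\<in>S. b (f j) v *\<^sub>R f j)" by (simp add: w_def)
      also have "\<dots> \<in> span (f ` S)" by (intro span_sum span_scale span_base) auto
      finally show False using v by simp
    qed
    then have w_pos: "b w w > 0" by (rule pos)
    have orth: "b (f i) w = 0" if "i \<in> S" for i
    proof -
      have "v = w + (\<Sum>j\<in>S. b (f j) v *\<^sub>R f j)" by (simp add: w_def)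
      then have "b (f i) v = b (f i) w + b (f i) (\<Sum>j\<in>S. b (f j) v *\<^sub>R f j)"
        using b_add by metis
      also have "b (f i) (\<Sum>j\<in>S. b (f j) v *\<^sub>R f j) = (\<Sum>j\<in>S. b (f j) v * (if i = j then 1 else 0))"
        using f[OF that] by (simp add: b_sum insert.hyps(1) b_scale)
      also have "\<dots> = (\<Sum>j\<in>S. if i = j then b (f j) v else 0)"
        by (intro sum.cong refl) simp
      also have "\<dots> = b (f i) v" using that by simp
      finally show ?thesis by simp
    qed
    define e where "e = (1 / sqrt (b w w)) *\<^sub>R w"
    have e1: "b e e = 1"
      using w_pos by (simp add: e_def b_scale sym[of "_ *\<^sub>R w" w] field_simps)
    have e2: "b (f i) e = 0" if "i \<in> S" for i using orth[OF that] by (simp add: e_def b_scale)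
    have e3: "b e (f i) = 0" if "i \<in> S" for i using e2[OF that] sym by metis
    have "\<forall>i\<in>insert k S. \<forall>j\<in>insert k S. b ((f(k := e)) i) ((f(k := e)) j) = (if i = j then 1 else 0)"
      using insert.hyps(2) f e1 e2 e3 by auto
    then show ?case by blast
  qed simp
  from this[of UNIV] obtain f :: "'n \<Rightarrow> real^'n" where "\<forall>i j. b (f i) (f j) = (if i = j then 1 else 0)" by auto
  then show ?thesis using that[of f] by (simp add: b_def)
qed

text \<open>If \<open>T\<close> is the Bargmann transform preceded by the substitution \<open>R\<close> and a unimodular factor \<open>p\<close>,
  and followed by the substitution \<open>L\<close> and the factor \<open>\<alpha> e\<^sup>e\<close>, then \<open>T\<close> is unitary as soon as \<open>|e\<^sup>e|\<^sup>2\<close>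
  converts one weight into the other and the Jacobian factors \<open>kL\<close>, \<open>kR\<close> balance \<open>\<alpha>\<close>.
  The factor is written as an exponential because its reciprocal has to be entire, too.\<close>

lemma unitary_transfer:
  fixes T :: "(real^'n \<Rightarrow> complex) \<Rightarrow> complex^'n \<Rightarrow> complex"
    and e :: "complex^'n \<Rightarrow> complex" and p :: "real^'n \<Rightarrow> complex"
    and L Li :: "complex^'n \<Rightarrow> complex^'n" and R Ri :: "real^'n \<Rightarrow> real^'n"
  assumes AE_cong: "\<And>u v. (AE y in lebesgue. u y = v y) \<Longrightarrow> u \<in> L2 lebesgue \<Longrightarrow> v \<in> L2 lebesgue \<Longrightarrow> T u = T v"
    and T: "\<And>u x. u \<in> L2 lebesgue \<Longrightarrow>
      T u x = of_real \<alpha> * (exp (e x) * bargmann (\<lambda>v. p v * u (R v)) (L x))"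
    and e: "e \<in> Hol" and p: "continuous_on UNIV p" "\<And>v. norm (p v) = 1"
    and weight: "\<And>x. exp (- 2 * \<Phi> x / h) * (norm (exp (e x)))\<^sup>2 = exp (- ((norm (L x))\<^sup>2 / 2))"
    and L: "linear L" "\<And>c v. L (c *s v) = c *s L v" "\<And>x. Li (L x) = x" "\<And>x. L (Li x) = x"
    and R: "linear R" "\<And>y. Ri (R y) = y" "\<And>y. R (Ri y) = y"
    and kL: "\<And>g. g \<in> borel_measurable lebesgue \<Longrightarrow>
      (LINT x|lebesgue. g (L x)) = complex_of_real kL * (LINT z|lebesgue. g z)"
    and kR: "\<And>g. g \<in> borel_measurable lebesgue \<Longrightarrow>
      (LINT v|lebesgue. g (R v)) = complex_of_real kR * (LINT y|lebesgue. g y)"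
    and const: "\<alpha>\<^sup>2 * kL * bargmann_constant TYPE('n) * kR = 1"
  shows "unitary_L2_onto lebesgue (weighted_lebesgue \<Phi> h) (H_space \<Phi> h) T"
proof -
  let ?W = "\<lambda>x. exp (- 2 * \<Phi> x / h)"
  let ?N = "weighted_lebesgue \<Phi> h"
  let ?w = "\<lambda>z :: complex^'n. exp (- ((norm z)\<^sup>2 / 2))"
  let ?U = "\<lambda>u v. p v * u (R v)"
  have bijL: "bij L" using L(3,4) by (intro o_bij[of Li]) (auto simp: fun_eq_iff)
  have bijR: "bij R" using R(2,3) by (intro o_bij[of Ri]) (auto simp: fun_eq_iff)
  have linLi: "linear Li"
  proof (rule linearI)
    show "Li (a + b) = Li a + Li b" for a b using L(1,3,4) by (metis linear_add)
    show "Li (r *\<^sub>R b) = r *\<^sub>R Li b" for r b using L(1,3,4) by (metis linear_scale)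
  qed
  have Li_scale: "Li (c *s b) = c *s Li b" for c b using L(2-4) by metis
  have linRi: "linear Ri"
  proof (rule linearI)
    show "Ri (a + b) = Ri a + Ri b" for a b using R by (metis linear_add)
    show "Ri (r *\<^sub>R b) = r *\<^sub>R Ri b" for r b using R by (metis linear_scale)
  qed
  have bijRi: "bij Ri" using R(2,3) by (intro o_bij[of R]) (auto simp: fun_eq_iff)
  note R_meas[measurable] = lebesgue_linear_image(1)[OF R(1) bijR]
    and Ri_meas[measurable] = lebesgue_linear_image(1)[OF linRi bijRi]
  have p_meas[measurable]: "p \<in> borel_measurable lebesgue"
    by (rule continuous_on_imp_borel_measurable_lebesgue[OF p(1)])
  have contL: "continuous_on UNIV L" using L(1) by (simp add: linear_continuous_on linear_linear)
  have cont_e: "continuous_on UNIV e" by (rule Hol_continuous[OF e])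
  have W_eq: "?W x = ?w (L x) / (norm (exp (e x)))\<^sup>2" for x
    using weight[of x] by (simp add: field_simps)
  have W_meas[measurable]: "?W \<in> borel_measurable lebesgue"
    unfolding W_eq
    by (intro continuous_on_imp_borel_measurable_lebesgue continuous_intros continuous_on_compose2[OF contL] cont_e) auto
  have \<alpha>: "\<alpha> \<noteq> 0" using const by auto
  note int_L = lebesgue_integrable_linear_iff[OF L(1) bijL]
    and int_R = lebesgue_integrable_linear_iff[OF R(1) bijR]
  have U_L2: "?U u \<in> L2 lebesgue \<longleftrightarrow> u \<in> L2 lebesgue" if u: "u \<in> borel_measurable lebesgue" for u
  proof -
    note [measurable] = u
    have "(\<lambda>v. p v * u (R v)) \<in> borel_measurable lebesgue" by measurable
    moreover have "integrable lebesgue (\<lambda>v. (norm (u (R v)))\<^sup>2) \<longleftrightarrow> integrable lebesgue (\<lambda>y. (norm (u y))\<^sup>2)"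
      by (rule int_R[of "\<lambda>y. (norm (u y))\<^sup>2"]) measurable
    ultimately show ?thesis using u by (simp add: L2_def norm_mult p(2))
  qed
  have U_in: "?U u \<in> L2 lebesgue" if "u \<in> L2 lebesgue" for u
    using U_L2[OF L2_measurable[OF that]] that by blast
  have U_inner: "L2_inner lebesgue (?U u) (?U v) = of_real kR * L2_inner lebesgue u v"
    if u: "u \<in> L2 lebesgue" and v: "v \<in> L2 lebesgue" for u v
  proof -
    note [measurable] = L2_measurable[OF u] L2_measurable[OF v]
    have "p y * cnj (p y) = 1" for y
      by (simp add: complex_norm_square[symmetric] p(2))
    then have "?U u y * cnj (?U v y) = u (R y) * cnj (v (R y))" for y
      by (metis (no_types, opaque_lifting) complex_cnj_mult mult.assoc mult.left_commute mult.right_neutral)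
    then show ?thesis
      unfolding L2_inner_def by (simp only:) (rule kR[of "\<lambda>y. u y * cnj (v y)"], measurable)
  qed
  have M_L2: "(\<lambda>x. exp (e x) * F (L x)) \<in> L2 ?N \<longleftrightarrow> F \<in> L2 fock" if F: "continuous_on UNIV F" for F
  proof -
    have [measurable]: "F \<in> borel_measurable lebesgue" by (rule continuous_on_imp_borel_measurable_lebesgue[OF F])
    have G[measurable]: "(\<lambda>x. exp (e x) * F (L x)) \<in> borel_measurable lebesgue"
      by (intro continuous_on_imp_borel_measurable_lebesgue continuous_intros cont_e continuous_on_compose2[OF F contL]) auto
    have sq: "?W x *\<^sub>R (norm (exp (e x) * F (L x)))\<^sup>2 = ?w (L x) * (norm (F (L x)))\<^sup>2" for x
      unfolding norm_mult power_mult_distrib weight[of x, symmetric] by (simp add: mult.assoc)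
    have "integrable ?N (\<lambda>x. (norm (exp (e x) * F (L x)))\<^sup>2)
        \<longleftrightarrow> integrable lebesgue (\<lambda>x. ?W x *\<^sub>R (norm (exp (e x) * F (L x)))\<^sup>2)"
      unfolding weighted_lebesgue_def by (rule integrable_density[OF _ W_meas]) simp_all
    also have "\<dots> \<longleftrightarrow> integrable lebesgue (\<lambda>z. ?w z * (norm (F z))\<^sup>2)"
      unfolding sq by (rule int_L[of "\<lambda>z. ?w z * (norm (F z))\<^sup>2"]) measurable
    finally show ?thesis
      using G by (simp add: L2_def[of ?N] fock_L2_iff)
  qed
  have cont_B: "continuous_on UNIV (bargmann u)" if "u \<in> L2 lebesgue" for u
    by (rule Hol_continuous[OF bargmann_Hol[OF that]])
  have T_fun: "T u = (\<lambda>x. exp (e x) * (of_real \<alpha> * bargmann (?U u) (L x)))" if "u \<in> L2 lebesgue" for u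
    using T[OF that] by (simp add: fun_eq_iff mult_ac)
  have T_L2: "T u \<in> L2 ?N" if u: "u \<in> L2 lebesgue" for u
    unfolding T_fun[OF u]
    by (subst M_L2[of "\<lambda>z. of_real \<alpha> * bargmann (?U u) z"])
       (intro continuous_intros cont_B U_in u L2_scale bargmann_L2)+
  have T_Hol: "T u \<in> Hol" if u: "u \<in> L2 lebesgue" for u
  proof -
    have "(\<lambda>x. bargmann (?U u) (L x + 0)) \<in> Hol"
      by (rule Hol_compose_affine[OF bargmann_Hol[OF U_in[OF u]] L(1,2)])
    then show ?thesis unfolding T_fun[OF u] by (intro Hol_mult Hol_exp e Hol_const) simp
  qed
  show ?thesis
    unfolding unitary_L2_onto_def
  proof (intro conjI ballI allI impI)
    show "T u = T v" if "u \<in> L2 lebesgue" "v \<in> L2 lebesgue" "AE x in lebesgue. u x = v x" for u v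
      using AE_cong that by blast
    show "T (\<lambda>x. a * u x + b * v x) = (\<lambda>z. a * T u z + b * T v z)"
      if u: "u \<in> L2 lebesgue" and v: "v \<in> L2 lebesgue" for u v a b
    proof -
      have "?U (\<lambda>x. a * u x + b * v x) = (\<lambda>y. a * ?U u y + b * ?U v y)"
        by (simp add: fun_eq_iff algebra_simps)
      then show ?thesis
        unfolding T_fun[OF u] T_fun[OF v] T_fun[OF L2_lincomb[OF u v]]
        by (simp add: bargmann_lincomb[OF U_in[OF u] U_in[OF v]] fun_eq_iff algebra_simps)
    qed
    show "L2_inner ?N (T u) (T v) = L2_inner lebesgue u v"
      if u: "u \<in> L2 lebesgue" and v: "v \<in> L2 lebesgue" for u v
    proof -
      let ?G = "\<lambda>z. of_real (?w z) * (bargmann (?U u) z * cnj (bargmann (?U v) z))"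
      have [measurable]: "T u \<in> borel_measurable lebesgue" "T v \<in> borel_measurable lebesgue"
        using Hol_continuous[OF T_Hol] u v by (auto intro: continuous_on_imp_borel_measurable_lebesgue)
      have [measurable]: "bargmann (?U u) \<in> borel_measurable lebesgue" "bargmann (?U v) \<in> borel_measurable lebesgue"
        using cont_B U_in u v by (auto intro!: continuous_on_imp_borel_measurable_lebesgue)
      have "L2_inner ?N (T u) (T v) = (LINT x|lebesgue. ?W x *\<^sub>R (T u x * cnj (T v x)))"
        unfolding L2_inner_def weighted_lebesgue_def by (rule integral_density[OF _ W_meas]) simp_all
      also have "\<dots> = (LINT x|lebesgue. of_real (\<alpha>\<^sup>2) * ?G (L x))"
      proof (rule Bochner_Integration.integral_cong[OF refl])
        fix x
        have "?W x *\<^sub>R (T u x * cnj (T v x)) = of_real (?W x) * (exp (e x) * cnj (exp (e x)))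
            * (of_real (\<alpha>\<^sup>2) * (bargmann (?U u) (L x) * cnj (bargmann (?U v) (L x))))"
          unfolding T_fun[OF u] T_fun[OF v] by (simp add: scaleR_conv_of_real power2_eq_square mult_ac)
        also have "of_real (?W x) * (exp (e x) * cnj (exp (e x))) = complex_of_real (?w (L x))"
          unfolding complex_norm_square[symmetric] weight[of x, symmetric] by simp
        finally show "?W x *\<^sub>R (T u x * cnj (T v x)) = of_real (\<alpha>\<^sup>2) * ?G (L x)"
          by (simp add: mult_ac)
      qed
      also have "\<dots> = of_real (\<alpha>\<^sup>2) * (of_real kL * (LINT z|lebesgue. ?G z))"
        unfolding integral_mult_right_zero by (subst kL[of ?G]) simp_all
      also have "(LINT z|lebesgue. ?G z) = L2_inner fock (bargmann (?U u)) (bargmann (?U v))"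
        unfolding L2_inner_def by (rule integral_fock[symmetric]) measurable
      also have "\<dots> = of_real (bargmann_constant TYPE('n)) * (of_real kR * L2_inner lebesgue u v)"
        unfolding bargmann_isometry[OF U_in[OF u] U_in[OF v]] U_inner[OF u v] ..
      also have "of_real (\<alpha>\<^sup>2) * (of_real kL * (of_real (bargmann_constant TYPE('n)) * (of_real kR * L2_inner lebesgue u v)))
          = complex_of_real (\<alpha>\<^sup>2 * kL * bargmann_constant TYPE('n) * kR) * L2_inner lebesgue u v"
        by (simp only: of_real_mult mult.assoc)
      finally show ?thesis unfolding const by simp
    qed
    show "H_space \<Phi> h \<subseteq> L2 ?N" by (simp add: H_space_def)
    show "T ` L2 lebesgue = H_space \<Phi> h"
    proof
      show "T ` L2 lebesgue \<subseteq> H_space \<Phi> h"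
        using T_L2 T_Hol by (auto simp: H_space_def)
      show "H_space \<Phi> h \<subseteq> T ` L2 lebesgue"
      proof
        fix f assume "f \<in> H_space \<Phi> h"
        then have f: "f \<in> Hol" "f \<in> L2 ?N" by (auto simp: H_space_def)
        define k where "k x = exp (- 1 * e x) * f x" for x
        define g where "g z = of_real (1 / \<alpha>) * k (Li z + 0)" for z
        have k_Hol: "k \<in> Hol" unfolding k_def by (intro Hol_mult Hol_exp Hol_const e f)
        have g_Hol: "g \<in> Hol"
          unfolding g_def by (intro Hol_mult Hol_const Hol_compose_affine[OF k_Hol linLi Li_scale])
        have f_eq: "f x = exp (e x) * (of_real \<alpha> * g (L x))" for x
          using \<alpha> by (simp add: g_def k_def L(3) exp_minus)
        have "(\<lambda>z. of_real \<alpha> * g z) \<in> L2 fock"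
          using f(2) M_L2[of "\<lambda>z. of_real \<alpha> * g z"] Hol_continuous[OF g_Hol]
          unfolding f_eq[abs_def] by (simp add: continuous_on_mult_left)
        from L2_scale[OF this, of "of_real (1 / \<alpha>)"] have g_L2: "g \<in> L2 fock"
          using \<alpha> by simp
        obtain u' where u': "u' \<in> L2 lebesgue" "bargmann u' = g"
          using bargmann_surjective[OF g_Hol g_L2] by blast
        note [measurable] = L2_measurable[OF u'(1)]
        define u where "u y = cnj (p (Ri y)) * u' (Ri y)" for y
        have u_meas: "u \<in> borel_measurable lebesgue" unfolding u_def by measurable
        have "p v * cnj (p v) = 1" for v
          by (simp add: complex_norm_square[symmetric] p(2))
        then have U_u: "?U u = u'"
          unfolding u_def R(2) by (simp add: fun_eq_iff mult.assoc[symmetric])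
        then have u: "u \<in> L2 lebesgue" using U_L2[OF u_meas] u'(1) by simp
        have "T u = f"
          unfolding T_fun[OF u] U_u u'(2) using f_eq by (simp add: fun_eq_iff)
        then show "f \<in> T ` L2 lebesgue" using u by blast
      qed
    qed
  qed
qed

lemma quadratic_form_at_real_vec:
  fixes D :: "complex^'n^'n" and y :: "real^'n"
  shows "(\<Sum>i\<in>UNIV. \<Sum>j\<in>UNIV. D $ i $ j * of_real_vec y $ i * of_real_vec y $ j)
    = of_real (\<Sum>i\<in>UNIV. \<Sum>j\<in>UNIV. Re (D $ i $ j) * y $ i * y $ j)
      + \<i> * of_real ((y \<bullet> (Im_matrix (D + transpose D) *v y)) / 2)"
proof -
  have entry: "D $ i $ j * of_real_vec y $ i * of_real_vec y $ j
      = of_real (Re (D $ i $ j) * y $ i * y $ j) + \<i> * of_real (Im (D $ i $ j) * y $ i * y $ j)" for i j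
    by (simp add: of_real_vec_def complex_eq_iff)
  have "y \<bullet> (Im_matrix (D + transpose D) *v y)
      = (\<Sum>i\<in>UNIV. \<Sum>j\<in>UNIV. Im (D $ i $ j) * y $ i * y $ j) + (\<Sum>i\<in>UNIV. \<Sum>j\<in>UNIV. Im (D $ j $ i) * y $ i * y $ j)"
    by (simp add: inner_vec_def matrix_vector_mult_def Im_matrix_def transpose_def sum_distrib_left
        sum.distrib algebra_simps)
  also have "(\<Sum>i\<in>UNIV. \<Sum>j\<in>UNIV. Im (D $ j $ i) * y $ i * y $ j) = (\<Sum>i\<in>UNIV. \<Sum>j\<in>UNIV. Im (D $ i $ j) * y $ i * y $ j)"
    by (subst sum.swap) (simp add: mult_ac)
  finally have half: "(y \<bullet> (Im_matrix (D + transpose D) *v y)) / 2 = (\<Sum>i\<in>UNIV. \<Sum>j\<in>UNIV. Im (D $ i $ j) * y $ i * y $ j)"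
    by simp
  show ?thesis
    unfolding entry half by (simp only: sum.distrib of_real_sum sum_distrib_left)
qed

lemma norm_sq_minus_Re_cdot:
  "((norm z)\<^sup>2 - Re (cdot z z)) / 2 = (norm (\<chi> i. Im (z $ i)))\<^sup>2"
  unfolding norm_vec_sq cdot_def
  by (simp add: sum_subtractf[symmetric] sum_divide_distrib cmod_power2) (simp add: power2_eq_square)

text \<open>In adapted coordinates the supremum of the concave quadratic function
  \<open>- Im a - Im z \<cdot> v - |v|\<^sup>2 / 2\<close> is attained at \<open>v = - Im z\<close>, with value \<open>- Im a + |Im z|\<^sup>2 / 2\<close>.
  The right-hand side expresses \<open>|Im z|\<^sup>2\<close> through \<open>|z|\<^sup>2\<close> and the holomorphic \<open>z \<cdot> z\<close>, to be
  absorbed by an entire factor.\<close>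

lemma Phi_weight_eq:
  fixes \<phi> :: "complex^'n \<Rightarrow> complex^'n \<Rightarrow> complex" and R :: "real^'n \<Rightarrow> real^'n"
  assumes \<phi>: "\<And>v. \<phi> x (of_real_vec (R v))
      = a + cdot z (of_real_vec v) + of_real (m v) + \<i> * of_real ((norm v)\<^sup>2 / 2)"
    and R: "surj R"
  shows "Phi_weight \<phi> x = - Im a + ((norm z)\<^sup>2 - Re (cdot z z)) / 4"
proof -
  let ?\<eta> = "\<chi> i. Im (z $ i)"
  have Im_cdot: "Im (cdot z (of_real_vec v)) = ?\<eta> \<bullet> v" for v
    by (simp add: cdot_def of_real_vec_def inner_vec_def)
  have val: "- Im (\<phi> x (of_real_vec (R v))) = - Im a + (norm ?\<eta>)\<^sup>2 / 2 - (norm (?\<eta> + v))\<^sup>2 / 2" for v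
  proof -
    have "(norm (?\<eta> + v))\<^sup>2 = (norm ?\<eta>)\<^sup>2 + 2 * (?\<eta> \<bullet> v) + (norm v)\<^sup>2"
      unfolding power2_norm_eq_inner by (simp add: inner_add inner_commute)
    moreover have "- Im (\<phi> x (of_real_vec (R v))) = - Im a - ?\<eta> \<bullet> v - (norm v)\<^sup>2 / 2"
      unfolding \<phi> by (simp add: Im_cdot del: of_real_divide of_real_power)
    ultimately show ?thesis by (simp add: field_simps)
  qed
  have "Phi_weight \<phi> x = - Im a + (norm ?\<eta>)\<^sup>2 / 2"
    unfolding Phi_weight_def
  proof (rule cSup_eq_maximum)
    have "- Im (\<phi> x (of_real_vec (R (- ?\<eta>)))) = - Im a + (norm ?\<eta>)\<^sup>2 / 2"
      unfolding val by simp
    then show "- Im a + (norm ?\<eta>)\<^sup>2 / 2 \<in> range (\<lambda>y. - Im (\<phi> x (of_real_vec y)))"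
      by (metis rangeI)
    fix t assume "t \<in> range (\<lambda>y. - Im (\<phi> x (of_real_vec y)))"
    then obtain y where "t = - Im (\<phi> x (of_real_vec y))" by blast
    moreover obtain v where "y = R v" using R by (metis surjD)
    ultimately have "t = - Im a + (norm ?\<eta>)\<^sup>2 / 2 - (norm (?\<eta> + v))\<^sup>2 / 2" using val by simp
    then show "t \<le> - Im a + (norm ?\<eta>)\<^sup>2 / 2" by simp
  qed
  then show ?thesis unfolding norm_sq_minus_Re_cdot[symmetric] by simp
qed

theorem theorem1p3p3:
  fixes \<phi> :: "complex^'n::finite \<Rightarrow> complex^'n \<Rightarrow> complex"
  assumes "holomorphic_quadratic_form \<phi>"
    and "det (phi_xy \<phi> 0 0) \<noteq> 0"
    and "pos_def_matrix (Im_matrix (phi_yy \<phi> 0 0))"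
  shows "\<exists>C>0. \<forall>h. 0 < h \<and> h \<le> 1 \<longrightarrow>
           unitary_L2_onto lebesgue (weighted_lebesgue (Phi_weight \<phi>) h)
             (H_space (Phi_weight \<phi>) h) (FBI_transform \<phi> C h)"
proof -
  obtain A B D :: "complex^'n^'n" where \<phi>: "\<And>x y. \<phi> x y
              = (\<Sum>i\<in>UNIV. \<Sum>j\<in>UNIV. A $ i $ j * x $ i * x $ j)
              + (\<Sum>i\<in>UNIV. \<Sum>j\<in>UNIV. B $ i $ j * x $ i * y $ j)
              + (\<Sum>i\<in>UNIV. \<Sum>j\<in>UNIV. D $ i $ j * y $ i * y $ j)"
    using assms(1) unfolding holomorphic_quadratic_form_def by blast
  have B: "det B \<noteq> 0" using assms(2) unfolding phi_xy_quadratic[OF \<phi>] .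
  define Q where "Q = Im_matrix (D + transpose D)"
  have Q: "pos_def_matrix Q" using assms(3) unfolding phi_yy_quadratic[OF \<phi>] Q_def .
  obtain f :: "'n \<Rightarrow> real^'n" where f: "\<And>i j. f i \<bullet> (Q *v f j) = (if i = j then 1 else 0)"
    using pos_def_orthonormalizing_map[OF Q] by blast
  \<comment> \<open>\<open>R\<close> maps the standard basis to a \<open>Q\<close>-orthonormal one.\<close>
  define R where "R v = (\<Sum>i\<in>UNIV. v $ i *\<^sub>R f i)" for v :: "real^'n"
  have R_lin: "linear R"
    by (rule linearI) (simp_all add: R_def scaleR_add_left sum.distrib scaleR_sum_right)
  have R_norm: "R v \<bullet> (Q *v R v) = (norm v)\<^sup>2" for v
  proof -
    have "Q *v R v = (\<Sum>j\<in>UNIV. v $ j *\<^sub>R (Q *v f j))"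
      unfolding R_def using linear_sum[OF matrix_vector_mul_linear[of Q], of "\<lambda>j. v $ j *\<^sub>R f j" UNIV]
      by (simp add: matrix_vector_mult_scaleR)
    then have "R v \<bullet> (Q *v R v) = (\<Sum>j\<in>UNIV. v $ j * (\<Sum>i\<in>UNIV. v $ i * (if i = j then 1 else 0)))"
      by (simp add: R_def inner_sum_left inner_sum_right f)
    also have "\<dots> = (\<Sum>j\<in>UNIV. v $ j * (\<Sum>i\<in>UNIV. if i = j then v $ i else 0))"
      by (intro sum.cong arg_cong2[of _ _ _ _ "(*)"] refl) simp
    also have "\<dots> = (norm v)\<^sup>2"
      unfolding norm_vec_sq by (simp add: power2_eq_square)
    finally show ?thesis .
  qed
  have "inj R"
    unfolding linear_injective_0[OF R_lin]
  proof (intro allI impI)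
    fix v assume "R v = 0"
    then show "v = 0" using R_norm[of v] by simp
  qed
  then have R_bij: "bij R" using linear_injective_imp_surjective[OF R_lin] by (simp add: bij_def)
  \<comment> \<open>\<open>a\<close> is the part of \<open>\<phi>\<close> that depends on \<open>x\<close> alone, \<open>\<zeta> x \<cdot> y\<close> its mixed part, and
    \<open>m\<close> the real part of the remainder at real points; \<open>L\<close> is \<open>\<zeta>\<close> followed by the transpose of \<open>R\<close>.\<close>
  define a where "a x = (\<Sum>i\<in>UNIV. \<Sum>j\<in>UNIV. A $ i $ j * x $ i * x $ j)" for x :: "complex^'n"
  define \<zeta> where "\<zeta> x = transpose B *v x" for x :: "complex^'n"
  define L where "L x = (\<chi> i. cdot (\<zeta> x) (of_real_vec (f i)))" for x :: "complex^'n"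
  define m where "m y = (\<Sum>i\<in>UNIV. \<Sum>j\<in>UNIV. Re (D $ i $ j) * y $ i * y $ j)" for y :: "real^'n"
  have L_R: "cdot (\<zeta> x) (of_real_vec (R v)) = cdot (L x) (of_real_vec v)" for x v
  proof -
    have "of_real_vec (R v) = (\<Sum>i\<in>UNIV. complex_of_real (v $ i) *s of_real_vec (f i))"
      by (simp add: R_def of_real_vec_def vec_eq_iff sum_component)
    then have "cdot (\<zeta> x) (of_real_vec (R v)) = (\<Sum>k\<in>UNIV. \<Sum>i\<in>UNIV. of_real (v $ i) * (\<zeta> x $ k * of_real_vec (f i) $ k))"
      by (simp add: cdot_def sum_component sum_distrib_left mult_ac)
    also have "\<dots> = (\<Sum>i\<in>UNIV. of_real (v $ i) * cdot (\<zeta> x) (of_real_vec (f i)))"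
      by (subst sum.swap) (simp add: cdot_def sum_distrib_left)
    also have "\<dots> = cdot (L x) (of_real_vec v)"
      unfolding cdot_def[of "L x"] by (simp add: L_def of_real_vec_def[of v] mult.commute)
    finally show ?thesis .
  qed
  have \<phi>_eq: "\<phi> x (of_real_vec (R v))
      = a x + cdot (L x) (of_real_vec v) + of_real (m (R v)) + \<i> * of_real ((norm v)\<^sup>2 / 2)" for x v
  proof -
    have "(\<Sum>i\<in>UNIV. \<Sum>j\<in>UNIV. B $ i $ j * x $ i * y $ j) = cdot (\<zeta> x) y" for y
      unfolding \<zeta>_def cdot_def matrix_vector_mult_def transpose_def
      by (simp add: sum_distrib_right) (subst sum.swap, simp)
    then show ?thesis
      unfolding \<phi> quadratic_form_at_real_vec Q_def[symmetric] R_norm L_R[symmetric]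
      by (simp add: a_def m_def)
  qed
  have \<zeta>_lin: "\<zeta> (x + y) = \<zeta> x + \<zeta> y" "\<zeta> (c *s x) = c *s \<zeta> x" for x y c
    by (simp_all add: \<zeta>_def matrix_vector_right_distrib vector_scalar_commute)
  have L_scale: "L (c *s x) = c *s L x" for c x
    by (simp add: L_def \<zeta>_lin cdot_scale_left vec_eq_iff)
  have scaleR_vec: "r *\<^sub>R x = complex_of_real r *s x" for r and x :: "complex^'n"
    by (simp add: vec_eq_iff scaleR_conv_of_real[where 'a=complex])
  have L_lin: "linear L"
  proof (rule linearI)
    show "L (x + y) = L x + L y" for x y by (simp add: L_def \<zeta>_lin cdot_add_left vec_eq_iff)
    show "L (r *\<^sub>R x) = r *\<^sub>R L x" for r x unfolding scaleR_vec by (rule L_scale)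
  qed
  have "inj L"
    unfolding linear_injective_0[OF L_lin]
  proof (intro allI impI)
    fix x assume "L x = 0"
    then have "cdot (\<zeta> x) (of_real_vec (R v)) = 0" for v unfolding L_R by simp
    then have zero: "cdot (\<zeta> x) (of_real_vec y) = 0" for y
      using R_bij by (metis bij_is_surj surjD)
    have "\<zeta> x $ k = cdot (\<zeta> x) (of_real_vec (axis k 1))" for k
      by (simp add: cdot_def of_real_vec_def axis_def if_distrib cong: if_cong)
    then have "\<zeta> x = 0" by (simp add: zero vec_eq_iff)
    moreover have "invertible (transpose B)" using B by (simp add: invertible_det_nz)
    ultimately show "x = 0"
      unfolding \<zeta>_def by (metis invertible_def matrix_left_invertible_ker)
  qed
  then have L_bij: "bij L" using linear_injective_imp_surjective[OF L_lin] by (simp add: bij_def)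
  have Phi: "Phi_weight \<phi> x = - Im (a x) + ((norm (L x))\<^sup>2 - Re (cdot (L x) (L x))) / 4" for x
    by (rule Phi_weight_eq[where R=R]) (rule \<phi>_eq, rule bij_is_surj[OF R_bij])
  have a_Hol: "a \<in> Hol"
    unfolding a_def by (intro Hol_sum[OF finite] Hol_mult[OF Hol_mult[OF Hol_const Hol_nth] Hol_nth])
  have L_Hol: "(\<lambda>x. L x $ i) \<in> Hol" for i
  proof -
    have "(\<lambda>x. \<zeta> x $ k) \<in> Hol" for k
      unfolding \<zeta>_def matrix_vector_mult_def vec_lambda_beta
      by (intro Hol_sum[OF finite] Hol_mult[OF Hol_const Hol_nth])
    then have "(\<lambda>x. cdot (\<zeta> x) (of_real_vec (f i))) \<in> Hol"
      by (intro Hol_cdot Hol_const)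
    then show ?thesis by (simp add: L_def)
  qed
  obtain kR where kR: "kR > 0" "\<And>g :: real^'n \<Rightarrow> complex. g \<in> borel_measurable lebesgue \<Longrightarrow>
      (LINT v|lebesgue. g (R v)) = complex_of_real kR * (LINT y|lebesgue. g y)"
    by (rule lebesgue_linear_change_of_variables[OF R_lin R_bij]) blast
  obtain kL where kL: "kL > 0" "\<And>g :: complex^'n \<Rightarrow> complex. g \<in> borel_measurable lebesgue \<Longrightarrow>
      (LINT x|lebesgue. g (L x)) = complex_of_real kL * (LINT z|lebesgue. g z)"
    by (rule lebesgue_linear_change_of_variables[OF L_lin L_bij]) blast
  let ?c = "bargmann_constant TYPE('n)" and ?n = "CARD('n)"
  have c: "0 < ?c" by (rule bargmann_constant_pos)
  \<comment> \<open>The Jacobians of \<open>R\<close> and \<open>L\<close> and the constant of the Bargmann transform are compensated by \<open>C\<close>.\<close>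
  define C where "C = sqrt (kR / (kL * ?c))"
  have C: "C > 0" "C\<^sup>2 = kR / (kL * ?c)" using kR(1) kL(1) c by (simp_all add: C_def)
  have "unitary_L2_onto lebesgue (weighted_lebesgue (Phi_weight \<phi>) h) (H_space (Phi_weight \<phi>) h) (FBI_transform \<phi> C h)"
    if h: "0 < h" for h
  proof -
    define s where "s = sqrt h"
    have s: "s > 0" "h = s\<^sup>2" using h by (auto simp: s_def)
    \<comment> \<open>The substitutions are scaled by \<open>s = sqrt h\<close>, which removes \<open>h\<close> from the exponent; their
      Jacobians acquire the powers \<open>s\<^bsup>-n\<^esup>\<close> and \<open>s\<^bsup>2n\<^esup>\<close>. The term \<open>- z \<cdot> z / 4\<close> in the exponent \<open>?e\<close>
      compensates the normalisation of the Bargmann kernel.\<close>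
    let ?Rs = "\<lambda>v. s *\<^sub>R R v" and ?Ri = "\<lambda>y. inv R ((1 / s) *\<^sub>R y)"
    let ?Ls = "\<lambda>x. (1 / s) *\<^sub>R L x" and ?Li = "\<lambda>z. inv L (s *\<^sub>R z)"
    let ?e = "\<lambda>x. (\<i> / of_real h) * a x + (- 1 / 4) * cdot (?Ls x) (?Ls x)"
    let ?p = "\<lambda>v. exp (\<i> * of_real (m (?Rs v) / h))"
    let ?kR = "kR * (1 / s ^ ?n)" and ?kL = "kL * s ^ (2 * ?n)"
    let ?\<alpha> = "C * h powr (- 3 * real ?n / 4) / ?kR"
    have Rs: "?Rs v = R (s *\<^sub>R v)" for v using R_lin by (simp add: linear_scale)
    have phase: "exp (\<i> * \<phi> x (of_real_vec (?Rs v)) / of_real h)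
        = exp (?e x) * (bargmann_kernel (?Ls x) v * ?p v)" for x v
    proof -
      have sq: "(norm (s *\<^sub>R v))\<^sup>2 / 2 = h * ((norm v)\<^sup>2 / 2)" by (simp add: s(2) power_mult_distrib)
      have sv: "of_real_vec (s *\<^sub>R v) = complex_of_real s *s of_real_vec v"
        by (simp add: of_real_vec_def vec_eq_iff)
      have "cdot (L x) (of_real_vec (s *\<^sub>R v)) = of_real h * cdot (?Ls x) (of_real_vec v)"
        unfolding sv cdot_scale_right cdot_scaleR_left s(2) using s(1) by (simp add: power2_eq_square)
      then have "\<i> * \<phi> x (of_real_vec (?Rs v)) / of_real h
          = \<i> * (a x + of_real h * cdot (?Ls x) (of_real_vec v) + of_real (m (?Rs v)) + \<i> * of_real (h * ((norm v)\<^sup>2 / 2))) / of_real h"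
        unfolding Rs \<phi>_eq sq by simp
      also have "\<dots> = ?e x + (cdot (?Ls x) (?Ls x) / 4 + \<i> * cdot (?Ls x) (of_real_vec v) - complex_of_real ((norm v)\<^sup>2 / 2))
          + \<i> * of_real (m (?Rs v) / h)"
        using h by (simp add: field_simps)
      finally show ?thesis unfolding bargmann_kernel_def exp_add[symmetric] by (simp only: add.assoc)
    qed
    have scale_meas: "(\<lambda>x. g (r *\<^sub>R x)) \<in> borel_measurable lebesgue"
      if "g \<in> borel_measurable lebesgue" "r > 0" for g :: "'x::euclidean_space \<Rightarrow> complex" and r
    proof -
      have "bij (\<lambda>x::'x. r *\<^sub>R x)"
        using that(2) by (intro o_bij[of "\<lambda>x. (1 / r) *\<^sub>R x"]) (auto simp: fun_eq_iff)
      from measurable_compose[OF lebesgue_linear_image(1)[OF linear_scaleR this] that(1)]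
      show ?thesis .
    qed
    have kRs: "(LINT v|lebesgue. g (?Rs v)) = complex_of_real ?kR * (LINT y|lebesgue. g y)"
      if g: "g \<in> borel_measurable lebesgue" for g
      using kR(2)[OF scale_meas[OF g s(1)]] lebesgue_integral_scale[OF s(1) g] by simp
    have kLs: "(LINT x|lebesgue. g (?Ls x)) = complex_of_real ?kL * (LINT z|lebesgue. g z)"
      if g: "g \<in> borel_measurable lebesgue" for g
    proof -
      have s': "1 / s > 0" using s(1) by simp
      show ?thesis
        using kL(2)[OF scale_meas[OF g s']] lebesgue_integral_scale[OF s' g]
        by (simp add: power_one_over mult.commute[of 2])
    qed
    have contR: "continuous_on UNIV R"
      using R_lin by (simp add: linear_continuous_on linear_linear)
    have kernel_meas: "(\<lambda>y. exp (\<i> * \<phi> x (of_real_vec y) / complex_of_real h) * u y) \<in> borel_measurable lebesgue"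
      if "u \<in> L2 lebesgue" for u :: "real^'n \<Rightarrow> complex" and x
    proof (rule borel_measurable_times[OF _ L2_measurable[OF that]])
      show "(\<lambda>y. exp (\<i> * \<phi> x (of_real_vec y) / complex_of_real h)) \<in> borel_measurable lebesgue"
        unfolding \<phi> of_real_vec_def by (intro continuous_on_imp_borel_measurable_lebesgue continuous_intros) (use h in auto)
    qed
    have Ls_Hol: "(\<lambda>x. ?Ls x $ i) \<in> Hol" for i
    proof -
      have "(\<lambda>x. complex_of_real (1 / s) * L x $ i) \<in> Hol"
        by (rule Hol_mult[OF Hol_const L_Hol])
      then show ?thesis unfolding scaleR_vec by simp
    qed
    show ?thesis
    proof (rule unitary_transfer[where e="?e" and p="?p" and L="?Ls" and Li="?Li" and R="?Rs" and Ri="?Ri"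
          and \<alpha>="?\<alpha>" and kL="?kL" and kR="?kR"])
      show "FBI_transform \<phi> C h u = FBI_transform \<phi> C h v"
        if "AE y in lebesgue. u y = v y" "u \<in> L2 lebesgue" "v \<in> L2 lebesgue" for u v
      proof -
        have "(LINT y|lebesgue. exp (\<i> * \<phi> x (of_real_vec y) / complex_of_real h) * u y)
            = (LINT y|lebesgue. exp (\<i> * \<phi> x (of_real_vec y) / complex_of_real h) * v y)" for x
          by (rule integral_cong_AE[OF kernel_meas[OF that(2)] kernel_meas[OF that(3)]])
             (use that(1) in \<open>eventually_elim, simp\<close>)
        then show ?thesis by (simp add: FBI_transform_def fun_eq_iff)
      qed
      show "FBI_transform \<phi> C h u x = of_real ?\<alpha> * (exp (?e x) * bargmann (\<lambda>v. ?p v * u (?Rs v)) (?Ls x))"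
        if u: "u \<in> L2 lebesgue" for u x
      proof -
        let ?F = "\<lambda>y. exp (\<i> * \<phi> x (of_real_vec y) / complex_of_real h) * u y"
        have "of_real ?kR * (LINT y|lebesgue. ?F y) = (LINT v|lebesgue. ?F (?Rs v))"
          by (rule kRs[OF kernel_meas[OF u], symmetric])
        also have "\<dots> = exp (?e x) * bargmann (\<lambda>v. ?p v * u (?Rs v)) (?Ls x)"
          unfolding phase bargmann_def mult.assoc by (rule integral_mult_right_zero)
        finally have "(LINT y|lebesgue. ?F y)
            = of_real (1 / ?kR) * (exp (?e x) * bargmann (\<lambda>v. ?p v * u (?Rs v)) (?Ls x))"
          using kR(1) s(1) by (simp add: field_simps)
        then show ?thesis
          unfolding FBI_transform_def by (simp only: mult.assoc[symmetric] of_real_mult[symmetric]) simp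
      qed
      show "?e \<in> Hol"
        by (intro Hol_add[OF Hol_mult[OF Hol_const a_Hol] Hol_mult[OF Hol_const Hol_cdot]] Ls_Hol)
      show "continuous_on UNIV ?p"
        unfolding m_def by (intro continuous_intros contR) (use h in simp)
      show "norm (?p v) = 1" for v by (simp add: norm_exp_eq_Re)
      show "exp (- 2 * Phi_weight \<phi> x / h) * (norm (exp (?e x)))\<^sup>2 = exp (- ((norm (?Ls x))\<^sup>2 / 2))" for x
      proof -
        have "cdot (?Ls x) (?Ls x) = of_real (1 / h) * cdot (L x) (L x)"
          unfolding scaleR_vec cdot_scale_left cdot_scale_right s(2) by (simp add: power2_eq_square)
        then have e_eq: "Re (?e x) = - Im (a x) / h - Re (cdot (L x) (L x)) / (4 * h)"
          using h by (simp add: field_simps)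
        have n_eq: "(norm (?Ls x))\<^sup>2 = (norm (L x))\<^sup>2 / h"
          using s(1) by (simp add: power_mult_distrib power_divide s(2))
        have "- 2 * Phi_weight \<phi> x / h + 2 * Re (?e x) = - ((norm (?Ls x))\<^sup>2 / 2)"
          unfolding Phi e_eq n_eq using h by (simp add: field_simps)
        then show ?thesis
          unfolding norm_exp_eq_Re exp_double[symmetric] exp_add[symmetric] by simp
      qed
      show "linear ?Ls" using L_lin by (rule linear_compose_scale_right)
      show "?Ls (c *s v) = c *s ?Ls v" for c v unfolding L_scale scaleR_vec by (simp add: vec_eq_iff)
      show "?Li (?Ls x) = x" for x using s(1) L_bij by (simp add: bij_is_inj)
      show "?Ls (?Li x) = x" for x using s(1) L_bij by (simp add: bij_is_surj surj_f_inv_f)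
      show "linear ?Rs" using R_lin by (rule linear_compose_scale_right)
      show "?Ri (?Rs x) = x" for x using s(1) R_bij by (simp add: bij_is_inj)
      show "?Rs (?Ri x) = x" for x using s(1) R_bij by (simp add: bij_is_surj surj_f_inv_f)
      show "(LINT x|lebesgue. g (?Ls x)) = complex_of_real ?kL * (LINT z|lebesgue. g z)"
        if g: "g \<in> borel_measurable lebesgue" for g
        by (rule kLs[OF g])
      show "(LINT v|lebesgue. g (?Rs v)) = complex_of_real ?kR * (LINT y|lebesgue. g y)"
        if g: "g \<in> borel_measurable lebesgue" for g
        by (rule kRs[OF g])
      \<comment> \<open>All powers of \<open>s\<close> cancel: \<open>h\<^bsup>-3n/2\<^esup> = s\<^bsup>-3n\<^esup>\<close> meets \<open>s\<^bsup>2n\<^esup>\<close> and, from \<open>?kR\<close>, \<open>s\<^sup>n\<close>.\<close>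
      show "?\<alpha>\<^sup>2 * ?kL * ?c * ?kR = 1"
      proof -
        have "(h powr (- 3 * real ?n / 4))\<^sup>2 = h powr (- 3 * real ?n / 4 * 2)"
          using h by (simp add: powr_powr flip: powr_numeral)
        also have "\<dots> = s powr (- 3 * real ?n)"
          using s(1) unfolding s(2) by (simp add: powr_powr flip: powr_numeral)
        also have "\<dots> = 1 / s ^ (3 * ?n)"
          using s(1) by (simp add: powr_minus_divide powr_realpow[symmetric])
        finally have "?\<alpha>\<^sup>2 = kR / (kL * ?c) * (1 / s ^ (3 * ?n)) / ?kR\<^sup>2"
          by (simp add: power_mult_distrib power_divide C(2))
        moreover have "s ^ (3 * ?n) = s ^ ?n * s ^ (2 * ?n)"
          by (simp flip: power_add)
        ultimately show ?thesis
          using kR(1) kL(1) c s(1) by (simp add: field_simps power2_eq_square)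
      qed
    qed
  qed
  then show ?thesis using C(1) by blast
qed

end
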